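(* Let $G$ be a locally compact second countable group. A nonsingular $G$-space $(X,\mu)$ is totally dissipative if and only if it is isomorphic to the Krengel $G$-space associated with its random compact subgroup; that is, if and only if there exist a $G$-invariant $\mu$-conull Borel set $X_1\subseteq X$ all of whose points have compact stabilizers, a Borel transversal $W\subseteq X_1$ for the orbit equivalence relation on $X_1$ with associated Borel selector $s:X_1\to W$, and a probability measure $\mu'\sim\mu$, such that $(X,\mu)$ is isomorphic, as a nonsingular $G$-space, to the Krengel $G$-space constructed out of the random compact subgroup $(W,s_*\mu')\to\mathbf{K}_{\mathrm{gr}}(G)$, $w\mapsto G_w$.
   Context: Fix a left Haar measure $\lambda$ on $G$. A Borel $G$-space is a standard Borel space $X$ with a Borel action map $G\times X\to X$, $(g,x)\mapsto g.x$. A nonsingular $G$-space is a Borel $G$-space $X$ with a (nonzero) $\sigma$-finite Borel measure $\mu$ such that $\mu\circ g\sim\mu$ for all $g\in G$, where $(\mu\circ g)(A)=\mu(g.A)$. The stabilizer of $x$ is $G_x=\{g\in G:g.x=x\}$. A Borel transversal is a Borel set meeting every orbit in exactly one point; its associated selector $s$ sends $x$ to the unique point of its orbit in the transversal. Two nonsingular $G$-spaces $(X,\mu)$, $(Y,\nu)$ are isomorphic if there are $G$-invariant conull sets $X_o\subseteq X$, $Y_o\subseteq Y$ and a Borel bijection $\varphi:X_o\to Y_o$ with $\varphi_*\mu\sim\nu$ and, for every $g\in G$, $\varphi(g.x)=g.\varphi(x)$ for $\mu$-a.e. $x\in X_o$. The Radon--Nikodym cocycle is a Borel map $\nabla:G\times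 X\to\mathbb{R}_{>0}$ satisfying $\nabla_e(x)=1$, $\nabla_{gh}(x)=\nabla_g(h.x)\nabla_h(x)$ for all $g,h,x$, and $\nabla_g=\frac{d\mu\circ g}{d\mu}$ $\mu$-a.e. for each $g$. $L^1_+(X,\mu)$ is the class of everywhere strictly positive functions in $L^1(X,\mu)$, and $S_f^G(x)=\int_G\nabla_g(x)f(g.x)\,d\lambda(g)$. The Hopf decomposition is the essentially unique decomposition $X=\mathcal{C}\sqcup\mathcal{D}$ into $G$-invariant Borel sets such that for every $f\in L^1_+(X,\mu)$, modulo $\mu$, $\mathcal{C}=\{S_f^G=+\infty\}$ and $\mathcal{D}=\{S_f^G<+\infty\}$. $(X,\mu)$ is totally dissipative if $\mu(\mathcal{C})=0$. $\mathbf{F}(G)$ is the standard Borel space of closed subsets of $G$ (Effros Borel structure, generated by the sets $\{F:F\cap U\neq\emptyset\}$, $U\subseteq G$ open), on which $G$ acts by left translation, and $\mathbf{K}_{\mathrm{gr}}(G)\subset\mathbf{F}(G)$ is the Borel subset of compact subgroups. A random compact subgroup of $G$ is a standard probability space $(W_o,\nu_o)$ with a Borel map $\psi_o:W_o\to\mathbf{K}_{\mathrm{gr}}(G)$. The Krengel $G$-space $(X_o,\mu_o)$ constructed out of it is the following: $X_o=\{(w,g\psi_o(w)):w\in W_o,g\in G\}$, a Borel subset of $W_o\times\mathbf{F}(G)$, with action $g.(w,h\psi_o(w))=(w,gh\psi_o(w))$, and $\mu_o=\int_{W_o}\delta_{\{w\}}\otimes\kappa_w\,d\nu_o(w)$,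 where for each $w$, $\kappa_w$ is a probability measure in the (unique) measure class of the nonzero $\sigma$-finite $G$-invariant measure on $G/\psi_o(w)$, chosen measurably in $w$ (for instance the image under $g\mapsto g\psi_o(w)$ of a fixed probability measure equivalent to $\lambda$). The measure class of $\mu_o$ does not depend on the choice of the $\kappa_w$. *)

theory Defs
  imports "HOL-Probability.Probability"
begin

text \<open>
  Groups are written additively: the library's class of topological groups is
  \<open>topological_group_add\<close>, whose operation is not assumed commutative.  Thus \<open>0\<close> is the identity \<open>e\<close>,
  \<open>g + h\<close> is the product \<open>g h\<close> and \<open>- g\<close> is the inverse of \<open>g\<close>.
  A measure space is a value of type \<open>'x measure\<close>; its underlying set may be a proper subset
  of the type \<open>'x\<close>.
\<close>

subsection \<open>Haar measure and measure classes\<close>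

definition left_haar_measure :: "'g::topological_group_add measure \<Rightarrow> bool" where
  "left_haar_measure haar \<longleftrightarrow>
     sets haar = sets borel \<and>
     emeasure haar UNIV \<noteq> 0 \<and>
     (\<forall>K. compact K \<longrightarrow> emeasure haar K < \<infinity>) \<and>
     (\<forall>g. distr haar borel (\<lambda>h. g + h) = haar)"

definition measure_equiv :: "'x measure \<Rightarrow> 'x measure \<Rightarrow> bool" where
  "measure_equiv M N \<longleftrightarrow>
     sets M = sets N \<and> absolutely_continuous M N \<and> absolutely_continuous N M"

subsection \<open>Nonsingular spaces\<close>

definition standard_borel :: "'x measure \<Rightarrow> bool" where
  "standard_borel M \<longleftrightarrow>
     (\<exists>T. completely_metrizable_space T \<and> second_countable T \<and> topspace T = space M \<and>
          sets M = sigma_sets (space M) {U. openin T U})"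

definition borel_G_space :: "'x measure \<Rightarrow> ('g::topological_group_add \<Rightarrow> 'x \<Rightarrow> 'x) \<Rightarrow> bool" where
  "borel_G_space M act \<longleftrightarrow>
     standard_borel M \<and>
     (\<lambda>(g, x). act g x) \<in> measurable (borel \<Otimes>\<^sub>M M) M \<and>
     (\<forall>x\<in>space M. act 0 x = x) \<and>
     (\<forall>g h. \<forall>x\<in>space M. act (g + h) x = act g (act h x))"

text \<open>The measure \<open>\<mu> \<circ> g\<close>, \<open>A \<mapsto> \<mu> (g.A)\<close>, is the image of \<open>\<mu>\<close> under the action of \<open>- g\<close>.\<close>

definition translate_measure :: "'x measure \<Rightarrow> ('g::group_add \<Rightarrow> 'x \<Rightarrow> 'x) \<Rightarrow> 'g \<Rightarrow> 'x measure" where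
  "translate_measure M act g = distr M M (act (- g))"

definition nonsingular_G_space :: "'x measure \<Rightarrow> ('g::topological_group_add \<Rightarrow> 'x \<Rightarrow> 'x) \<Rightarrow> bool" where
  "nonsingular_G_space M act \<longleftrightarrow>
     borel_G_space M act \<and> sigma_finite_measure M \<and> emeasure M (space M) \<noteq> 0 \<and>
     (\<forall>g. measure_equiv (translate_measure M act g) M)"

definition stabilizer :: "('g \<Rightarrow> 'x \<Rightarrow> 'x) \<Rightarrow> 'x \<Rightarrow> 'g set" where
  "stabilizer act x = {g. act g x = x}"

definition orbit :: "('g \<Rightarrow> 'x \<Rightarrow> 'x) \<Rightarrow> 'x \<Rightarrow> 'x set" where
  "orbit act x = range (\<lambda>g. act g x)"

definition invariant_set :: "('g \<Rightarrow> 'x \<Rightarrow> 'x) \<Rightarrow> 'x set \<Rightarrow> bool" where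
  "invariant_set act A \<longleftrightarrow> (\<forall>g. \<forall>x\<in>A. act g x \<in> A)"

definition invariant_conull_borel :: "'x measure \<Rightarrow> ('g \<Rightarrow> 'x \<Rightarrow> 'x) \<Rightarrow> 'x set \<Rightarrow> bool" where
  "invariant_conull_borel M act A \<longleftrightarrow>
     A \<in> sets M \<and> invariant_set act A \<and> space M - A \<in> null_sets M"

definition borel_transversal :: "'x measure \<Rightarrow> ('g \<Rightarrow> 'x \<Rightarrow> 'x) \<Rightarrow> 'x set \<Rightarrow> 'x set \<Rightarrow> bool" where
  "borel_transversal M act A W \<longleftrightarrow>
     W \<in> sets M \<and> W \<subseteq> A \<and> (\<forall>x\<in>A. \<exists>!w. w \<in> W \<and> w \<in> orbit act x)"

definition borel_selector ::
  "'x measure \<Rightarrow> ('g \<Rightarrow> 'x \<Rightarrow> 'x) \<Rightarrow> 'x set \<Rightarrow> 'x set \<Rightarrow> ('x \<Rightarrow> 'x) \<Rightarrow> bool" where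
  "borel_selector M act A W s \<longleftrightarrow>
     s \<in> measurable (restrict_space M A) (restrict_space M W) \<and>
     (\<forall>x\<in>A. s x \<in> W \<and> s x \<in> orbit act x)"

text \<open>
  In standard Borel spaces the inverse of the Borel bijection below is automatically Borel.
\<close>

definition isomorphic_G_spaces ::
  "'x measure \<Rightarrow> ('g \<Rightarrow> 'x \<Rightarrow> 'x) \<Rightarrow> 'y measure \<Rightarrow> ('g \<Rightarrow> 'y \<Rightarrow> 'y) \<Rightarrow> bool" where
  "isomorphic_G_spaces M actM N actN \<longleftrightarrow>
     (\<exists>X Y \<phi>. invariant_conull_borel M actM X \<and> invariant_conull_borel N actN Y \<and>
        bij_betw \<phi> X Y \<and>
        \<phi> \<in> measurable (restrict_space M X) (restrict_space N Y) \<and>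
        measure_equiv (distr (restrict_space M X) (restrict_space N Y) \<phi>) (restrict_space N Y) \<and>
        (\<forall>g. AE x in M. x \<in> X \<longrightarrow> \<phi> (actM g x) = actN g (\<phi> x)))"

subsection \<open>Hopf decomposition\<close>

definition rn_cocycle ::
  "'x measure \<Rightarrow> ('g::topological_group_add \<Rightarrow> 'x \<Rightarrow> 'x) \<Rightarrow> ('g \<Rightarrow> 'x \<Rightarrow> real) \<Rightarrow> bool" where
  "rn_cocycle M act D \<longleftrightarrow>
     (\<lambda>(g, x). D g x) \<in> borel_measurable (borel \<Otimes>\<^sub>M M) \<and>
     (\<forall>g. \<forall>x\<in>space M. D g x > 0) \<and>
     (\<forall>x\<in>space M. D 0 x = 1) \<and>
     (\<forall>g h. \<forall>x\<in>space M. D (g + h) x = D g (act h x) * D h x) \<and>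
     (\<forall>g. AE x in M. ennreal (D g x) = RN_deriv M (translate_measure M act g) x)"

definition L1_plus :: "'x measure \<Rightarrow> ('x \<Rightarrow> real) set" where
  "L1_plus M = {f. integrable M f \<and> (\<forall>x\<in>space M. f x > 0)}"

definition hopf_sum ::
  "'g measure \<Rightarrow> ('g \<Rightarrow> 'x \<Rightarrow> 'x) \<Rightarrow> ('g \<Rightarrow> 'x \<Rightarrow> real) \<Rightarrow> ('x \<Rightarrow> real) \<Rightarrow> 'x \<Rightarrow> ennreal" where
  "hopf_sum haar act D f x = (\<integral>\<^sup>+g. ennreal (D g x * f (act g x)) \<partial>haar)"

definition hopf_decomposition ::
  "'g measure \<Rightarrow> 'x measure \<Rightarrow> ('g \<Rightarrow> 'x \<Rightarrow> 'x) \<Rightarrow> ('g \<Rightarrow> 'x \<Rightarrow> real) \<Rightarrow> 'x set \<Rightarrow> 'x set \<Rightarrow> bool" where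
  "hopf_decomposition haar M act D Con Dis \<longleftrightarrow>
     Con \<in> sets M \<and> Dis \<in> sets M \<and> Con \<union> Dis = space M \<and> Con \<inter> Dis = {} \<and>
     invariant_set act Con \<and> invariant_set act Dis \<and>
     (\<forall>f\<in>L1_plus M.
        (AE x in M. x \<in> Con \<longleftrightarrow> hopf_sum haar act D f x = \<infinity>) \<and>
        (AE x in M. x \<in> Dis \<longleftrightarrow> hopf_sum haar act D f x < \<infinity>))"

text \<open>
  A Radon--Nikodym cocycle exists for every nonsingular space of a locally compact second
  countable group, and any two agree almost everywhere for each \<open>g\<close>; by Fubini the
  decomposition does not depend, modulo null sets, on which one is taken.
\<close>

definition totally_dissipative ::
  "'g::topological_group_add measure \<Rightarrow> 'x measure \<Rightarrow> ('g \<Rightarrow> 'x \<Rightarrow> 'x) \<Rightarrow> bool" where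
  "totally_dissipative haar M act \<longleftrightarrow>
     (\<exists>D Con Dis. rn_cocycle M act D \<and> hopf_decomposition haar M act D Con Dis \<and> emeasure M Con = 0)"

subsection \<open>Random compact subgroups and Krengel spaces\<close>

definition effros :: "'g::topological_space set measure" where
  "effros = sigma {F. closed F} {{F. closed F \<and> F \<inter> U \<noteq> {}} | U. open U}"

definition compact_subgroups :: "'g::topological_group_add set set" where
  "compact_subgroups =
     {K. compact K \<and> 0 \<in> K \<and> (\<forall>g\<in>K. \<forall>h\<in>K. g + h \<in> K) \<and> (\<forall>g\<in>K. - g \<in> K)}"

definition random_compact_subgroup ::
  "'w measure \<Rightarrow> ('w \<Rightarrow> 'g::topological_group_add set) \<Rightarrow> bool" where
  "random_compact_subgroup \<nu> \<psi> \<longleftrightarrow>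
     prob_space \<nu> \<and> standard_borel \<nu> \<and>
     \<psi> \<in> measurable \<nu> (restrict_space effros compact_subgroups)"

definition left_translate :: "'g::plus \<Rightarrow> 'g set \<Rightarrow> 'g set" where
  "left_translate g F = (\<lambda>h. g + h) ` F"

definition left_cosets :: "'g::plus set \<Rightarrow> 'g set set" where
  "left_cosets K = range (\<lambda>g. left_translate g K)"

text \<open>
  Measures on \<open>G/K\<close> are represented as measures on the Effros space concentrated on the
  left cosets of \<open>K\<close>.
\<close>

definition invariant_coset_measure ::
  "'g::topological_group_add set \<Rightarrow> 'g set measure \<Rightarrow> bool" where
  "invariant_coset_measure K m \<longleftrightarrow>
     sets m = sets effros \<and> (AE F in m. F \<in> left_cosets K) \<and>
     sigma_finite_measure m \<and> emeasure m (space m) \<noteq> 0 \<and>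
     (\<forall>g. distr m effros (left_translate g) = m)"

definition krengel_kernel ::
  "'w measure \<Rightarrow> ('w \<Rightarrow> 'g::topological_group_add set) \<Rightarrow> ('w \<Rightarrow> 'g set measure) \<Rightarrow> bool" where
  "krengel_kernel \<nu> \<psi> \<kappa> \<longleftrightarrow>
     \<kappa> \<in> measurable \<nu> (prob_algebra effros) \<and>
     (\<forall>w\<in>space \<nu>. \<exists>m. invariant_coset_measure (\<psi> w) m \<and> measure_equiv (\<kappa> w) m)"

definition krengel_set :: "'w measure \<Rightarrow> ('w \<Rightarrow> 'g::plus set) \<Rightarrow> ('w \<times> 'g set) set" where
  "krengel_set \<nu> \<psi> = {(w, left_translate g (\<psi> w)) | w g. w \<in> space \<nu>}"

definition krengel_measure ::
  "'w measure \<Rightarrow> ('w \<Rightarrow> 'g::topological_group_add set) \<Rightarrow> ('w \<Rightarrow> 'g set measure)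
     \<Rightarrow> ('w \<times> 'g set) measure" where
  "krengel_measure \<nu> \<psi> \<kappa> =
     restrict_space (Giry_Monad.bind \<nu> (\<lambda>w. return \<nu> w \<Otimes>\<^sub>M \<kappa> w)) (krengel_set \<nu> \<psi>)"

definition krengel_act :: "'g::plus \<Rightarrow> 'w \<times> 'g set \<Rightarrow> 'w \<times> 'g set" where
  "krengel_act g = (\<lambda>(w, F). (w, left_translate g F))"

text \<open>
  The kernel \<open>\<kappa>\<close> affects the Krengel space only within its measure class, which isomorphism
  does not see; so being isomorphic to it for some admissible \<open>\<kappa>\<close> is the same as for all.
\<close>

definition isomorphic_to_krengel_space ::
  "'x measure \<Rightarrow> ('g::topological_group_add \<Rightarrow> 'x \<Rightarrow> 'x)
     \<Rightarrow> 'w measure \<Rightarrow> ('w \<Rightarrow> 'g set) \<Rightarrow> bool" where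
  "isomorphic_to_krengel_space M act \<nu> \<psi> \<longleftrightarrow>
     (\<exists>\<kappa>. krengel_kernel \<nu> \<psi> \<kappa> \<and>
          isomorphic_G_spaces M act (krengel_measure \<nu> \<psi> \<kappa>) krengel_act)"

end

theory Submission
  imports Defs
begin

text \<open>
  If \<open>M\<close> is totally dissipative, the functions \<open>g \<mapsto> D g x * f (act g x)\<close> are, after normalisation,
  probability densities on the group, equivariant in \<open>x\<close> for right translation.  Integrating a
  bump function against them gives a function \<open>F\<close> on the space that is continuous along orbits and
  tends to \<open>0\<close> at infinity along orbits; so the points where \<open>-F\<close> is minimal along
  their orbit form a compact subset of that orbit, and stabilizers are compact.  Countably
  many Borel functions that are continuous along orbits and separate points are then minimised
  lexicographically on this compact set, which selects one point of each orbit.  The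
  isomorphism is \<open>x \<mapsto> (s x, {g. act g (s x) = x})\<close>; it preserves the measure class because both
  sides have the null sets of the image of \<open>\<nu> \<Otimes> haar\<close> under \<open>(w, g) \<mapsto> act g w\<close>.

  Conversely, a transversal with compact stabilizers gives an invariant measure equivalent to \<open>M\<close>,
  namely that same image.  If \<open>p\<close> is the density of \<open>M\<close> with respect to it, then
  \<open>D g x = p (act g x) / p x\<close> is a Radon--Nikodym cocycle, for which the Hopf sums are finite by
  Fubini's theorem.
\<close>

subsection \<open>Borel subsets of standard Borel spaces\<close>

text \<open>The obstacle is measurability. A set defined by quantifying over the group, such as the
  points whose orbit meets a given Borel set, is in general only analytic. Continuity along orbits
  repairs this: for closed conditions that are continuous in the group variable, compactness reduces
  an existential quantifier over the group to countably many approximate conditions on a countable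
  dense set (\<open>sets_ex_in_open\<close>). Hence one generating family of functions continuous
  along orbits (\<open>gen\<close>) is fixed; it serves to select the transversal, to make
  stabilizers and cosets depend measurably on the point, and to show that the Krengel set is Borel.
  A second theme is that replacing the base point \<open>x\<close> by \<open>act h x\<close>
  translates the group variable on the right, whereas \<open>haar\<close> is left invariant. Right
  translation multiplies \<open>haar\<close> by a constant, which preserves null sets and finiteness
  and cancels in quotients. The topological preliminaries are there because a random compact
  subgroup lives on a standard space, so the Borel set \<open>W\<close> has to be shown
  standard.\<close>

lemma gdelta_in_continuous_map_preimage:
  assumes f: "continuous_map X Y f" and S: "gdelta_in Y S"
  shows "gdelta_in X {x \<in> topspace X. f x \<in> S}"
proof -
  obtain \<U> where \<U>: "countable \<U>" "\<And>U. U \<in> \<U> \<Longrightarrow> openin Y U" "\<Inter>\<U> = S" "S \<subseteq> topspace Y"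
    using S unfolding gdelta_in_alt intersection_of_def by auto
  \<comment> \<open>\<open>topspace Y\<close> is inserted because an intersection of G-delta sets
    needs a nonempty family.\<close>
  have "gdelta_in X (\<Inter>((\<lambda>U. {x \<in> topspace X. f x \<in> U}) ` insert (topspace Y) \<U>))"
    using \<U> f by (intro gdelta_in_Inter) (auto intro!: open_imp_gdelta_in openin_continuous_map_preimage)
  also have "(\<Inter>((\<lambda>U. {x \<in> topspace X. f x \<in> U}) ` insert (topspace Y) \<U>)) = {x \<in> topspace X. f x \<in> S}"
    using \<U> f continuous_map_image_subset_topspace[OF f] by auto
  finally show ?thesis .
qed

lemma second_countable_prod_topology:
  assumes "second_countable X" "second_countable Y"
  shows "second_countable (prod_topology X Y)"
proof -
  obtain \<B> \<C> where B: "countable \<B>" "\<And>V. V \<in> \<B> \<Longrightarrow> openin X V"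
      "\<And>U x. openin X U \<Longrightarrow> x \<in> U \<Longrightarrow> \<exists>V\<in>\<B>. x \<in> V \<and> V \<subseteq> U"
    and C: "countable \<C>" "\<And>V. V \<in> \<C> \<Longrightarrow> openin Y V"
      "\<And>U x. openin Y U \<Longrightarrow> x \<in> U \<Longrightarrow> \<exists>V\<in>\<C>. x \<in> V \<and> V \<subseteq> U"
    using assms unfolding second_countable_def by metis
  let ?D = "(\<lambda>(V,W). V \<times> W) ` (\<B> \<times> \<C>)"
  have "\<exists>V\<in>?D. z \<in> V \<and> V \<subseteq> U" if zU: "openin (prod_topology X Y) U" "z \<in> U" for U z
  proof -
    obtain a b where z: "z = (a,b)" by (cases z)
    obtain V W where "openin X V" "openin Y W" "a \<in> V" "b \<in> W" "V \<times> W \<subseteq> U"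
      using zU(1)[unfolded openin_prod_topology_alt, rule_format, of a b] zU(2) z by auto
    then obtain V' W' where "V' \<in> \<B>" "a \<in> V'" "V' \<subseteq> V" "W' \<in> \<C>" "b \<in> W'" "W' \<subseteq> W"
      using B C by metis
    with \<open>V \<times> W \<subseteq> U\<close> show ?thesis unfolding z by (intro bexI[of _ "V' \<times> W'"]) auto
  qed
  moreover have "openin (prod_topology X Y) V" if "V \<in> ?D" for V
    using that B C by (auto simp: openin_prod_Times_iff)
  ultimately show ?thesis
    unfolding second_countable_def using B C by (intro exI[of _ ?D]) auto
qed

lemma second_countable_euclidean:
  "second_countable (euclidean :: 'a::second_countable_topology topology)"
proof -
  obtain B :: "'a set set" where "countable B" "topological_basis B"
    using ex_countable_basis by blast
  then show ?thesis
    unfolding second_countable_def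
    by (intro exI[of _ B]) (metis open_openin topological_basisE topological_basis_open)
qed

text \<open>Such an \<open>f\<close> refines the topology \<open>T\<close>: the graph is Polish if \<open>T\<close> is, and preimages of open sets under \<open>f\<close> are open in it.\<close>

definition gdelta_graph :: "'x topology \<Rightarrow> 'x measure \<Rightarrow> ('x \<Rightarrow> nat \<Rightarrow> real) \<Rightarrow> bool" where
  "gdelta_graph T M f \<longleftrightarrow> f \<in> borel_measurable M \<and>
     gdelta_in (prod_topology T euclidean) ((\<lambda>x. (x, f x)) ` topspace T)"

text \<open>This codes the classical fact that a Borel set of a Polish space becomes clopen in a
  finer Polish topology with the same Borel sets: pulling the product topology back along the graph
  makes coordinate \<open>0\<close>, hence membership in \<open>A\<close>, continuous. Working with
  G-delta graphs lets the induction over \<open>sigma_sets\<close> merge countably many refinements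
  into one sequence of coordinates.\<close>

lemma gdelta_graph_indicator:
  fixes M :: "'x measure"
  assumes met: "metrizable_space T"
    and sp: "topspace T = space M" and st: "sets M = sigma_sets (space M) {U. openin T U}"
    and A: "A \<in> sets M"
  shows "\<exists>f. gdelta_graph T M f \<and> (\<forall>x\<in>space M. f x 0 = indicator A x)"
proof -
  let ?P = "prod_topology T (euclidean :: (nat \<Rightarrow> real) topology)"
  let ?G = "\<lambda>f. (\<lambda>x. (x, f x)) ` topspace T"
  have cont: "continuous_map ?P euclideanreal (\<lambda>z. snd z i)" for i
    using continuous_map_compose[OF continuous_map_snd, of euclidean euclideanreal "\<lambda>y. y i" T]
    by (simp add: comp_def continuous_on_product_coordinates)
  have A': "A \<in> sigma_sets (space M) {U. openin T U}" using A st by simp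
  show ?thesis using A'
  proof (induction rule: sigma_sets.induct)
    case (Basic U)
    have Um: "U \<in> sets M" using Basic st by auto
    have U: "openin T U" using Basic by simp
    let ?f = "\<lambda>x (n::nat). indicator U x :: real"
    \<comment> \<open>Over \<open>U\<close> the graph is an open set times a point, elsewhere a
      closed set times a point; in a metrizable space both pieces are G-delta.\<close>
    have "?G ?f =
       (U \<times> {\<lambda>_. 1}) \<union> ((topspace T - U) \<times> {\<lambda>_. 0})"
      using openin_subset[OF U] by (auto simp: indicator_def fun_eq_iff image_iff split: if_splits)
    moreover have "metrizable_space ?P"
      using met by (simp add: metrizable_space_prod_topology metrizable_space_euclidean)
    moreover have "gdelta_in ?P (U \<times> {\<lambda>_. 1})"
    proof -
      have "gdelta_in ?P ({z \<in> topspace ?P. fst z \<in> U} \<inter> {z \<in> topspace ?P. snd z \<in> {\<lambda>_. 1}})"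
        by (intro gdelta_in_Int[OF open_imp_gdelta_in closed_imp_gdelta_in] calculation(2)
             openin_continuous_map_preimage[OF continuous_map_fst U]
             closedin_continuous_map_preimage[OF continuous_map_snd]) auto
      also have "{z \<in> topspace ?P. fst z \<in> U} \<inter> {z \<in> topspace ?P. snd z \<in> {\<lambda>_. 1}} = U \<times> {\<lambda>_. 1}"
        using openin_subset[OF U] by auto
      finally show ?thesis .
    qed
    moreover have "gdelta_in ?P ((topspace T - U) \<times> {\<lambda>_. 0})"
      using U by (intro closed_imp_gdelta_in calculation(2)) (auto simp: closedin_prod_Times_iff)
    ultimately have "gdelta_in ?P (?G ?f)"
      by (simp add: gdelta_in_Un)
    moreover have "?f \<in> borel_measurable M"
      using Um by (intro measurable_coordinatewise_then_product) auto
    ultimately show ?case unfolding gdelta_graph_def by (intro exI[of _ ?f]) auto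
  next
    case Empty
    let ?f = "\<lambda>x (n::nat). 0 :: real"
    have "?G ?f = topspace T \<times> {\<lambda>_. 0}" by auto
    moreover have "gdelta_in ?P (topspace T \<times> {\<lambda>_. 0})"
      using met by (intro closed_imp_gdelta_in) (auto simp: metrizable_space_prod_topology metrizable_space_euclidean closedin_prod_Times_iff)
    ultimately show ?case unfolding gdelta_graph_def
      by (intro exI[of _ ?f]) (auto intro!: measurable_coordinatewise_then_product)
  next
    case (Compl A)
    then obtain f where f: "gdelta_graph T M f" "\<forall>x\<in>space M. f x 0 = indicator A x" by blast
    let ?f = "\<lambda>x n. 1 - f x n" and ?r = "\<lambda>z::'x \<times> (nat \<Rightarrow> real). (fst z, \<lambda>n. 1 - snd z n)"
    have "continuous_map ?P euclidean (\<lambda>z. (\<lambda>n. 1 - snd z n))"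
    proof -
      have "continuous_on UNIV (\<lambda>(y::nat\<Rightarrow>real) n. 1 - y n)"
        by (intro continuous_on_coordinatewise_then_product continuous_intros continuous_on_product_coordinates)
      then show ?thesis
        using continuous_map_compose[OF continuous_map_snd, of euclidean euclidean "\<lambda>y n. 1 - y n" T]
        by (simp add: comp_def)
    qed
    then have "continuous_map ?P ?P ?r"
      by (intro continuous_map_pairedI continuous_map_fst)
    moreover have "{z \<in> topspace ?P. ?r z \<in> ?G f} = ?G ?f"
    proof -
      have "(\<lambda>n. 1 - y n) = f x \<longleftrightarrow> y = (\<lambda>n. 1 - f x n)" for x y
        by (auto simp: fun_eq_iff) (metis diff_diff_eq2 add_diff_cancel_left')+
      then show ?thesis by (auto simp: image_iff)
    qed
    moreover have "gdelta_in ?P (?G f)"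
      using f(1) unfolding gdelta_graph_def by blast
    ultimately have "gdelta_in ?P (?G ?f)"
      using gdelta_in_continuous_map_preimage[of ?P ?P ?r "?G f"] by simp
    moreover have "?f \<in> borel_measurable M"
    proof (intro measurable_coordinatewise_then_product borel_measurable_diff measurable_const)
      show "(\<lambda>x. f x n) \<in> borel_measurable M" for n
        using f(1) unfolding gdelta_graph_def by (auto intro: measurable_product_then_coordinatewise)
    qed auto
    ultimately show ?case using f unfolding gdelta_graph_def
      by (intro exI[of _ ?f]) (auto simp: indicator_def)
  next
    case (Union A)
    then obtain f where f: "\<And>k::nat. gdelta_graph T M (f k)"
      "\<And>k. \<forall>x\<in>space M. f k x 0 = indicator (A k) x" by metis
    have Am: "A k \<in> sets M" for k using Union st by auto
    \<comment> \<open>Coordinate \<open>0\<close> holds the new indicator and coordinate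
      \<open>Suc (prod_encode (k, j))\<close> holds \<open>f k x j\<close>, so all earlier
      refinements are kept together with the new one.\<close>
    define g where "g x n = (case n of 0 \<Rightarrow> indicator (\<Union>k. A k) x
       | Suc n \<Rightarrow> f (fst (prod_decode n)) x (snd (prod_decode n)))" for x n
    let ?r = "\<lambda>k (z::'x \<times> (nat \<Rightarrow> real)). (fst z, \<lambda>j. snd z (Suc (prod_encode (k,j))))"
    have "continuous_map ?P euclidean (\<lambda>z. (\<lambda>j. snd z (Suc (prod_encode (k,j)))))" for k
    proof -
      have "continuous_on UNIV (\<lambda>(y::nat\<Rightarrow>real) j. y (Suc (prod_encode (k,j))))"
        by (intro continuous_on_coordinatewise_then_product continuous_on_product_coordinates)
      then show ?thesis
        using continuous_map_compose[OF continuous_map_snd, of euclidean euclidean "\<lambda>y j. y (Suc (prod_encode (k,j)))" T]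
        by (simp add: comp_def)
    qed
    then have r: "continuous_map ?P ?P (?r k)" for k
      by (intro continuous_map_pairedI continuous_map_fst)
    have P: "metrizable_space ?P"
      using met by (simp add: metrizable_space_prod_topology metrizable_space_euclidean)
    have G: "gdelta_in ?P {z \<in> topspace ?P. ?r k z \<in> ?G (f k)}" for k
      using gdelta_in_continuous_map_preimage[OF r] f unfolding gdelta_graph_def by blast
    \<comment> \<open>\<open>a k\<close> is the place where the indicator of \<open>A k\<close> is
      stored. That coordinate \<open>0\<close> is the indicator of the union has to be expressed by
      G-delta conditions: \<open>?O\<close> is the case of a point in some \<open>A k\<close>, where
      the threshold 1/2 turns "the value is 1" into an open condition, and \<open>?Z\<close> is the
      case of a point in none.\<close>
    define a where "a k = Suc (prod_encode (k, 0))" for k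
    let ?O = "{z \<in> topspace ?P. snd z 0 \<in> {1}} \<inter> (\<Union>k. {z \<in> topspace ?P. snd z (a k) \<in> {1/2<..}})"
    let ?Z = "{z \<in> topspace ?P. snd z 0 \<in> {0}} \<inter> (\<Inter>k. {z \<in> topspace ?P. snd z (a k) \<in> {0}})"
    have opn: "openin ?P {z \<in> topspace ?P. snd z (a k) \<in> {1/2<..}}" for k
      by (rule openin_continuous_map_preimage[OF cont]) simp
    have cls: "closedin ?P {z \<in> topspace ?P. snd z k \<in> {c}}" for k c
      by (rule closedin_continuous_map_preimage[OF cont]) simp
    have G1: "gdelta_in ?P ?O"
      by (rule gdelta_in_Int[OF closed_imp_gdelta_in[OF P cls] open_imp_gdelta_in[OF openin_Union]])
        (use opn in blast)
    have G2: "gdelta_in ?P ?Z"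
      by (rule closed_imp_gdelta_in[OF P closedin_Int[OF cls closedin_INT]]) (use cls in blast)+
    have G3: "gdelta_in ?P (\<Inter>k. {z \<in> topspace ?P. ?r k z \<in> ?G (f k)})"
      by (intro gdelta_in_Inter) (use G in auto)
    have "gdelta_in ?P ((\<Inter>k. {z \<in> topspace ?P. ?r k z \<in> ?G (f k)}) \<inter> (?O \<union> ?Z))"
      by (rule gdelta_in_Int[OF G3 gdelta_in_Un[OF G1 G2]])
    also have "(\<Inter>k. {z \<in> topspace ?P. ?r k z \<in> ?G (f k)}) \<inter> (?O \<union> ?Z) = ?G g"
      (is "?L = ?R")
    proof (intro set_eqI iffI)
      fix z assume "z \<in> ?R"
      then obtain x where x: "x \<in> topspace T" "z = (x, g x)" by auto
      have "g x (a k) = indicator (A k) x" for k using f(2)[of k] x sp by (simp add: g_def a_def)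
      then show "z \<in> ?L" using x by (auto simp: g_def image_iff indicator_def split: if_splits)
    next
      fix z assume z: "z \<in> ?L"
      obtain x y where xy: "z = (x,y)" by (cases z)
      have x: "x \<in> topspace T" using z xy by auto
      have y: "(\<lambda>j. y (Suc (prod_encode (k,j)))) = f k x" for k using z xy by auto
      have yS: "y (Suc n) = g x (Suc n)" for n
        using fun_cong[OF y[of "fst (prod_decode n)"], of "snd (prod_decode n)"] by (simp add: g_def)
      have ya: "y (a k) = indicator (A k) x" for k
        using fun_cong[OF y[of k], of 0] f(2)[of k] x sp by (simp add: a_def)
      have "y 0 = g x 0" using z xy ya by (auto simp: g_def indicator_def split: if_splits)
      then have "y = g x" using yS by (auto simp: fun_eq_iff) (metis not0_implies_Suc)
      then show "z \<in> ?R" using x xy by auto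
    qed
    finally have "gdelta_in ?P ?R" .
    moreover have "g \<in> borel_measurable M"
    proof (intro measurable_coordinatewise_then_product)
      fix n show "(\<lambda>x. g x n) \<in> borel_measurable M"
      proof (cases n)
        case 0 then show ?thesis using Am by (auto simp: g_def)
      next
        case (Suc m) then show ?thesis using f(1) unfolding gdelta_graph_def
          by (auto simp: g_def intro: measurable_product_then_coordinatewise)
      qed
    qed
    ultimately show ?case unfolding gdelta_graph_def by (intro exI[of _ g]) (auto simp: g_def)
  qed
qed

text \<open>The topology on \<open>W\<close> is pulled back along \<open>h x = (x, f x)\<close>,
  where \<open>f x 0\<close> is the indicator of \<open>W\<close>. The image of \<open>W\<close>
  under \<open>h\<close> is the part of a G-delta graph on which coordinate \<open>0\<close> is 1,
  hence a G-delta set in a Polish product and itself Polish.\<close>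

lemma standard_borel_restrict_space:
  assumes M: "standard_borel M" and W: "W \<in> sets M"
  shows "standard_borel (restrict_space M W)"
proof -
  obtain T where T: "completely_metrizable_space T" "second_countable T" and sp: "topspace T = space M"
    and st: "sets M = sigma_sets (space M) {U. openin T U}"
    using M unfolding standard_borel_def by blast
  have Wsp: "W \<subseteq> space M" using W sets.sets_into_space by blast
  let ?E = "euclidean :: (nat \<Rightarrow> real) topology"
  let ?P = "prod_topology T ?E"
  obtain f where f: "gdelta_graph T M f" and f0: "\<And>x. x \<in> space M \<Longrightarrow> f x 0 = indicator W x"
    using gdelta_graph_indicator[OF completely_metrizable_imp_metrizable_space[OF T(1)] sp st W] by blast
  have fm: "f \<in> borel_measurable M" using f unfolding gdelta_graph_def by blast
  define h where "h x = (x, f x)" for x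
  have P: "completely_metrizable_space ?P"
    using T by (simp add: completely_metrizable_space_prod_topology completely_metrizable_space_euclidean)
  have P2: "second_countable ?P" using T by (intro second_countable_prod_topology second_countable_euclidean)
  have "gdelta_in ?P (h ` topspace T \<inter> {z \<in> topspace ?P. snd z 0 \<in> {1}})"
  proof (rule gdelta_in_Int[OF _ closed_imp_gdelta_in[OF completely_metrizable_imp_metrizable_space[OF P]]])
    show "gdelta_in ?P (h ` topspace T)" using f unfolding gdelta_graph_def h_def by blast
    have "continuous_map ?P euclideanreal (\<lambda>z. snd z 0)"
      using continuous_map_compose[OF continuous_map_snd, of euclidean euclideanreal "\<lambda>y. y 0" T]
      by (simp add: comp_def continuous_on_product_coordinates)
    then show "closedin ?P {z \<in> topspace ?P. snd z 0 \<in> {1}}"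
      by (intro closedin_continuous_map_preimage) auto
  qed
  also have "h ` topspace T \<inter> {z \<in> topspace ?P. snd z 0 \<in> {1}} = h ` W"
    using Wsp f0 sp by (auto simp: h_def indicator_def split: if_splits)
  finally have Z: "gdelta_in ?P (h ` W)" .
  define TW where "TW = pullback_topology W h ?P"
  have tsp: "topspace TW = W" using Wsp sp by (auto simp: TW_def topspace_pullback_topology h_def)
  have "homeomorphic_maps TW (subtopology ?P (h ` W)) h fst"
    unfolding homeomorphic_maps_def
  proof (intro conjI ballI)
    have "continuous_map TW ?P (id \<circ> h)"
      unfolding TW_def by (intro continuous_map_pullback) auto
    then show "continuous_map TW (subtopology ?P (h ` W)) h"
      by (auto simp: continuous_map_in_subtopology tsp)
    show "continuous_map (subtopology ?P (h ` W)) TW fst"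
      unfolding TW_def
    proof (rule continuous_map_pullback')
      have "continuous_map (subtopology ?P (h ` W)) ?P id" by (simp add: continuous_map_from_subtopology)
      then show "continuous_map (subtopology ?P (h ` W)) ?P (h \<circ> fst)"
        by (rule continuous_map_eq) (auto simp: h_def)
      show "topspace (subtopology ?P (h ` W)) \<subseteq> fst -` W" by (auto simp: h_def)
    qed
  qed (auto simp: h_def)
  then have hom: "TW homeomorphic_space (subtopology ?P (h ` W))"
    unfolding homeomorphic_space_def by blast
  have 1: "completely_metrizable_space TW"
    using completely_metrizable_space_gdelta_in[OF P Z] hom homeomorphic_completely_metrizable_space by blast
  have 2: "second_countable TW"
    using second_countable_subtopology[OF P2] hom homeomorphic_space_second_countability by blast
  \<comment> \<open>The refined topology adds no Borel sets: by second countability an open set of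
    the product is a countable union of rectangles, whose preimages in \<open>W\<close> are in
    \<open>sets M\<close>.\<close>
  have hO: "h -` Q \<inter> W \<in> sets M" if Q: "openin ?P Q" for Q
  proof -
    have hm: "h -` (A \<times> B) \<inter> W \<in> sets M" if "openin T A" "open B" for A B
    proof -
      have "A \<in> sets M" using that st by auto
      moreover have "f -` B \<inter> space M \<in> sets M" using that fm by (intro measurable_sets) auto
      moreover have "h -` (A \<times> B) \<inter> W = A \<inter> (f -` B \<inter> space M) \<inter> W" using Wsp by (auto simp: h_def)
      ultimately show ?thesis using W by auto
    qed
    obtain \<B> where B: "countable \<B>" "\<And>V. V \<in> \<B> \<Longrightarrow> openin T V"
      "\<And>U x. openin T U \<Longrightarrow> x \<in> U \<Longrightarrow> \<exists>V\<in>\<B>. x \<in> V \<and> V \<subseteq> U"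
      using T unfolding second_countable_def by metis
    obtain \<C> where C: "countable \<C>" "\<And>V. V \<in> \<C> \<Longrightarrow> openin ?E V"
      "\<And>U x. openin ?E U \<Longrightarrow> x \<in> U \<Longrightarrow> \<exists>V\<in>\<C>. x \<in> V \<and> V \<subseteq> U"
      using second_countable_euclidean[where 'a="nat\<Rightarrow>real"] unfolding second_countable_def by metis
    let ?I = "{(V, V'). V \<in> \<B> \<and> V' \<in> \<C> \<and> V \<times> V' \<subseteq> Q}"
    have "countable ?I" by (rule countable_subset[of _ "\<B> \<times> \<C>"]) (use B C in auto)
    moreover have "h -` Q \<inter> W = (\<Union>(V,V')\<in>?I. h -` (V \<times> V') \<inter> W)"
    proof (intro set_eqI iffI)
      fix x assume x: "x \<in> h -` Q \<inter> W"
      then obtain V V' where "openin T V" "openin ?E V'" "x \<in> V" "f x \<in> V'" "V \<times> V' \<subseteq> Q"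
        using Q[unfolded openin_prod_topology_alt, rule_format, of x "f x"] by (auto simp: h_def)
      moreover from calculation obtain V1 V1' where "V1 \<in> \<B>" "x \<in> V1" "V1 \<subseteq> V" "V1' \<in> \<C>" "f x \<in> V1'" "V1' \<subseteq> V'"
        using B C by metis
      ultimately show "x \<in> (\<Union>(V,V')\<in>?I. h -` (V \<times> V') \<inter> W)"
        using x by (auto simp: h_def intro!: exI[of _ V1] exI[of _ V1'])
    qed auto
    ultimately show ?thesis using hm B C by (auto intro!: sets.countable_UN')
  qed
  have 3: "sets (restrict_space M W) = sigma_sets W {U. openin TW U}"
  proof
    have "sets (restrict_space M W) = (\<inter>) W ` sigma_sets (space M) {U. openin T U}"
      using st by (simp add: sets_restrict_space)
    also have "\<dots> = sigma_sets W ((\<inter>) W ` {U. openin T U})"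
      using sigma_sets_Int[of W "space M" "{U. openin T U}"] W st Wsp by simp
    also have "\<dots> \<subseteq> sigma_sets W {U. openin TW U}"
    proof (rule sigma_sets_mono', safe)
      fix U assume "openin T U"
      then have "openin ?P (U \<times> UNIV)" by (simp add: openin_prod_Times_iff)
      moreover have "W \<inter> U = h -` (U \<times> UNIV) \<inter> W" by (auto simp: h_def)
      ultimately show "openin TW (W \<inter> U)" unfolding TW_def openin_pullback_topology by blast
    qed
    finally show "sets (restrict_space M W) \<subseteq> sigma_sets W {U. openin TW U}" .
    have "sigma_sets (space (restrict_space M W)) {U. openin TW U} \<subseteq> sets (restrict_space M W)"
      using hO W Wsp unfolding TW_def openin_pullback_topology
      by (intro sets.sigma_sets_subset) (auto simp: sets_restrict_space_iff)
    then show "sigma_sets W {U. openin TW U} \<subseteq> sets (restrict_space M W)"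
      using Wsp by (simp add: space_restrict_space inf_absorb1)
  qed
  have "space (restrict_space M W) = W" using Wsp by (auto simp: space_restrict_space)
  with 1 2 3 tsp show ?thesis unfolding standard_borel_def by (intro exI[of _ TW]) auto
qed

subsection \<open>Haar measure\<close>

lemma borel_measurable_group_uminus [measurable (raw)]:
  fixes f :: "'a \<Rightarrow> 'g::topological_group_add"
  assumes "f \<in> borel_measurable M"
  shows "(\<lambda>x. - f x) \<in> borel_measurable M"
proof -
  have "(uminus :: 'g \<Rightarrow> 'g) \<in> borel_measurable borel"
    by (intro borel_measurable_continuous_onI continuous_on_minus continuous_on_id)
  then show ?thesis using measurable_compose[OF assms] by blast
qed

lemma borel_measurable_group_diff [measurable (raw)]:
  fixes f g :: "'a \<Rightarrow> 'g::{topological_group_add, second_countable_topology}"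
  assumes [measurable]: "f \<in> borel_measurable M" "g \<in> borel_measurable M"
  shows "(\<lambda>x. f x - g x) \<in> borel_measurable M"
  unfolding diff_conv_add_uminus by measurable

lemma compact_group_minus:
  fixes K :: "'g::topological_group_add set"
  shows "compact K \<Longrightarrow> compact (uminus ` K)"
  by (rule compact_continuous_image) (intro continuous_on_minus continuous_on_id)

lemma compact_group_translate:
  fixes K :: "'g::topological_group_add set"
  shows "compact K \<Longrightarrow> compact ((\<lambda>h. h + g) ` K)"
  by (rule compact_continuous_image) (intro continuous_on_add continuous_on_id continuous_on_const)

lemma image_group_translate:
  fixes K :: "'g::group_add set"
  shows "(\<lambda>h. h + g) ` K = {t. t - g \<in> K}"
proof safe
  fix t assume "t - g \<in> K"
  then show "t \<in> (\<lambda>h. h + g) ` K" by (intro image_eqI[of _ _ "t - g"]) auto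
qed simp

lemma compact_group_sum:
  fixes K L :: "'g::topological_group_add set"
  assumes "compact K" "compact L"
  shows "compact {h + k | h k. h \<in> K \<and> k \<in> L}"
proof -
  have "compact ((\<lambda>(h,k). h + k) ` (K \<times> L))"
    by (intro compact_continuous_image compact_Times assms) (auto simp: case_prod_beta intro!: continuous_intros)
  also have "(\<lambda>(h,k). h + k) ` (K \<times> L) = {h + k | h k. h \<in> K \<and> k \<in> L}" by auto
  finally show ?thesis .
qed

lemma open_group_translate:
  fixes U :: "'g::topological_group_add set"
  assumes "open U"
  shows "open {h. g + h \<in> U}" "open {h. h + g \<in> U}"
proof -
  have "open ((\<lambda>h. g + h) -` U)" "open ((\<lambda>h. h + g) -` U)"
    by (intro open_vimage[OF assms] continuous_intros)+
  then show "open {h. g + h \<in> U}" "open {h. h + g \<in> U}" by (simp_all add: vimage_def)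
qed

locale lcsc_group =
  fixes haar :: "'g::{topological_group_add, t2_space, second_countable_topology} measure"
  assumes locally_compact: "locally_compact_space (euclidean :: 'g topology)"
    and left_haar: "left_haar_measure haar"
begin

lemma sets_haar [measurable_cong, simp]: "sets haar = sets borel"
  using left_haar by (simp add: left_haar_measure_def)

lemma space_haar [simp]: "space haar = UNIV"
  using sets_eq_imp_space_eq[OF sets_haar] by simp

lemma haar_compact_finite: "compact K \<Longrightarrow> emeasure haar K < \<infinity>"
  using left_haar by (simp add: left_haar_measure_def)

lemma nn_integral_haar_left:
  assumes "f \<in> borel_measurable borel"
  shows "(\<integral>\<^sup>+h. f (g + h) \<partial>haar) = (\<integral>\<^sup>+h. f h \<partial>haar)"
proof -
  have "(\<integral>\<^sup>+h. f h \<partial>haar) = (\<integral>\<^sup>+h. f h \<partial>(distr haar borel (\<lambda>h. g + h)))"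
    using left_haar by (simp add: left_haar_measure_def)
  also have "\<dots> = (\<integral>\<^sup>+h. f (g + h) \<partial>haar)"
    by (rule nn_integral_distr) (use assms in measurable)
  finally show ?thesis ..
qed

section \<open>Relatively compact bases and exhaustions of the group\<close>

lemma compact_neighbourhood:
  fixes U :: "'g set"
  assumes "open U" "x \<in> U"
  obtains V where "open V" "x \<in> V" "compact (closure V)" "closure V \<subseteq> U"
proof -
  have "Hausdorff_space (euclidean :: 'g topology)"
    unfolding Hausdorff_space_def by (auto simp: disjnt_def) (meson hausdorff)
  then have "neighbourhood_base_of (compactin euclidean) (euclidean :: 'g topology)"
    using locally_compact by (simp add: locally_compact_space_neighbourhood_base)
  then have "\<forall>W x. openin (euclidean :: 'g topology) W \<and> x \<in> W \<longrightarrow>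
      (\<exists>U V. openin euclidean U \<and> compactin euclidean V \<and> x \<in> U \<and> U \<subseteq> V \<and> V \<subseteq> W)"
    by (simp only: neighbourhood_base_of)
  from this[rule_format, of U x] assms
  obtain V K where VK: "open V" "compact K" "x \<in> V" "V \<subseteq> K" "K \<subseteq> U"
    by (auto simp: open_openin[symmetric])
  have "closure V \<subseteq> K" using VK by (simp add: closure_minimal compact_imp_closed)
  moreover have "compact (closure V)"
    using VK calculation compact_Int_closed[of K "closure V"] by (simp add: inf.absorb2)
  ultimately show ?thesis using VK that by blast
qed

lemma ex_compact_base:
  "\<exists>cb :: nat \<Rightarrow> 'g set. (\<forall>n. open (cb n) \<and> compact (closure (cb n))) \<and>
     (\<forall>U x. open U \<longrightarrow> x \<in> U \<longrightarrow> (\<exists>n. x \<in> cb n \<and> closure (cb n) \<subseteq> U))"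
proof -
  obtain B :: "'g set set" where B: "countable B" "topological_basis B"
    using ex_countable_basis by blast
  let ?C = "{V \<in> B. compact (closure V)}"
  have 1: "\<exists>V\<in>?C. x \<in> V \<and> closure V \<subseteq> U" if U: "open U" "x \<in> U" for U x
  proof -
    obtain W where W: "open W" "x \<in> W" "compact (closure W)" "closure W \<subseteq> U"
      using compact_neighbourhood[OF U] by blast
    then obtain V where V: "V \<in> B" "x \<in> V" "V \<subseteq> W"
      using topological_basisE[OF B(2), of W x] by blast
    then have "closure V \<subseteq> closure W" by (simp add: closure_mono)
    moreover from this have "compact (closure V)"
      using W compact_Int_closed[of "closure W" "closure V"] by (simp add: inf.absorb2)
    ultimately show ?thesis using V W by auto
  qed
  have "?C \<noteq> {}" using 1[of UNIV 0] by auto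
  moreover have "countable ?C" using B by auto
  ultimately have "range (from_nat_into ?C) = ?C" by (simp add: range_from_nat_into)
  then have 2: "from_nat_into ?C n \<in> ?C" "V \<in> ?C \<Longrightarrow> \<exists>n. V = from_nat_into ?C n" for n V
    by blast+
  show ?thesis
  proof (intro exI[of _ "from_nat_into ?C"] conjI allI impI)
    show "open (from_nat_into ?C n)" "compact (closure (from_nat_into ?C n))" for n
      using 2(1)[of n] B(2) topological_basis_open by blast+
    fix U :: "'g set" and x assume "open U" "x \<in> U"
    then show "\<exists>n. x \<in> from_nat_into ?C n \<and> closure (from_nat_into ?C n) \<subseteq> U"
    proof -
      obtain V where V: "V \<in> ?C" "x \<in> V" "closure V \<subseteq> U"
        using 1[OF \<open>open U\<close> \<open>x \<in> U\<close>] by blast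
      obtain n where n: "V = from_nat_into ?C n" using 2(2)[OF V(1)] by blast
      show ?thesis by (rule exI[of _ n]) (use V(2,3) in \<open>simp only: n[symmetric]\<close>)
    qed
  qed
qed

definition cbase :: "nat \<Rightarrow> 'g set" where
  "cbase = (SOME cb. (\<forall>n. open (cb n) \<and> compact (closure (cb n))) \<and>
     (\<forall>U x. open U \<longrightarrow> x \<in> U \<longrightarrow> (\<exists>n. x \<in> cb n \<and> closure (cb n) \<subseteq> U)))"

lemma open_cbase [simp]: "open (cbase n)"
  and compact_closure_cbase [simp]: "compact (closure (cbase n))"
  and cbase_basis: "open U \<Longrightarrow> x \<in> U \<Longrightarrow> \<exists>n. x \<in> cbase n \<and> closure (cbase n) \<subseteq> U"
  using someI_ex[OF ex_compact_base] unfolding cbase_def[symmetric] by blast+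

definition exhaustion :: "nat \<Rightarrow> 'g set" where
  "exhaustion n = (\<Union>i\<le>n. cbase i)"

lemma open_exhaustion [simp]: "open (exhaustion n)"
  unfolding exhaustion_def by auto

lemma exhaustion_mono: "m \<le> n \<Longrightarrow> exhaustion m \<subseteq> exhaustion n"
  unfolding exhaustion_def by force

lemma compact_closure_exhaustion [simp]: "compact (closure (exhaustion n))"
proof -
  have K: "compact (\<Union>i\<le>n. closure (cbase i))" by (intro compact_UN) auto
  have "exhaustion n \<subseteq> (\<Union>i\<le>n. closure (cbase i))"
    unfolding exhaustion_def using closure_subset by fast
  then have "closure (exhaustion n) \<subseteq> (\<Union>i\<le>n. closure (cbase i))"
    using K by (simp add: closure_minimal compact_imp_closed)
  then show ?thesis using compact_Int_closed[OF K, of "closure (exhaustion n)"] by (simp add: inf.absorb2)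
qed

lemma exhaustion_cover: "\<exists>n. x \<in> exhaustion n"
  using cbase_basis[of UNIV x] unfolding exhaustion_def by auto

lemma haar_closure_compact_finite: "compact (closure A) \<Longrightarrow> emeasure haar A < \<infinity>"
  using haar_compact_finite[of "closure A"] emeasure_mono[OF closure_subset, of A haar]
  by (simp add: le_less_trans)

sublocale sigma_finite_measure haar
proof
  show "\<exists>A. countable A \<and> A \<subseteq> sets haar \<and> \<Union>A = space haar \<and> (\<forall>a\<in>A. emeasure haar a \<noteq> \<infinity>)"
    using exhaustion_cover haar_closure_compact_finite[OF compact_closure_exhaustion]
    by (intro exI[of _ "range exhaustion"]) (auto simp: less_top)
qed

text \<open>Translates of a nonempty open null set would cover the group, and by the Lindelof
  property countably many of them would, so \<open>haar\<close> would vanish.\<close>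

lemma haar_nonempty_open_pos:
  assumes "open U" "x \<in> U"
  shows "emeasure haar U > 0"
proof (rule ccontr)
  assume "\<not> ?thesis"
  then have 0: "emeasure haar U = 0" by simp
  let ?T = "\<lambda>g. {h. g + h \<in> U}"
  have [measurable]: "U \<in> sets borel" using assms by auto
  have T0: "emeasure haar (?T g) = 0" for g
  proof -
    have "emeasure haar (?T g) = (\<integral>\<^sup>+h. indicator U (g + h) \<partial>haar)"
      using open_group_translate[OF assms(1), of g]
      by (subst nn_integral_indicator[symmetric]) (auto intro!: nn_integral_cong simp: indicator_def simp del: nn_integral_indicator)
    also have "\<dots> = emeasure haar U" by (subst nn_integral_haar_left) auto
    finally show ?thesis using 0 by simp
  qed
  obtain F where F: "F \<subseteq> range ?T" "countable F" "\<Union>F = \<Union>(range ?T)"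
    using Lindelof[of "range ?T"] open_group_translate[OF assms(1)] by blast
  have "\<Union>(range ?T) = UNIV"
  proof -
    have "y \<in> ?T (x - y)" for y using assms by simp
    then show ?thesis by blast
  qed
  then have "UNIV \<subseteq> (\<Union>V\<in>F. V)" using F by auto
  moreover have "(\<Union>V\<in>F. V) \<in> null_sets haar"
  proof (rule null_sets_UN')
    fix V assume "V \<in> F"
    then obtain g where "V = ?T g" using F by auto
    then show "V \<in> null_sets haar" using T0 open_group_translate(1)[OF assms(1)] by auto
  qed (use F in auto)
  ultimately have "UNIV \<in> null_sets haar" by (simp add: top.extremum_unique)
  then show False using left_haar by (auto simp: left_haar_measure_def)
qed

text \<open>Uniqueness of Haar measure as an explicit formula: the second factor on the right
  depends on \<open>haar\<close>, \<open>f\<close> and \<open>k\<close> but not on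
  \<open>haar'\<close>, so the ratio of the integrals of \<open>f\<close> and \<open>k\<close> is
  common to all left Haar measures. The proof integrates \<open>f x * k (y + x) / c x\<close> over
  both variables and substitutes twice by left invariance, first in \<open>x\<close> for
  \<open>haar'\<close> and then in \<open>y\<close> for \<open>haar\<close>.\<close>

lemma left_haar_proportional:
  assumes haar': "left_haar_measure haar'"
    and f: "f \<in> borel_measurable borel" and k: "k \<in> borel_measurable borel"
    and k_pos: "\<And>x. (\<integral>\<^sup>+t. k (t + x) \<partial>haar) \<noteq> 0" and k_fin: "\<And>x. (\<integral>\<^sup>+t. k (t + x) \<partial>haar) \<noteq> \<infinity>"
  shows "(\<integral>\<^sup>+x. f x \<partial>haar') = (\<integral>\<^sup>+x. k x \<partial>haar') * (\<integral>\<^sup>+y. f (- y) / (\<integral>\<^sup>+t. k (t - y) \<partial>haar) \<partial>haar)"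
proof -
  interpret H: lcsc_group haar' by unfold_locales (use locally_compact haar' in auto)
  interpret P: pair_sigma_finite haar haar' ..
  note f[measurable] k[measurable]
  define c where "c x = (\<integral>\<^sup>+t. k (t + x) \<partial>haar)" for x
  have [measurable]: "c \<in> borel_measurable borel"
    unfolding c_def by measurable
  have c: "c x \<noteq> 0" "c x \<noteq> \<infinity>" for x using k_pos k_fin unfolding c_def by auto
  have "(\<integral>\<^sup>+x. f x \<partial>haar') = (\<integral>\<^sup>+x. (\<integral>\<^sup>+y. f x * k (y + x) / c x \<partial>haar) \<partial>haar')"
  proof (rule nn_integral_cong)
    fix x
    have "(\<integral>\<^sup>+y. f x * k (y + x) / c x \<partial>haar) = (\<integral>\<^sup>+y. (f x / c x) * k (y + x) \<partial>haar)"
      by (simp add: ennreal_times_divide divide_ennreal_def mult_ac)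
    also have "\<dots> = f x / c x * c x"
      unfolding c_def by (rule nn_integral_cmult) measurable
    also have "\<dots> = f x"
      using c[of x] by (simp add: ennreal_divide_times ennreal_divide_self less_top)
    finally show "f x = (\<integral>\<^sup>+y. f x * k (y + x) / c x \<partial>haar)" ..
  qed
  also have "\<dots> = (\<integral>\<^sup>+y. (\<integral>\<^sup>+x. f x * k (y + x) / c x \<partial>haar') \<partial>haar)"
    by (rule P.Fubini') measurable
  also have "\<dots> = (\<integral>\<^sup>+y. (\<integral>\<^sup>+x. f (- y + x) * k x / c (- y + x) \<partial>haar') \<partial>haar)"
  proof (rule nn_integral_cong)
    fix y
    show "(\<integral>\<^sup>+x. f x * k (y + x) / c x \<partial>haar') = (\<integral>\<^sup>+x. f (- y + x) * k x / c (- y + x) \<partial>haar')"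
      using H.nn_integral_haar_left[of "\<lambda>x. f x * k (y + x) / c x" "- y"] by (simp add: add.assoc[symmetric])
  qed
  also have "\<dots> = (\<integral>\<^sup>+x. (\<integral>\<^sup>+y. f (- y + x) * k x / c (- y + x) \<partial>haar) \<partial>haar')"
    by (rule P.Fubini'[symmetric]) measurable
  also have "\<dots> = (\<integral>\<^sup>+x. (\<integral>\<^sup>+y. f (- y) * k x / c (- y) \<partial>haar) \<partial>haar')"
  proof (rule nn_integral_cong)
    fix x
    show "(\<integral>\<^sup>+y. f (- y + x) * k x / c (- y + x) \<partial>haar) = (\<integral>\<^sup>+y. f (- y) * k x / c (- y) \<partial>haar)"
      using nn_integral_haar_left[of "\<lambda>y. f (- y + x) * k x / c (- y + x)" x] by (simp add: minus_add add.assoc)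
  qed
  also have "\<dots> = (\<integral>\<^sup>+x. k x * (\<integral>\<^sup>+y. f (- y) / c (- y) \<partial>haar) \<partial>haar')"
  proof (rule nn_integral_cong)
    fix x
    have "(\<integral>\<^sup>+y. f (- y) * k x / c (- y) \<partial>haar) = (\<integral>\<^sup>+y. k x * (f (- y) / c (- y)) \<partial>haar)"
      by (simp add: ennreal_times_divide mult.commute)
    also have "\<dots> = k x * (\<integral>\<^sup>+y. f (- y) / c (- y) \<partial>haar)"
      by (rule nn_integral_cmult) measurable
    finally show "(\<integral>\<^sup>+y. f (- y) * k x / c (- y) \<partial>haar) = k x * (\<integral>\<^sup>+y. f (- y) / c (- y) \<partial>haar)" .
  qed
  also have "\<dots> = (\<integral>\<^sup>+x. k x \<partial>haar') * (\<integral>\<^sup>+y. f (- y) / c (- y) \<partial>haar)"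
    by (rule nn_integral_multc) measurable
  finally show ?thesis by (simp add: c_def)
qed

lemma right_translate_haar:
  "left_haar_measure (distr haar borel (\<lambda>h. h + g))"
  unfolding left_haar_measure_def
proof (intro conjI allI impI)
  show "emeasure (distr haar borel (\<lambda>h. h + g)) UNIV \<noteq> 0"
    using left_haar by (simp add: emeasure_distr left_haar_measure_def)
  fix K :: "'g set" assume K: "compact K"
  have "compact ((\<lambda>h. h + (- g)) ` K)" by (rule compact_group_translate[OF K])
  also have "(\<lambda>h. h + (- g)) ` K = (\<lambda>h. h + g) -` K"
    unfolding image_group_translate by auto
  finally have "compact ((\<lambda>h. h + g) -` K)" .
  then show "emeasure (distr haar borel (\<lambda>h. h + g)) K < \<infinity>"
    using K by (subst emeasure_distr) (auto simp: haar_compact_finite[simplified] compact_imp_closed)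
next
  fix a
  have "distr (distr haar borel (\<lambda>h. h + g)) borel (\<lambda>h. a + h) = distr haar borel (\<lambda>h. a + (h + g))"
    by (subst distr_distr) (auto simp: comp_def)
  also have "\<dots> = distr (distr haar borel (\<lambda>h. a + h)) borel (\<lambda>h. h + g)"
    by (subst distr_distr) (auto simp: comp_def add.assoc)
  also have "distr haar borel (\<lambda>h. a + h) = haar"
    using left_haar by (simp add: left_haar_measure_def)
  finally show "distr (distr haar borel (\<lambda>h. h + g)) borel (\<lambda>h. a + h) = distr haar borel (\<lambda>h. h + g)" .
qed simp

text \<open>The constant is a value of the modular function. A right translate of
  \<open>haar\<close> is again a left Haar measure, so \<open>left_haar_proportional\<close> applies
  to both measures with the same test function \<open>k\<close>, and the shared factor
  \<open>C\<close> is eliminated.\<close>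

lemma haar_right_scaling:
  "\<exists>c. c \<noteq> 0 \<and> c \<noteq> \<infinity> \<and> (\<forall>f\<in>borel_measurable borel. (\<integral>\<^sup>+h. f (h + g) \<partial>haar) = c * (\<integral>\<^sup>+h. f h \<partial>haar))"
proof -
  obtain n where n: "(0::'g) \<in> cbase n" using cbase_basis[of UNIV 0] by auto
  define k :: "'g \<Rightarrow> ennreal" where "k = indicator (cbase n)"
  have km[measurable]: "k \<in> borel_measurable borel" by (simp add: k_def)
  \<comment> \<open>The test function is the indicator of a relatively compact open neighbourhood of
    0, so all its right translates have positive finite integral; these are the side conditions of
    \<open>left_haar_proportional\<close>.\<close>
  have kx: "(\<integral>\<^sup>+t. k (t + x) \<partial>haar) \<noteq> 0 \<and> (\<integral>\<^sup>+t. k (t + x) \<partial>haar) \<noteq> \<infinity>" for x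
  proof -
    let ?T = "{t. t + x \<in> cbase n}" and ?C = "(\<lambda>h. h + (- x)) ` closure (cbase n)"
    have op: "open ?T" by (rule open_group_translate) simp
    have eq: "(\<integral>\<^sup>+t. k (t + x) \<partial>haar) = emeasure haar ?T"
      using op by (subst nn_integral_indicator[symmetric]) (auto intro!: nn_integral_cong simp: indicator_def k_def simp del: nn_integral_indicator)
    have "- x \<in> ?T" using n by simp
    then have 1: "emeasure haar ?T > 0" using haar_nonempty_open_pos op by blast
    have "?T \<subseteq> ?C"
      unfolding image_group_translate using closure_subset by auto
    moreover have "compact ?C"
      by (rule compact_group_translate) simp
    ultimately have "emeasure haar ?T < \<infinity>"
      using haar_compact_finite[of "?C"]
        emeasure_mono[of "?T" "?C" haar]
      by (auto simp: compact_imp_closed intro: le_less_trans)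
    with 1 show ?thesis unfolding eq by auto
  qed
  let ?h = "distr haar borel (\<lambda>h. h + g)"
  define a where "a = (\<integral>\<^sup>+x. k x \<partial>?h)"
  define b where "b = (\<integral>\<^sup>+x. k x \<partial>haar)"
  have a: "a \<noteq> 0" "a \<noteq> \<infinity>" using kx[of g] by (auto simp: a_def nn_integral_distr)
  have b: "b \<noteq> 0" "b \<noteq> \<infinity>" using kx[of 0] by (auto simp: b_def)
  have "(\<integral>\<^sup>+h. f (h + g) \<partial>haar) = a / b * (\<integral>\<^sup>+h. f h \<partial>haar)" if f[measurable]: "f \<in> borel_measurable borel" for f
  proof -
    define C where "C = (\<integral>\<^sup>+y. f (- y) / (\<integral>\<^sup>+t. k (t - y) \<partial>haar) \<partial>haar)"
    have "(\<integral>\<^sup>+h. f (h + g) \<partial>haar) = (\<integral>\<^sup>+h. f h \<partial>?h)" by (simp add: nn_integral_distr)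
    also have "\<dots> = a * C"
      unfolding a_def C_def using kx by (intro left_haar_proportional right_translate_haar) auto
    finally have 1: "(\<integral>\<^sup>+h. f (h + g) \<partial>haar) = a * C" .
    have "(\<integral>\<^sup>+h. f h \<partial>haar) = b * C"
      unfolding b_def C_def using kx by (intro left_haar_proportional left_haar) auto
    then have "a / b * (\<integral>\<^sup>+h. f h \<partial>haar) = a * (b * C / b)" by (simp add: ennreal_times_divide divide_ennreal_def mult_ac)
    also have "b * C / b = C" using b by (simp add: ennreal_mult_divide_eq mult.commute)
    finally show ?thesis using 1 by simp
  qed
  then show ?thesis using a b
    by (intro exI[of _ "a / b"]) (auto simp: ennreal_divide_eq_top_iff ennreal_divide_eq_0_iff)
qed

text \<open>Since \<open>act g (act h x) = act (g + h) x\<close>, this is what makes a statement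
  about almost every point of an orbit independent of the base point.\<close>

lemma AE_haar_right:
  assumes [measurable]: "Measurable.pred borel P"
  shows "(AE h in haar. P (h + g)) \<longleftrightarrow> (AE h in haar. P h)"
proof -
  obtain c where c: "c \<noteq> 0" "\<And>f. f \<in> borel_measurable borel \<Longrightarrow> (\<integral>\<^sup>+h. f (h + g) \<partial>haar) = c * (\<integral>\<^sup>+h. f h \<partial>haar)"
    using haar_right_scaling by blast
  have "(AE h in haar. P (h + g)) \<longleftrightarrow> (\<integral>\<^sup>+h. indicator {h. \<not> P h} (h + g) \<partial>haar) = 0"
    by (subst nn_integral_0_iff_AE) (auto simp: indicator_def)
  also have "\<dots> \<longleftrightarrow> (\<integral>\<^sup>+h. indicator {h. \<not> P h} h \<partial>haar) = (0::ennreal)"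
    by (subst c(2)) (auto simp: c(1))
  also have "\<dots> \<longleftrightarrow> (AE h in haar. P h)"
    by (subst nn_integral_0_iff_AE) (auto simp: indicator_def)
  finally show ?thesis .
qed

end

subsection \<open>Orbit-continuous Borel functions\<close>

text \<open>Stability under intersection prepares for Dynkin's lemma. The representation of each
  member as a finite intersection of sets of \<open>E\<close> is recorded so that openness passes
  from \<open>E\<close> to the new generator.\<close>

lemma countable_Int_stable_generator:
  assumes E: "countable E" "E \<subseteq> Pow (space M)" "sets M = sigma_sets (space M) E"
  shows "\<exists>G :: nat \<Rightarrow> 'a set. Int_stable (range G) \<and> space M \<in> range G \<and>
    range G \<subseteq> Pow (space M) \<and> sets M = sigma_sets (space M) (range G) \<and>
    (\<forall>A\<in>range G. \<exists>F. finite F \<and> F \<subseteq> E \<and> A = space M \<inter> \<Inter>F)"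
proof -
  let ?G = "(\<lambda>F. space M \<inter> \<Inter>F) ` {F. finite F \<and> F \<subseteq> E}"
  have sp: "space M \<in> ?G" by (rule image_eqI[of _ _ "{}"]) auto
  then have "?G \<noteq> {}" by (metis empty_iff)
  moreover have "countable ?G" using E(1) by (intro countable_image countable_Collect_finite_subset)
  ultimately have r: "range (from_nat_into ?G) = ?G" by (simp add: range_from_nat_into)
  have stable: "Int_stable ?G"
  proof (rule Int_stableI_image)
    fix F F' assume "F \<in> {F. finite F \<and> F \<subseteq> E}" "F' \<in> {F. finite F \<and> F \<subseteq> E}"
    then show "\<exists>k\<in>{F. finite F \<and> F \<subseteq> E}. (space M \<inter> \<Inter>F) \<inter> (space M \<inter> \<Inter>F') = space M \<inter> \<Inter>k"
      by (intro bexI[of _ "F \<union> F'"]) auto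
  qed
  have gen: "sigma_sets (space M) E = sigma_sets (space M) ?G"
  proof (rule sigma_sets_eqI)
    fix A assume A: "A \<in> E"
    have "A = space M \<inter> \<Inter>{A}" using A E(2) by auto
    moreover have "{A} \<in> {F. finite F \<and> F \<subseteq> E}" using A by simp
    ultimately show "A \<in> sigma_sets (space M) ?G" by (blast intro: sigma_sets.Basic)
  next
    fix B assume "B \<in> ?G"
    then obtain F where F: "finite F" "F \<subseteq> E" "B = space M \<inter> \<Inter>F" by blast
    have "space M \<inter> \<Inter>F \<in> sets M"
    proof (cases "F = {}")
      case False
      have "(\<Inter>A\<in>F. A) \<in> sets M" using F E(3) False by (intro sets.finite_INT) (auto intro: sigma_sets.Basic)
      then show ?thesis by simp
    qed simp
    then show "B \<in> sigma_sets (space M) E" using F E(3) by simp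
  qed
  have sub: "?G \<subseteq> Pow (space M)" by (rule image_subsetI) simp
  have rep: "\<exists>F. finite F \<and> F \<subseteq> E \<and> A = space M \<inter> \<Inter>F" if "A \<in> ?G" for A
  proof -
    from that obtain F where F: "A = space M \<inter> \<Inter>F" "F \<in> {F. finite F \<and> F \<subseteq> E}" by (rule imageE)
    show ?thesis by (rule exI[of _ F]) (use F in simp)
  qed
  have "Int_stable ?G \<and> space M \<in> ?G \<and> ?G \<subseteq> Pow (space M) \<and> sets M = sigma_sets (space M) ?G \<and>
      (\<forall>A\<in>?G. \<exists>F. finite F \<and> F \<subseteq> E \<and> A = space M \<inter> \<Inter>F)"
    by (intro conjI ballI stable sp E(3)[unfolded gen] sub rep)
  then show ?thesis by (intro exI[of _ "from_nat_into ?G"]) (unfold r, assumption)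
qed

context lcsc_group
begin

text \<open>Fatou's lemma: the indicator of the open set \<open>U\<close> is lower semicontinuous at
  \<open>h + g\<close>, and the condition \<open>g \<in> E\<close> does not move with the
  translation.\<close>

lemma haar_translate_lsc:
  fixes u :: "nat \<Rightarrow> 'g"
  assumes U: "open U" and E: "E \<in> sets borel" and u: "u \<longlonglongrightarrow> h"
  shows "emeasure haar {g. h + g \<in> U \<and> g \<in> E} \<le> liminf (\<lambda>n. emeasure haar {g. u n + g \<in> U \<and> g \<in> E})"
proof -
  have [measurable]: "U \<in> sets borel" "E \<in> sets borel" using U E by auto
  define F where "F a g = (indicator {g. a + g \<in> U \<and> g \<in> E} g :: ennreal)" for a g
  have [measurable]: "F a \<in> borel_measurable borel" for a unfolding F_def by measurable
  have F: "emeasure haar {g. a + g \<in> U \<and> g \<in> E} = (\<integral>\<^sup>+g. F a g \<partial>haar)" for a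
    unfolding F_def by (rule nn_integral_indicator[symmetric]) measurable
  have "F h g \<le> liminf (\<lambda>n. F (u n) g)" for g
  proof (cases "h + g \<in> U \<and> g \<in> E")
    case True
    have "(\<lambda>n. u n + g) \<longlonglongrightarrow> h + g" by (intro tendsto_intros u)
    then have "\<forall>\<^sub>F n in sequentially. u n + g \<in> U" using True U topological_tendstoD by blast
    then have "\<forall>\<^sub>F n in sequentially. F h g \<le> F (u n) g"
      by eventually_elim (use True in \<open>simp add: F_def\<close>)
    then show ?thesis by (rule Liminf_bounded)
  qed (simp add: F_def)
  then have "(\<integral>\<^sup>+g. F h g \<partial>haar) \<le> (\<integral>\<^sup>+g. liminf (\<lambda>n. F (u n) g) \<partial>haar)"
    by (intro nn_integral_mono) auto
  also have "\<dots> \<le> liminf (\<lambda>n. \<integral>\<^sup>+g. F (u n) g \<partial>haar)"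
    by (rule nn_integral_liminf) measurable
  finally show ?thesis by (simp add: F)
qed

text \<open>Both \<open>E\<close> and its complement give lower semicontinuous functions, and their sum is constant.\<close>

lemma continuous_haar_translate:
  assumes U: "open U" "emeasure haar U < \<infinity>" and E: "E \<in> sets borel"
  shows "continuous_on UNIV (\<lambda>h. measure haar {g. h + g \<in> U \<and> g \<in> E})"
  unfolding continuous_on_eq_continuous_within
proof (intro ballI continuous_within_sequentiallyI)
  fix h and u :: "nat \<Rightarrow> 'g" assume u: "u \<longlonglongrightarrow> h"
  have [measurable]: "U \<in> sets borel" "E \<in> sets borel" using U E by auto
  have tot: "emeasure haar {g. a + g \<in> U} = emeasure haar U" for a
  proof -
    have "emeasure haar {g. a + g \<in> U} = (\<integral>\<^sup>+g. indicator {g. a + g \<in> U} g \<partial>haar)"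
      by (rule nn_integral_indicator[symmetric]) measurable
    also have "\<dots> = (\<integral>\<^sup>+g. indicator U (a + g) \<partial>haar)" by (rule nn_integral_cong) (simp add: indicator_def)
    also have "\<dots> = (\<integral>\<^sup>+g. indicator U g \<partial>haar)" by (rule nn_integral_haar_left) measurable
    also have "\<dots> = emeasure haar U" by (rule nn_integral_indicator) measurable
    finally show ?thesis .
  qed
  define m where "m D a = measure haar {g. a + g \<in> U \<and> g \<in> D}" for D a
  have fin: "emeasure haar {g. a + g \<in> U \<and> g \<in> D} < \<infinity>" for a D
  proof (rule le_less_trans)
    show "emeasure haar {g. a + g \<in> U \<and> g \<in> D} \<le> emeasure haar {g. a + g \<in> U}"
      by (intro emeasure_mono) auto
  qed (use U tot in auto)
  have em: "emeasure haar {g. a + g \<in> U \<and> g \<in> D} = ennreal (m D a)" for a D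
    unfolding m_def using fin[of a D] by (intro emeasure_eq_ennreal_measure) auto
  have sum: "m E a + m (- E) a = measure haar U" for a
  proof -
    have "measure haar ({g. a + g \<in> U \<and> g \<in> E} \<union> {g. a + g \<in> U \<and> g \<in> - E}) = m E a + m (- E) a"
      unfolding m_def using fin[of a E] fin[of a "- E"]
      by (intro measure_Union) (auto simp: less_top[symmetric])
    also have "{g. a + g \<in> U \<and> g \<in> E} \<union> {g. a + g \<in> U \<and> g \<in> - E} = {g. a + g \<in> U}" by auto
    finally show ?thesis using tot[of a] by (simp add: measure_def)
  qed
  have lsc: "\<forall>\<^sub>F n in sequentially. m D h - e < m D (u n)" if "D \<in> sets borel" "e > 0" for D e
  proof (cases "m D h - e < 0")
    case True
    then show ?thesis unfolding m_def by (intro always_eventually allI) (rule less_le_trans[OF _ measure_nonneg])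
  next
    case False
    have "ennreal (m D h) \<le> liminf (\<lambda>n. ennreal (m D (u n)))"
      using haar_translate_lsc[OF U(1) that(1) u] by (simp add: em)
    moreover have "ennreal (m D h - e) < ennreal (m D h)"
      using that False by (simp add: ennreal_less_iff)
    ultimately have "\<forall>\<^sub>F n in sequentially. ennreal (m D h - e) < ennreal (m D (u n))"
      unfolding le_Liminf_iff by blast
    then show ?thesis
      by eventually_elim (use False in \<open>simp add: ennreal_less_iff\<close>)
  qed
  have "(\<lambda>n. m E (u n)) \<longlonglongrightarrow> m E h"
  proof (rule tendstoI)
    fix e :: real assume "e > 0"
    then have "\<forall>\<^sub>F n in sequentially. m E h - e < m E (u n)" "\<forall>\<^sub>F n in sequentially. m (- E) h - e < m (- E) (u n)"
      using lsc E by auto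
    then show "\<forall>\<^sub>F n in sequentially. dist (m E (u n)) (m E h) < e"
    proof eventually_elim
      case (elim n)
      then show ?case using sum[of h] sum[of "u n"] by (simp add: dist_real_def abs_less_iff)
    qed
  qed
  then show "(\<lambda>n. measure haar {g. u n + g \<in> U \<and> g \<in> E}) \<longlonglongrightarrow> measure haar {g. h + g \<in> U \<and> g \<in> E}"
    by (simp add: m_def)
qed

text \<open>An uncountable quantifier is made countable. On the compact closure of a basic set, all
  constraints have a common solution iff for every \<open>k\<close> some point of a countable dense
  set satisfies the first \<open>k\<close> of them up to \<open>1 / Suc k\<close>: continuity gives
  the approximate solutions, and compactness turns them into an exact one. An open \<open>U\<close>
  is a countable union of such compact sets.\<close>

lemma sets_ex_in_open:
  fixes c :: "nat \<Rightarrow> 'w \<Rightarrow> 'g \<Rightarrow> real"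
  assumes meas: "\<And>n g. (\<lambda>w. c n w g) \<in> borel_measurable N"
    and cont: "\<And>n w. w \<in> space N \<Longrightarrow> continuous_on UNIV (c n w)" and U: "open U"
  shows "{w \<in> space N. \<exists>g\<in>U. \<forall>n. c n w g \<le> 0} \<in> sets N"
proof -
  obtain D :: "'g set" where D: "countable D" "\<And>X. open X \<Longrightarrow> X \<noteq> {} \<Longrightarrow> \<exists>d\<in>D. d \<in> X"
    using countable_dense_exists by blast
  let ?L = "\<lambda>i. closure (cbase i)" and ?a = "\<lambda>k w q. \<forall>n<k. c n w q < 1 / Suc k"
  have key: "(\<exists>g\<in>?L i. \<forall>n. c n w g \<le> 0) \<longleftrightarrow> (\<forall>k. \<exists>q\<in>D \<inter> cbase i. ?a k w q)"
    if w: "w \<in> space N" for w i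
  proof
    assume "\<exists>g\<in>?L i. \<forall>n. c n w g \<le> 0"
    then obtain g where g: "g \<in> ?L i" "\<And>n. c n w g \<le> 0" by blast
    show "\<forall>k. \<exists>q\<in>D \<inter> cbase i. ?a k w q"
    proof
      fix k
      let ?O = "\<Inter>n\<in>{..<k}. {q. c n w q < 1 / Suc k}"
      have op: "open ?O" by (intro open_INT ballI open_Collect_less cont w continuous_on_const) auto
      have gpos: "c n w g < 1 / Suc k" for n by (rule le_less_trans[OF g(2)]) simp
      then have "g \<in> ?O" by simp
      then have ne: "?O \<inter> cbase i \<noteq> {}" using g(1) \<open>g \<in> ?O\<close> open_Int_closure_eq_empty[OF op, of "cbase i"] by blast
      have "open (?O \<inter> cbase i)" using op by (rule open_Int) simp
      from D(2)[OF this ne] obtain q where "q \<in> D" "q \<in> ?O \<inter> cbase i" by blast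
      then show "\<exists>q\<in>D \<inter> cbase i. ?a k w q" by (intro bexI[of _ q]) auto
    qed
  next
    assume *: "\<forall>k. \<exists>q\<in>D \<inter> cbase i. ?a k w q"
    \<comment> \<open>The one index \<open>k\<close> governs both the number of constraints and the
      tolerance, which makes the closed sets \<open>F k\<close> decreasing; the finite intersection
      property then only has to be checked for single sets.\<close>
    define F where "F k = {g. \<forall>n<k. c n w g \<le> 1 / Suc k}" for k
    have cl: "closed (F k)" for k
    proof -
      have "F k = (\<Inter>n\<in>{..<k}. {g. c n w g \<le> 1 / Suc k})" by (auto simp: F_def)
      also have "closed \<dots>" by (intro closed_INT ballI closed_Collect_le cont w continuous_on_const)
      finally show ?thesis .
    qed
    have anti: "F l \<subseteq> F k" if "k \<le> l" for k l
    proof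
      fix g assume "g \<in> F l"
      then have "c n w g \<le> 1 / Suc l" if "n < k" for n using that \<open>k \<le> l\<close> by (auto simp: F_def)
      moreover have "1 / real (Suc l) \<le> 1 / Suc k" using that by (simp add: frac_le)
      ultimately show "g \<in> F k" unfolding F_def by (blast intro: order_trans)
    qed
    have ne: "?L i \<inter> F k \<noteq> {}" for k
    proof -
      obtain q where q: "q \<in> cbase i" "?a k w q" using * by blast
      have "q \<in> ?L i" using q(1) closure_subset by blast
      moreover have "q \<in> F k" using q(2) by (auto simp: F_def less_imp_le)
      ultimately show ?thesis by blast
    qed
    have "?L i \<inter> (\<Inter>k\<in>UNIV. F k) \<noteq> {}"
    proof (rule compact_imp_fip_image)
      fix I :: "nat set" assume "finite I"
      then have "F (Max (insert 0 I)) \<subseteq> (\<Inter>k\<in>I. F k)"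
        by (intro INF_greatest anti Max_ge) auto
      then show "?L i \<inter> (\<Inter>k\<in>I. F k) \<noteq> {}" using ne[of "Max (insert 0 I)"] by blast
    qed (use cl in auto)
    then obtain g where g: "g \<in> ?L i" "\<And>k. g \<in> F k" by blast
    have "c n w g \<le> 0" for n
    proof (rule field_le_epsilon)
      fix e :: real assume "e > 0"
      then obtain k where k: "1 / Suc k < e" using nat_approx_posE by (auto simp: inverse_eq_divide)
      \<comment> \<open>\<open>F j\<close> controls constraint \<open>n\<close> only if
        \<open>n < j\<close>; the index \<open>k + Suc n\<close> ensures this and keeps the
        tolerance at most \<open>1 / Suc k\<close>.\<close>
      have "c n w g \<le> 1 / Suc (k + Suc n)" using g(2)[of "k + Suc n"] unfolding F_def by force
      also have "\<dots> \<le> 1 / Suc k" by (simp add: frac_le)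
      finally show "c n w g \<le> 0 + e" using k by simp
    qed
    then show "\<exists>g\<in>?L i. \<forall>n. c n w g \<le> 0" using g(1) by blast
  qed
  have U_eq: "U = (\<Union>i\<in>{i. ?L i \<subseteq> U}. ?L i)"
    using cbase_basis[OF U] closure_subset by blast
  have "{w \<in> space N. \<exists>g\<in>U. \<forall>n. c n w g \<le> 0} =
      (\<Union>i\<in>{i. ?L i \<subseteq> U}. {w \<in> space N. \<exists>g\<in>?L i. \<forall>n. c n w g \<le> 0})"
    by (subst U_eq) blast
  also have "\<dots> = (\<Union>i\<in>{i. ?L i \<subseteq> U}. {w \<in> space N. \<forall>k. \<exists>q\<in>D \<inter> cbase i. ?a k w q})"
    by (intro SUP_cong refl Collect_cong conj_cong key)
  also have "\<dots> \<in> sets N"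
  proof (rule sets.countable_UN'')
    fix i
    have cD: "countable (D \<inter> cbase i)" using D(1) by blast
    note meas[measurable]
    have m: "{w \<in> space N. ?a k w q} \<in> sets N" for k q by measurable
    have "{w \<in> space N. \<exists>q\<in>D \<inter> cbase i. ?a k w q} \<in> sets N" for k
    proof -
      have "{w \<in> space N. \<exists>q\<in>D \<inter> cbase i. ?a k w q} =
         (\<Union>q\<in>D \<inter> cbase i. {w \<in> space N. ?a k w q})" by blast
      also have "\<dots> \<in> sets N" by (intro sets.countable_UN' cD) (use m in blast)
      finally show ?thesis .
    qed
    then show "{w \<in> space N. \<forall>k. \<exists>q\<in>D \<inter> cbase i. ?a k w q} \<in> sets N"
      by (rule sets.sets_Collect_countable_All)
  qed auto
  finally show ?thesis .
qed

end

section \<open>Borel actions of the group\<close>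

locale borel_G = lcsc_group haar
  for haar :: "'g::{topological_group_add, t2_space, second_countable_topology} measure" +
  fixes M :: "'x measure" and act :: "'g \<Rightarrow> 'x \<Rightarrow> 'x"
  assumes borel_action: "borel_G_space M act"
begin

lemma act_measurable [measurable (raw)]:
  assumes "f \<in> borel_measurable N" "h \<in> measurable N M"
  shows "(\<lambda>z. act (f z) (h z)) \<in> measurable N M"
proof -
  have "(\<lambda>(g, x). act g x) \<in> measurable (borel \<Otimes>\<^sub>M M) M"
    using borel_action by (simp add: borel_G_space_def)
  from measurable_compose[OF measurable_Pair[OF assms] this] show ?thesis by simp
qed

lemma act_space [simp]: "x \<in> space M \<Longrightarrow> act g x \<in> space M"
  using measurable_space[OF act_measurable[of "\<lambda>_. g" M "\<lambda>x. x"]] by simp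

lemma act_zero [simp]: "x \<in> space M \<Longrightarrow> act 0 x = x"
  and act_add: "x \<in> space M \<Longrightarrow> act (g + h) x = act g (act h x)"
  using borel_action by (auto simp: borel_G_space_def)

lemma act_minus [simp]: "x \<in> space M \<Longrightarrow> act (- g) (act g x) = x" "x \<in> space M \<Longrightarrow> act g (act (- g) x) = x"
  by (simp_all add: act_add[symmetric])

lemma countable_generator:
  "\<exists>E. countable E \<and> E \<subseteq> Pow (space M) \<and> sets M = sigma_sets (space M) E"
proof -
  obtain T where T: "second_countable T" "topspace T = space M"
    "sets M = sigma_sets (space M) {U. openin T U}"
    using borel_action unfolding borel_G_space_def standard_borel_def by blast
  obtain \<B> where B: "countable \<B>" "\<And>V. V \<in> \<B> \<Longrightarrow> openin T V"
      "\<And>U x. openin T U \<Longrightarrow> x \<in> U \<Longrightarrow> \<exists>V\<in>\<B>. x \<in> V \<and> V \<subseteq> U"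
    using T(1) unfolding second_countable_def by metis
  have "sigma_sets (space M) {U. openin T U} = sigma_sets (space M) \<B>"
  proof (rule sigma_sets_eqI)
    fix U assume "U \<in> {U. openin T U}"
    then have "U = (\<Union>V\<in>{V\<in>\<B>. V \<subseteq> U}. V)" using B(3) by blast
    moreover have "(\<Union>V\<in>{V\<in>\<B>. V \<subseteq> U}. V) \<in> sigma_sets (space M) \<B>"
    proof -
      have "\<B> \<subseteq> Pow (space M)" using B(2) T(2) openin_subset by blast
      then interpret S: sigma_algebra "space M" "sigma_sets (space M) \<B>" by (rule sigma_algebra_sigma_sets)
      show ?thesis using B(1) by (intro S.countable_UN') (auto intro: sigma_sets.Basic)
    qed
    ultimately show "U \<in> sigma_sets (space M) \<B>" by simp
  next
    fix V assume "V \<in> \<B>" then show "V \<in> sigma_sets (space M) {U. openin T U}"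
      using B by (auto intro: sigma_sets.Basic)
  qed
  moreover have "\<B> \<subseteq> Pow (space M)" using B(2) T(2) openin_subset by blast
  ultimately show ?thesis using B T by (intro exI[of _ \<B>]) simp
qed

lemma singleton_sets: "x \<in> space M \<Longrightarrow> {x} \<in> sets M"
proof -
  assume x: "x \<in> space M"
  obtain T where T: "completely_metrizable_space T" "topspace T = space M"
    "sets M = sigma_sets (space M) {U. openin T U}"
    using borel_action unfolding borel_G_space_def standard_borel_def by blast
  have "t1_space T" using T(1) completely_metrizable_imp_metrizable_space metrizable_imp_Hausdorff_space
    Hausdorff_imp_t1_space by blast
  then have "openin T (space M - {x})" using x T(2) by (metis closedin_def closedin_t1_singleton)
  then have "space M - {x} \<in> sets M" using T(3) by auto
  then have "space M - (space M - {x}) \<in> sets M" by blast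
  moreover have "space M - (space M - {x}) = {x}" using x by blast
  ultimately show ?thesis by simp
qed

text \<open>
  Averaging the indicators of a countable generator over small open sets of group elements makes
  them continuous along orbits.  No information is lost: applying the averages to
  \<open>{(g, y). g y \<in> A}\<close> recovers \<open>A\<close>, so they generate the Borel structure.
\<close>

lemma ex_orbit_continuous_generator:
  "\<exists>v :: nat \<Rightarrow> 'x \<Rightarrow> real. (\<forall>n. v n \<in> borel_measurable M) \<and> (\<forall>n x. 0 \<le> v n x) \<and>
     (\<forall>n. \<forall>x\<in>space M. continuous_on UNIV (\<lambda>g. v n (act g x))) \<and>
     sets M = sigma_sets (space M) {v n -` S \<inter> space M | n S. S \<in> sets borel}"
proof -
  obtain B :: "nat \<Rightarrow> 'x set" where B: "Int_stable (range B)" "space M \<in> range B" "range B \<subseteq> Pow (space M)"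
      "sets M = sigma_sets (space M) (range B)"
  proof -
    obtain E where "countable E" "E \<subseteq> Pow (space M)" "sets M = sigma_sets (space M) E"
      using countable_generator by blast
    from countable_Int_stable_generator[OF this] show ?thesis using that by auto
  qed
  have "sets (borel :: 'g measure) = sigma_sets (space borel) (range cbase)"
  proof -
    have "topological_basis (range cbase)"
    proof (rule topological_basisI)
      fix V :: "'g set" and x assume "open V" "x \<in> V"
      then obtain n where "x \<in> cbase n" "closure (cbase n) \<subseteq> V" using cbase_basis by blast
      then show "\<exists>B\<in>range cbase. x \<in> B \<and> B \<subseteq> V" using closure_subset[of "cbase n"] by blast
    qed auto
    then have "borel = sigma UNIV (range cbase)" by (intro borel_eq_countable_basis) auto
    then have "sets (borel :: 'g measure) = sets (sigma UNIV (range cbase))" by simp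
    then show ?thesis by (simp add: sets_measure_of)
  qed
  then obtain C :: "nat \<Rightarrow> 'g set" where C: "Int_stable (range C)" "UNIV \<in> range C"
      "sets borel = sigma_sets UNIV (range C)"
      "\<forall>A\<in>range C. \<exists>F. finite F \<and> F \<subseteq> range cbase \<and> A = UNIV \<inter> \<Inter>F"
    using countable_Int_stable_generator[of "range cbase" "borel :: 'g measure"] by auto
  obtain n0 where n0: "(0::'g) \<in> cbase n0" using cbase_basis[of UNIV 0] by auto
  define U where "U = cbase n0"
  \<comment> \<open>Averages of Borel sets \<open>E\<close> of the product: rectangles give the
    functions \<open>v\<close>, and general \<open>E\<close> are reached by a Dynkin
    argument.\<close>
  let ?m = "\<lambda>E x. emeasure haar {g. g \<in> U \<and> (g, act (- g) x) \<in> E}"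
  have U: "open U" "emeasure haar U < \<infinity>" "emeasure haar U > 0"
    using haar_closure_compact_finite[of U] haar_nonempty_open_pos[of U 0] n0 by (auto simp: U_def)
  have C_open: "open (C n)" for n
  proof -
    from bspec[OF C(4) rangeI[of C n]]
    obtain F where F: "finite F" "F \<subseteq> range cbase" "C n = UNIV \<inter> \<Inter>F" by (elim exE conjE)
    have "open (\<Inter>F)" using F by (intro open_Inter) auto
    then show ?thesis using F by simp
  qed
  have Um[measurable]: "U \<in> sets borel" and Cm[measurable]: "C n \<in> sets borel" for n using U C_open by auto
  have Bm[measurable]: "B n \<in> sets M" for n using B by auto
  define v where "v k x = (case prod_decode k of (i, j) \<Rightarrow>
      measure haar {g. g \<in> U \<inter> C i \<and> act (- g) x \<in> B j} * indicator (space M) x)" for k x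
  have fin: "emeasure haar {g. g \<in> U \<and> P g} < \<infinity>" for P
    by (rule le_less_trans[OF emeasure_mono U(2)]) auto
  have em: "?m E \<in> borel_measurable M"
    if [measurable]: "E \<in> sets (borel \<Otimes>\<^sub>M M)" for E
    by (rule measurable_emeasure) (simp, measurable)
  have v_meas: "v n \<in> borel_measurable M" for n
  proof -
    obtain i j where ij: "prod_decode n = (i, j)" by (cases "prod_decode n")
    have "?m (C i \<times> B j) \<in> borel_measurable M"
      by (rule em) measurable
    then have "(\<lambda>x. enn2real (?m (C i \<times> B j) x) * indicator (space M) x) \<in> borel_measurable M"
      by measurable
    then show ?thesis unfolding v_def ij measure_def by (simp add: conj_ac)
  qed
  show ?thesis
  proof (intro exI[of _ v] conjI allI ballI)
    show "v n \<in> borel_measurable M" for n by (rule v_meas)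
  next
    fix n obtain i j where ij: "prod_decode n = (i, j)" by (cases "prod_decode n")
    show "0 \<le> v n x" for x unfolding v_def ij by simp
    fix x assume x: "x \<in> space M"
    have "continuous_on UNIV (\<lambda>h. measure haar {g. h + g \<in> U \<inter> C i \<and> g \<in> {g. act (- g) x \<in> B j}})"
    proof (rule continuous_haar_translate)
      show "open (U \<inter> C i)" using U C_open by auto
      show "emeasure haar (U \<inter> C i) < \<infinity>" using fin[of "\<lambda>g. g \<in> C i"] by (simp add: Int_def)
      have "{g \<in> space borel. act (- g) x \<in> B j} \<in> sets borel" using x by measurable
      then show "{g. act (- g) x \<in> B j} \<in> sets borel" by simp
    qed
    \<comment> \<open>Substituting \<open>h + g\<close> for \<open>g\<close> shifts the dependence
      on \<open>h\<close> from the Borel set \<open>B j\<close> to the open set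
      \<open>U \<inter> C i\<close>, where \<open>continuous_haar_translate\<close> applies.\<close>
    moreover have "v n (act h x) = measure haar {g. h + g \<in> U \<inter> C i \<and> g \<in> {g. act (- g) x \<in> B j}}" for h
    proof -
      have a: "act (- (h + g)) (act h x) = act (- g) x" for g
        using x act_add[of x "- (h + g)" h] by (simp add: minus_add add.assoc)
      let ?E = "{g. g \<in> U \<inter> C i \<and> act (- g) (act h x) \<in> B j}"
      have "{g \<in> space borel. g \<in> U \<inter> C i \<and> act (- g) (act h x) \<in> B j} \<in> sets borel"
        using x by measurable
      then have E: "?E \<in> sets borel" by simp
      have "emeasure haar ?E = (\<integral>\<^sup>+g. indicator ?E (h + g) \<partial>haar)"
        using E by (subst nn_integral_haar_left) auto
      also have "\<dots> = (\<integral>\<^sup>+g. indicator ((\<lambda>g. h + g) -` ?E) g \<partial>haar)"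
        by (rule nn_integral_cong) (simp add: indicator_def)
      also have "\<dots> = emeasure haar ((\<lambda>g. h + g) -` ?E)"
        using measurable_sets_borel[OF _ E, of "\<lambda>g. h + g"] by (intro nn_integral_indicator) auto
      also have "(\<lambda>g. h + g) -` ?E = {g. h + g \<in> U \<inter> C i \<and> g \<in> {g. act (- g) x \<in> B j}}"
        using a by auto
      finally show ?thesis unfolding v_def ij measure_def using x by simp
    qed
    ultimately show "continuous_on UNIV (\<lambda>h. v n (act h x))" by simp
  next
    let ?V = "{v n -` S \<inter> space M | n S. S \<in> sets borel}"
    define N where "N = sigma (space M) ?V"
    have N: "sets N = sigma_sets (space M) ?V" "space N = space M"
      unfolding N_def by (auto intro!: sets_measure_of space_measure_of)
    have vN: "v n \<in> borel_measurable N" for n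
      by (rule measurableI) (auto simp: N intro!: sigma_sets.Basic)
    \<comment> \<open>Dynkin's lemma for the intersection-stable rectangles: on these
      \<open>?m\<close> is one of the functions \<open>v\<close>, and complements are handled by
      subtraction because \<open>U\<close> has finite measure.\<close>
    have rec: "?m E \<in> borel_measurable N"
      if "E \<in> sets (borel \<Otimes>\<^sub>M M)" for E
    proof -
      let ?P = "{c \<times> b | c b. c \<in> range C \<and> b \<in> range B}"
      have "sets (borel \<Otimes>\<^sub>M M) = sets (sigma (space borel \<times> space M) ?P)"
        by (rule sets_pair_eq[where Ca = "{UNIV}" and Cb = "{space M}"]) (use B C in auto)
      also have "\<dots> = sigma_sets (UNIV \<times> space M) ?P"
        using B(3) by (subst sets_measure_of) auto
      finally have sig: "sets (borel \<Otimes>\<^sub>M M) = sigma_sets (UNIV \<times> space M) ?P" .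
      have st: "Int_stable ?P"
      proof (rule Int_stableI)
        fix a b assume "a \<in> ?P" "b \<in> ?P"
        then obtain c d c' d' where *: "a = c \<times> d" "b = c' \<times> d'" "c \<in> range C" "c' \<in> range C" "d \<in> range B" "d' \<in> range B"
          by blast
        then have "c \<inter> c' \<in> range C" "d \<inter> d' \<in> range B" using B(1) C(1) unfolding Int_stable_def by blast+
        moreover have "a \<inter> b = (c \<inter> c') \<times> (d \<inter> d')" using * by auto
        ultimately show "a \<inter> b \<in> ?P" by blast
      qed
      have sec: "{g. g \<in> U \<and> (g, act (- g) x) \<in> E} \<in> sets haar" if "E \<in> sets (borel \<Otimes>\<^sub>M M)" "x \<in> space M" for E x
      proof -
        note that(1)[measurable]
        have "{g \<in> space borel. g \<in> U \<and> (g, act (- g) x) \<in> E} \<in> sets borel" using that(2) by measurable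
        then show ?thesis by simp
      qed
      have sub: "?P \<subseteq> Pow (UNIV \<times> space M)" using B(3) by blast
      from st sub that[unfolded sig] show ?thesis
      proof (induction rule: sigma_sets_induct_disjoint)
        case (basic A)
        then obtain i j where A: "A = C i \<times> B j" by blast
        have "?m A x = ennreal (v (prod_encode (i, j)) x)" if "x \<in> space N" for x
          using that fin[of "\<lambda>g. g \<in> C i \<and> act (- g) x \<in> B j"] unfolding v_def A N
          by (simp add: emeasure_eq_ennreal_measure less_top conj_ac)
        then show ?case using vN by (subst measurable_cong[where g = "\<lambda>x. ennreal (v (prod_encode (i, j)) x)" for i j]) auto
      next
        case empty then show ?case by simp
      next
        case (compl A)
        have "?m (UNIV \<times> space M - A) x = emeasure haar U - ?m A x" if "x \<in> space N" for x
        proof -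
          have "{g. g \<in> U \<and> (g, act (- g) x) \<in> UNIV \<times> space M - A} = U - {g. g \<in> U \<and> (g, act (- g) x) \<in> A}"
            using that N by auto
          then show ?thesis using sec[of A x] compl(1) sig that N fin[of "\<lambda>g. (g, act (- g) x) \<in> A"]
            by (simp add: emeasure_Diff less_top[symmetric])
        qed
        then show ?case using compl(2) by (subst measurable_cong[where g = "\<lambda>x. emeasure haar U - ?m A x"]) auto
      next
        case (union A)
        have "?m (\<Union>i. A i) x = (\<Sum>i. ?m (A i) x)" if "x \<in> space N" for x
        proof -
          have "(\<Sum>i. ?m (A i) x) = emeasure haar (\<Union>i. {g. g \<in> U \<and> (g, act (- g) x) \<in> A i})"
          proof (rule suminf_emeasure)
            show "range (\<lambda>i. {g. g \<in> U \<and> (g, act (- g) x) \<in> A i}) \<subseteq> sets haar"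
              using sec[of _ x] union(2) sig that N by blast
            show "disjoint_family (\<lambda>i. {g. g \<in> U \<and> (g, act (- g) x) \<in> A i})"
              using union(1) unfolding disjoint_family_on_def by blast
          qed
          also have "(\<Union>i. {g. g \<in> U \<and> (g, act (- g) x) \<in> A i}) = {g. g \<in> U \<and> (g, act (- g) x) \<in> (\<Union>i. A i)}"
            by blast
          finally show ?thesis ..
        qed
        then show ?case using union(3) by (subst measurable_cong[where g = "\<lambda>x. \<Sum>i. ?m (A i) x"]) auto
      qed
    qed
    have "A \<in> sets N" if A[measurable]: "A \<in> sets M" for A
    proof -
      define Q where "Q = {z \<in> space (borel \<Otimes>\<^sub>M M). act (fst z) (snd z) \<in> A}"
      have Q: "Q \<in> sets (borel \<Otimes>\<^sub>M M)" unfolding Q_def by measurable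
      have m: "?m Q x = (if x \<in> A then emeasure haar U else 0)"
        if "x \<in> space M" for x
      proof -
        have "{g. g \<in> U \<and> (g, act (- g) x) \<in> Q} = (if x \<in> A then U else {})"
          using that by (auto simp: Q_def space_pair_measure)
        then show ?thesis by simp
      qed
      have "{x \<in> space N. ?m Q x \<noteq> 0} \<in> sets N"
        using rec[OF Q] by measurable
      also have "{x \<in> space N. ?m Q x \<noteq> 0} = A"
        using m U(3) sets.sets_into_space[OF A] N(2) by (auto split: if_splits)
      finally show ?thesis .
    qed
    then have "sets M \<subseteq> sets N" by (rule subsetI)
    moreover have "sets N \<subseteq> sets M"
      unfolding N(1) by (intro sets.sigma_sets_subset) (use v_meas in \<open>auto intro: measurable_sets\<close>)
    ultimately show "sets M = sigma_sets (space M) {v n -` S \<inter> space M | n S. S \<in> sets borel}"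
      unfolding N(1)[symmetric] by (rule equalityI)
  qed
qed

end

subsection \<open>The Effros space and Krengel sets\<close>

lemma space_effros: "space effros = {F :: 'g::topological_space set. closed F}"
  unfolding effros_def by (rule space_measure_of) auto

lemma sets_effros_hit_open [measurable]:
  "open U \<Longrightarrow> {F :: 'g::topological_space set. closed F \<and> F \<inter> U \<noteq> {}} \<in> sets effros"
  unfolding effros_def by (subst sets_measure_of) (auto intro!: sigma_sets.Basic)

lemma measurable_effrosI:
  fixes f :: "'a \<Rightarrow> 'g::topological_space set"
  assumes "\<And>z. z \<in> space N \<Longrightarrow> closed (f z)"
    and "\<And>U. open U \<Longrightarrow> {z \<in> space N. f z \<inter> U \<noteq> {}} \<in> sets N"
  shows "f \<in> measurable N effros"
  unfolding effros_def
proof (rule measurable_measure_of)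
  fix A assume "A \<in> {{F :: 'g set. closed F \<and> F \<inter> U \<noteq> {}} | U. open U}"
  then obtain U where U: "open U" "A = {F. closed F \<and> F \<inter> U \<noteq> {}}" by blast
  have "f -` A \<inter> space N = {z \<in> space N. f z \<inter> U \<noteq> {}}" using assms(1) U by auto
  then show "f -` A \<inter> space N \<in> sets N" using assms(2)[OF U(1)] by simp
qed (use assms(1) in auto)

context lcsc_group
begin

text \<open>Countably many rectangles suffice: a point of \<open>F\<close> with value below
  \<open>a\<close> has a basic neighbourhood \<open>cbase i\<close> on which \<open>c w\<close> is
  at most some rational \<open>r < a\<close>, and by continuity that bound need only be tested on a
  countable dense set.\<close>

lemma sets_effros_hit_less:
  fixes c :: "'w \<Rightarrow> 'g \<Rightarrow> real"
  assumes meas: "\<And>g. (\<lambda>w. c w g) \<in> borel_measurable N"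
    and cont: "\<And>w. w \<in> space N \<Longrightarrow> continuous_on UNIV (c w)"
  shows "{(w, F) \<in> space (N \<Otimes>\<^sub>M effros). \<exists>g\<in>F. c w g < a} \<in> sets (N \<Otimes>\<^sub>M effros)"
proof -
  obtain D :: "'g set" where D: "countable D" "\<And>X. open X \<Longrightarrow> X \<noteq> {} \<Longrightarrow> \<exists>d\<in>D. d \<in> X"
    using countable_dense_exists by blast
  let ?A = "\<lambda>i r. {w \<in> space N. \<forall>q\<in>D \<inter> cbase i. c w q \<le> r} \<times> {F. closed F \<and> F \<inter> cbase i \<noteq> {}}"
  have "{(w, F) \<in> space (N \<Otimes>\<^sub>M effros). \<exists>g\<in>F. c w g < a} = (\<Union>i. \<Union>r\<in>{r\<in>\<rat>. r < a}. ?A i r)" (is "?L = ?R")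
  proof (intro subset_antisym subsetI)
    fix z assume "z \<in> ?L"
    then obtain w F g where z: "z = (w, F)" "w \<in> space N" "closed F" "g \<in> F" "c w g < a"
      by (auto simp: space_pair_measure space_effros)
    obtain r where r: "r \<in> \<rat>" "c w g < r" "r < a" using Rats_dense_in_real[OF z(5)] by blast
    have "open {q. c w q < r}" by (intro open_Collect_less cont z continuous_on_const)
    then obtain i where i: "g \<in> cbase i" "closure (cbase i) \<subseteq> {q. c w q < r}"
      using cbase_basis[of "{q. c w q < r}" g] r(2) by blast
    have "c w q \<le> r" if "q \<in> cbase i" for q using i(2) that closure_subset[of "cbase i"] by force
    then have "z \<in> ?A i r" using z i(1) by auto
    then show "z \<in> ?R" using r by blast
  next
    fix z assume "z \<in> ?R"
    then obtain i r where "r < a" "z \<in> ?A i r" by blast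
    then obtain w F h where z: "z = (w, F)" "w \<in> space N" "closed F" "h \<in> F" "h \<in> cbase i" "r < a"
        "\<And>q. q \<in> D \<inter> cbase i \<Longrightarrow> c w q \<le> r"
      by blast
    have "c w h \<le> r"
    proof (rule ccontr)
      assume gt: "\<not> c w h \<le> r"
      have "open ({q. r < c w q} \<inter> cbase i)"
        by (intro open_Int open_Collect_less cont z continuous_on_const open_cbase)
      moreover have "h \<in> {q. r < c w q} \<inter> cbase i" using gt z(5) by simp
      ultimately obtain d where "d \<in> D" "d \<in> {q. r < c w q} \<inter> cbase i" using D(2) by blast
      then show False using z(7)[of d] by simp
    qed
    then have "c w h < a" using z(6) by simp
    then show "z \<in> ?L" using z(1,2,3,4) by (auto simp: space_pair_measure space_effros)
  qed
  also have "\<dots> \<in> sets (N \<Otimes>\<^sub>M effros)"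
  proof (intro sets.countable_UN'' pair_measureI)
    show "countable {r \<in> \<rat>. r < a}" using countable_rat by (rule countable_subset[rotated]) auto
    fix i r
    have "{w \<in> space N. c w q \<le> r} \<in> sets N" for q using meas[measurable] by measurable
    moreover have "countable (D \<inter> cbase i)" using D(1) by blast
    ultimately have "{w \<in> space N. \<forall>q\<in>D \<inter> cbase i. c w q \<le> r} \<in> sets N"
      by (intro sets.sets_Collect_countable_All')
    then show "{w \<in> space N. \<forall>q\<in>D \<inter> cbase i. c w q \<le> r} \<in> sets N" .
    show "{F :: 'g set. closed F \<and> F \<inter> cbase i \<noteq> {}} \<in> sets effros" by (rule sets_effros_hit_open) simp
  qed auto
  finally show ?thesis .
qed

end

section \<open>A fixed generating family and the measurability of transporters\<close>

context borel_G
begin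

definition gen :: "nat \<Rightarrow> 'x \<Rightarrow> real" where
  "gen = (SOME v. (\<forall>n. v n \<in> borel_measurable M) \<and> (\<forall>n x. 0 \<le> v n x) \<and>
     (\<forall>n. \<forall>x\<in>space M. continuous_on UNIV (\<lambda>g. v n (act g x))) \<and>
     sets M = sigma_sets (space M) {v n -` S \<inter> space M | n S. S \<in> sets borel})"

lemma gen_props:
  "(\<forall>n. gen n \<in> borel_measurable M) \<and> (\<forall>n x. 0 \<le> gen n x) \<and>
     (\<forall>n. \<forall>x\<in>space M. continuous_on UNIV (\<lambda>g. gen n (act g x))) \<and>
     sets M = sigma_sets (space M) {gen n -` S \<inter> space M | n S. S \<in> sets borel}"
  unfolding gen_def by (rule someI_ex[OF ex_orbit_continuous_generator])

lemma gen_measurable [measurable]: "gen n \<in> borel_measurable M"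
  and gen_nonneg [simp]: "0 \<le> gen n x"
  and gen_continuous: "x \<in> space M \<Longrightarrow> continuous_on UNIV (\<lambda>g. gen n (act g x))"
  using gen_props by auto

lemma sets_gen: "sets M = sigma_sets (space M) {gen n -` S \<inter> space M | n S. S \<in> sets borel}"
  using gen_props by (elim conjE)

text \<open>The sets that contain both or neither of \<open>x\<close> and \<open>y\<close> are
  closed under the sigma-algebra operations; if no \<open>gen n\<close> separates the points they
  include the generators, hence the singleton of \<open>x\<close>.\<close>

lemma gen_separates:
  assumes x: "x \<in> space M" and y: "y \<in> space M" and eq: "\<And>n. gen n x = gen n y"
  shows "x = y"
proof -
  have "{x} \<in> sigma_sets (space M) {gen n -` S \<inter> space M | n S. S \<in> sets borel}"
    using singleton_sets[OF x] unfolding sets_gen .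
  then have "x \<in> {x} \<longleftrightarrow> y \<in> {x}"
  proof (induction rule: sigma_sets.induct)
    case (Basic A)
    then obtain n S where "A = gen n -` S \<inter> space M" by blast
    then show ?case using eq[of n] x y by simp
  qed (use x y in auto)
  then show ?thesis by simp
qed

lemma measurable_genI:
  assumes f: "\<And>z. z \<in> space N \<Longrightarrow> f z \<in> space M" and g: "\<And>n. (\<lambda>z. gen n (f z)) \<in> borel_measurable N"
  shows "f \<in> measurable N M"
proof (rule measurable_sigma_sets[OF sets_gen])
  fix A assume "A \<in> {gen n -` S \<inter> space M | n S. S \<in> sets borel}"
  then obtain n S where A: "A = gen n -` S \<inter> space M" "S \<in> sets borel" by blast
  have "f -` A \<inter> space N = (\<lambda>z. gen n (f z)) -` S \<inter> space N" using f A(1) by auto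
  then show "f -` A \<inter> space N \<in> sets N" using measurable_sets[OF g A(2)] by simp
qed (use f in auto)

lemma act_eq_iff_gen:
  "x \<in> space M \<Longrightarrow> y \<in> space M \<Longrightarrow> act g x = y \<longleftrightarrow> (\<forall>n. gen n (act g x) = gen n y)"
  using gen_separates[of "act g x" y] by auto

text \<open>The target is a sequence of numbers rather than a point of the space because in
  \<open>krengel_set_measurable\<close> it is a sequence of infima that need not come from a
  point.\<close>

lemma sets_ex_act_gen:
  assumes [measurable]: "a \<in> measurable N M" "\<And>n. b n \<in> borel_measurable N" and U: "open U"
  shows "{z \<in> space N. \<exists>g\<in>U. \<forall>n. gen n (act g (a z)) = b n z} \<in> sets N"
proof -
  have "{z \<in> space N. \<exists>g\<in>U. \<forall>n. \<bar>gen n (act g (a z)) - b n z\<bar> \<le> 0} \<in> sets N"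
  proof (rule sets_ex_in_open[OF _ _ U])
    show "(\<lambda>z. \<bar>gen n (act g (a z)) - b n z\<bar>) \<in> borel_measurable N" for n g by measurable
    show "continuous_on UNIV (\<lambda>g. \<bar>gen n (act g (a z)) - b n z\<bar>)" if "z \<in> space N" for n z
      using that measurable_space[OF assms(1)] by (intro continuous_intros gen_continuous) auto
  qed
  then show ?thesis by simp
qed

lemma sets_ex_act_eq:
  assumes [measurable]: "a \<in> measurable N M" "b \<in> measurable N M" and U: "open U"
  shows "{z \<in> space N. \<exists>g\<in>U. act g (a z) = b z} \<in> sets N"
proof -
  have "{z \<in> space N. \<exists>g\<in>U. \<forall>n. gen n (act g (a z)) = gen n (b z)} \<in> sets N"
    by (rule sets_ex_act_gen) (use U in measurable)
  also have "{z \<in> space N. \<exists>g\<in>U. \<forall>n. gen n (act g (a z)) = gen n (b z)} = {z \<in> space N. \<exists>g\<in>U. act g (a z) = b z}"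
    by (intro Collect_cong conj_cong bex_cong refl act_eq_iff_gen[symmetric] measurable_space[OF assms(1)] measurable_space[OF assms(2)])
  finally show ?thesis .
qed

lemma closed_act_eq: 
  assumes "x \<in> space M" "y \<in> space M"
  shows "closed {g. act g x = y}"
proof -
  have "{g. act g x = y} = (\<Inter>n. {g. gen n (act g x) = gen n y})"
    using assms by (auto simp: act_eq_iff_gen)
  also have "closed \<dots>" by (intro closed_INT ballI closed_Collect_eq gen_continuous assms continuous_on_const)
  finally show ?thesis .
qed

text \<open>A transporter hits an open \<open>U\<close> iff some \<open>g \<in> U\<close> solves the
  equation, which is a Borel condition on \<open>z\<close>. Different \<open>a\<close> and
  \<open>b\<close> give stabilizers, their left cosets, and the second component of the
  isomorphism.\<close>

lemma transporter_measurable: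
  assumes [measurable]: "a \<in> measurable N M" "b \<in> measurable N M"
  shows "(\<lambda>z. {g. act g (a z) = b z}) \<in> measurable N effros"
proof (rule measurable_effrosI)
  show "closed {g. act g (a z) = b z}" if "z \<in> space N" for z
    using that measurable_space[OF assms(1)] measurable_space[OF assms(2)] by (intro closed_act_eq) auto
  fix U :: "'g set" assume "open U"
  then have "{z \<in> space N. \<exists>g\<in>U. act g (a z) = b z} \<in> sets N" by (intro sets_ex_act_eq) measurable
  also have "{z \<in> space N. \<exists>g\<in>U. act g (a z) = b z} = {z \<in> space N. {g. act g (a z) = b z} \<inter> U \<noteq> {}}" by auto
  finally show "{z \<in> space N. {g. act g (a z) = b z} \<inter> U \<noteq> {}} \<in> sets N" .
qed

lemma left_translate_stabilizer:
  assumes "x \<in> space M"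
  shows "left_translate g (stabilizer act x) = {h. act h x = act g x}"
proof (intro set_eqI iffI)
  fix h assume "h \<in> left_translate g (stabilizer act x)"
  then show "h \<in> {h. act h x = act g x}"
    using assms by (auto simp: left_translate_def stabilizer_def act_add)
next
  fix h assume "h \<in> {h. act h x = act g x}"
  then have "act (- g + h) x = x" using assms by (simp add: act_add)
  then show "h \<in> left_translate g (stabilizer act x)"
    unfolding left_translate_def stabilizer_def by (intro image_eqI[of _ _ "- g + h"]) (simp_all add: add.assoc[symmetric])
qed

lemma stabilizer_subgroup:
  assumes "x \<in> space M"
  shows "0 \<in> stabilizer act x" "g \<in> stabilizer act x \<Longrightarrow> h \<in> stabilizer act x \<Longrightarrow> g + h \<in> stabilizer act x"
    "g \<in> stabilizer act x \<Longrightarrow> - g \<in> stabilizer act x"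
  using assms act_minus(1)[of x g] by (auto simp: stabilizer_def act_add)

text \<open>A closed set \<open>F\<close> is a left coset of the stabilizer of \<open>w\<close> iff
  it is nonempty, every \<open>gen n (act g w)\<close> is constant for \<open>g \<in> F\<close>
  (\<open>?C1\<close>), and \<open>F\<close> contains every \<open>g\<close> with these values
  (\<open>?C2\<close>). Each condition is a countable combination of Borel conditions.\<close>

lemma krengel_set_measurable:
  assumes W: "W \<in> sets M" and \<nu>: "sets \<nu> = sets (restrict_space M W)"
  shows "krengel_set \<nu> (stabilizer act) \<in> sets (\<nu> \<Otimes>\<^sub>M (effros :: 'g set measure))"
proof -
  have Wsp: "W \<subseteq> space M" using W sets.sets_into_space by blast
  have sp: "space \<nu> = W" using sets_eq_imp_space_eq[OF \<nu>] Wsp by (auto simp: space_restrict_space)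
  have id[measurable]: "(\<lambda>w. w) \<in> measurable \<nu> M"
    unfolding measurable_cong_sets[OF \<nu> refl] by (rule measurable_restrict_space1) simp
  let ?E = "effros :: 'g set measure"
  let ?S = "space (\<nu> \<Otimes>\<^sub>M ?E)"
  let ?Ne = "{(w, F) \<in> ?S. F \<noteq> {}}" and ?Hit = "\<lambda>U. {(w, F) \<in> ?S. F \<inter> U \<noteq> {}}"
  let ?Lt = "\<lambda>n a. {(w, F) \<in> ?S. \<exists>g\<in>F. gen n (act g w) < a}"
  let ?Gt = "\<lambda>n a. {(w, F) \<in> ?S. \<exists>g\<in>F. a < gen n (act g w)}"
  have S: "?S = W \<times> {F. closed F}" by (simp add: space_pair_measure sp space_effros)
  have cont: "continuous_on UNIV (\<lambda>g. gen n (act g w))" if "w \<in> space \<nu>" for w n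
    using that sp Wsp by (intro gen_continuous) auto
  have lt: "?Lt n a \<in> sets (\<nu> \<Otimes>\<^sub>M ?E)" for n a
    by (rule sets_effros_hit_less[OF _ cont]) measurable
  have "{(w, F) \<in> ?S. \<exists>g\<in>F. - gen n (act g w) < - a} \<in> sets (\<nu> \<Otimes>\<^sub>M ?E)" for n a
    by (rule sets_effros_hit_less) (measurable, intro continuous_on_minus cont)
  then have gt: "?Gt n a \<in> sets (\<nu> \<Otimes>\<^sub>M ?E)" for n a by simp
  have hit: "?Hit U \<in> sets (\<nu> \<Otimes>\<^sub>M ?E)" if "open U" for U
  proof -
    have "space \<nu> \<times> {F. closed F \<and> F \<inter> U \<noteq> {}} \<in> sets (\<nu> \<Otimes>\<^sub>M ?E)"
      using that by (intro pair_measureI sets_effros_hit_open) auto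
    also have "space \<nu> \<times> {F. closed F \<and> F \<inter> U \<noteq> {}} = ?Hit U" by (auto simp: S sp)
    finally show ?thesis .
  qed
  have ne: "?Ne \<in> sets (\<nu> \<Otimes>\<^sub>M ?E)" using hit[of UNIV] by simp
  \<comment> \<open>On a coset this infimum is the constant value, so no element of \<open>F\<close>
    has to be chosen. Nonnegativity of \<open>gen\<close> bounds it from below, and an empty
    \<open>F\<close> gives the fixed value of \<open>Inf {}\<close>.\<close>
  define V where "V n z = Inf ((\<lambda>g. gen n (act g (fst z))) ` snd z)" for n and z :: "'x \<times> 'g set"
  have V_less: "V n (w, F) < a \<longleftrightarrow> (\<exists>g\<in>F. gen n (act g w) < a)" if "F \<noteq> {}" for n w F a
    unfolding V_def using that by (subst cInf_less_iff) (auto intro!: bdd_belowI[of _ 0])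
  have V: "V n \<in> borel_measurable (\<nu> \<Otimes>\<^sub>M ?E)" for n
    unfolding borel_measurable_iff_less
  proof
    fix a
    have "{z \<in> ?S. V n z < a} = (?Ne \<inter> ?Lt n a) \<union>
        ((?S - ?Ne) \<inter> {z \<in> ?S. Inf ({} :: real set) < a})"
    proof (intro set_eqI)
      fix z :: "'x \<times> 'g set" obtain w F where z: "z = (w, F)" by (cases z)
      show "z \<in> {z \<in> ?S. V n z < a} \<longleftrightarrow> z \<in> (?Ne \<inter> ?Lt n a) \<union>
        ((?S - ?Ne) \<inter> {z \<in> ?S. Inf ({} :: real set) < a})"
      proof (cases "F = {}")
        case True then show ?thesis unfolding z by (simp add: V_def)
      next
        case False then show ?thesis unfolding z by (simp add: V_less)
      qed
    qed
    also have "\<dots> \<in> sets (\<nu> \<Otimes>\<^sub>M ?E)" using ne lt[of n a] by (intro sets.Un sets.Int sets.Diff) auto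
    finally show "{z \<in> ?S. V n z < a} \<in> sets (\<nu> \<Otimes>\<^sub>M ?E)" .
  qed
  let ?D = "\<lambda>i. {z \<in> ?S. \<exists>g\<in>cbase i. \<forall>n. gen n (act g (fst z)) = V n z}"
  \<comment> \<open>Distinct values are separated by a rational, so constancy means that no rational
    \<open>a\<close> has values of \<open>F\<close> on both sides. In \<open>?C2\<close>, a solution
    in \<open>cbase i\<close> forces \<open>F\<close> to meet \<open>cbase i\<close>; as
    \<open>F\<close> is closed, every solution then lies in \<open>F\<close>.\<close>
  let ?C1 = "\<Inter>n. \<Inter>a\<in>\<rat>. ?S - (?Lt n a \<inter> ?Gt n a)"
  let ?C2 = "\<Inter>i. ?S - (?D i - ?Hit (cbase i))"
  have "?D i \<in> sets (\<nu> \<Otimes>\<^sub>M ?E)" for i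
    by (rule sets_ex_act_gen) (use V in \<open>auto intro: measurable_compose[OF measurable_fst id]\<close>)
  then have C2: "?C2 \<in> sets (\<nu> \<Otimes>\<^sub>M ?E)"
    by (intro sets.countable_INT'[OF _ _ image_subsetI] sets.Diff hit sets.top) auto
  have C1: "?C1 \<in> sets (\<nu> \<Otimes>\<^sub>M ?E)"
    by (intro sets.countable_INT'[OF _ _ image_subsetI] sets.Diff sets.Int lt gt countable_rat sets.top) auto
  have "krengel_set \<nu> (stabilizer act) = ?Ne \<inter> ?C1 \<inter> ?C2"
  proof (intro subset_antisym subsetI)
    fix z assume "z \<in> krengel_set \<nu> (stabilizer act)"
    then obtain w g where w: "w \<in> W" "z = (w, left_translate g (stabilizer act w))"
      unfolding krengel_set_def sp by blast
    have wM: "w \<in> space M" using w Wsp by blast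
    define F where "F = {h. act h w = act g w}"
    have z: "z = (w, F)" using w(2) left_translate_stabilizer[OF wM] by (simp add: F_def)
    have zS: "z \<in> ?S" unfolding z S F_def using w(1) wM by (simp add: closed_act_eq)
    have gF: "g \<in> F" "F \<noteq> {}" by (auto simp: F_def)
    have Vg: "V n z = gen n (act g w)" for n
    proof -
      have "(\<lambda>g. gen n (act g w)) ` F = {gen n (act g w)}" using gF(1) by (auto simp: F_def)
      then show ?thesis by (simp add: V_def z)
    qed
    have "z \<in> ?C1" using zS by (auto simp: z F_def)
    moreover have "z \<in> ?C2"
    proof (rule INT_I)
      fix i
      show "z \<in> ?S - (?D i - ?Hit (cbase i))"
      proof (cases "\<exists>g\<in>cbase i. \<forall>n. gen n (act g (fst z)) = V n z")
        case True
        then obtain h where h: "h \<in> cbase i" "\<And>n. gen n (act h w) = gen n (act g w)" unfolding Vg by (auto simp: z)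
        then have "h \<in> F" using gen_separates[of "act h w" "act g w"] wM by (simp add: F_def)
        then have "z \<in> ?Hit (cbase i)" using zS h(1) unfolding z by blast
        then show ?thesis using zS by blast
      qed (use zS in blast)
    qed
    ultimately show "z \<in> ?Ne \<inter> ?C1 \<inter> ?C2" using zS gF(2) unfolding z by blast
  next
    fix z assume z: "z \<in> ?Ne \<inter> ?C1 \<inter> ?C2"
    obtain w F where wF: "z = (w, F)" by (cases z)
    have w: "w \<in> W" "w \<in> space M" and F: "closed F" "F \<noteq> {}" using z Wsp unfolding wF by (auto simp: S)
    have zS: "(w, F) \<in> ?S" using w F by (simp add: S)
    obtain g where g: "g \<in> F" using F(2) by blast
    have nlt: "\<not> gen n (act h w) < gen n (act k w)" if "h \<in> F" "k \<in> F" for n h k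
    proof
      assume "gen n (act h w) < gen n (act k w)"
      then obtain a where a: "a \<in> \<rat>" "gen n (act h w) < a" "a < gen n (act k w)"
        using Rats_dense_in_real by blast
      have "z \<in> ?C1" using z by (rule IntD1[THEN IntD2])
      then have "z \<notin> ?Lt n a \<inter> ?Gt n a"
        using a(1) by blast
      then show False using a(2,3) that zS unfolding wF by blast
    qed
    have eq: "gen n (act h w) = gen n (act g w)" if "h \<in> F" for n h
      using nlt[OF that g] nlt[OF g that] by (simp add: order_class.order_eq_iff not_less)
    have Vg: "V n z = gen n (act g w)" for n
    proof -
      have "(\<lambda>h. gen n (act h w)) ` F = (\<lambda>_. gen n (act g w)) ` F" by (rule image_cong[OF refl eq])
      then have "(\<lambda>h. gen n (act h w)) ` F = {gen n (act g w)}" using g by auto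
      then show ?thesis by (simp add: V_def wF)
    qed
    have "F = {h. act h w = act g w}"
    proof (intro set_eqI iffI)
      fix h assume "h \<in> F"
      then show "h \<in> {h. act h w = act g w}" using eq[of h] gen_separates[of "act h w" "act g w"] w(2) by simp
    next
      fix h assume h: "h \<in> {h. act h w = act g w}"
      show "h \<in> F"
      proof (rule ccontr)
        assume "h \<notin> F"
        then obtain i where i: "h \<in> cbase i" "closure (cbase i) \<subseteq> - F"
          using cbase_basis[of "- F" h] F(1) by auto
        have "z \<in> ?C2" using z by (rule IntD2)
        then have "z \<in> ?S - (?D i - ?Hit (cbase i))"
          by (rule INT_D) simp
        moreover have "\<exists>g\<in>cbase i. \<forall>n. gen n (act g (fst z)) = V n z"
          using i(1) h unfolding Vg by (intro bexI[of _ h]) (auto simp: wF)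
        ultimately have "F \<inter> cbase i \<noteq> {}" using zS unfolding wF by blast
        then show False using i(2) closure_subset[of "cbase i"] by blast
      qed
    qed
    then have "z = (w, left_translate g (stabilizer act w))" using w(2) by (simp add: wF left_translate_stabilizer)
    then show "z \<in> krengel_set \<nu> (stabilizer act)" unfolding krengel_set_def sp using w(1) by blast
  qed
  also have "\<dots> \<in> sets (\<nu> \<Otimes>\<^sub>M ?E)" by (intro sets.Int ne C1 C2)
  finally show ?thesis .
qed

end

subsection \<open>Null sets along orbits\<close>

lemma measure_equivI_AE:
  assumes sets: "sets M = sets N"
    and AE: "\<And>A. A \<in> sets M \<Longrightarrow> (AE x in M. x \<notin> A) \<longleftrightarrow> (AE x in N. x \<notin> A)"
  shows "measure_equiv M N"
proof -
  have "A \<in> null_sets M \<longleftrightarrow> A \<in> null_sets N" for A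
  proof (cases "A \<in> sets M")
    case True
    then show ?thesis using AE[OF True] sets by (simp add: AE_iff_null_sets)
  qed (use sets in \<open>auto simp: null_sets_def\<close>)
  then show ?thesis using sets by (auto simp: measure_equiv_def absolutely_continuous_def)
qed

lemma measure_equiv_AE:
  assumes "measure_equiv M N"
  shows "(AE x in M. P x) \<longleftrightarrow> (AE x in N. P x)"
proof
  assume "AE x in M. P x"
  then show "AE x in N. P x"
    by (rule absolutely_continuous_AE[rotated 2]) (use assms in \<open>auto simp: measure_equiv_def\<close>)
next
  assume "AE x in N. P x"
  then show "AE x in M. P x"
    by (rule absolutely_continuous_AE[rotated 2]) (use assms in \<open>auto simp: measure_equiv_def\<close>)
qed

lemma measure_equiv_density:
  fixes f :: "'a \<Rightarrow> ennreal"
  assumes [measurable]: "f \<in> borel_measurable M" and pos: "AE x in M. 0 < f x"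
  shows "measure_equiv (density M f) M"
proof (rule measure_equivI_AE)
  fix A assume "A \<in> sets (density M f)"
  have "(AE x in M. 0 < f x \<longrightarrow> x \<notin> A) \<longleftrightarrow> (AE x in M. x \<notin> A)"
    using pos by (auto intro: AE_mp)
  then show "(AE x in density M f. x \<notin> A) \<longleftrightarrow> (AE x in M. x \<notin> A)" by (simp add: AE_density)
qed simp

lemma (in sigma_finite_measure) ex_equivalent_prob_space:
  assumes "emeasure M (space M) \<noteq> 0"
  shows "\<exists>N. prob_space N \<and> measure_equiv N M"
proof -
  obtain h where h[measurable]: "h \<in> borel_measurable M" and fin: "integral\<^sup>N M h \<noteq> \<infinity>"
    and pos: "\<And>x. x \<in> space M \<Longrightarrow> 0 < h x" using Ex_finite_integrable_function by blast
  define c where "c = integral\<^sup>N M h"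
  have "c \<noteq> 0"
  proof
    assume "c = 0"
    then have "AE x in M. h x = 0" unfolding c_def by (simp add: nn_integral_0_iff_AE)
    moreover have "AE x in M. 0 < h x" using pos by (intro AE_I2)
    ultimately have "AE x in M. False" by eventually_elim simp
    then have "AE x in M. x \<notin> space M" by eventually_elim simp
    then have "space M \<in> null_sets M" by (simp add: AE_iff_null_sets)
    then show False using assms by auto
  qed
  define N where "N = density M (\<lambda>x. h x / c)"
  have "emeasure N (space N) = 1"
    using \<open>c \<noteq> 0\<close> fin unfolding N_def
    by (simp add: emeasure_density divide_ennreal_def nn_integral_multc c_def[symmetric] less_top ennreal_divide_self[unfolded divide_ennreal_def] cong: nn_integral_cong)
  then have "prob_space N" by (rule prob_spaceI)
  moreover have "measure_equiv N M"
    unfolding N_def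
  proof (rule measure_equiv_density)
    show "AE x in M. 0 < h x / c"
      using pos fin by (intro AE_I2) (auto simp: c_def[symmetric] zero_less_iff_neq_zero ennreal_divide_eq_0_iff)
  qed measurable
  ultimately show ?thesis by blast
qed

locale nonsingular_G = borel_G haar M act
  for haar :: "'g::{topological_group_add, t2_space, second_countable_topology} measure"
    and M :: "'x measure" and act :: "'g \<Rightarrow> 'x \<Rightarrow> 'x" +
  assumes nonsingular: "nonsingular_G_space M act"
begin

lemma sigma_finite_M: "sigma_finite_measure M"
  using nonsingular by (simp add: nonsingular_G_space_def)

lemma AE_act:
  assumes [measurable]: "Measurable.pred M P"
  shows "(AE x in M. P (act g x)) \<longleftrightarrow> (AE x in M. P x)"
proof -
  have "measure_equiv (distr M M (act g)) M"
    using nonsingular spec[of _ "- g"] unfolding nonsingular_G_space_def translate_measure_def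
    by (metis minus_minus)
  then have "(AE x in M. P x) \<longleftrightarrow> (AE x in distr M M (act g). P x)" by (rule measure_equiv_AE[symmetric])
  also have "\<dots> \<longleftrightarrow> (AE x in M. P (act g x))" by (rule AE_distr_iff) measurable
  finally show ?thesis ..
qed

lemma AE_orbit:
  assumes [measurable]: "Measurable.pred M P"
  shows "(AE x in M. AE g in haar. P (act g x)) \<longleftrightarrow> (AE x in M. P x)"
proof -
  interpret S: sigma_finite_measure M by (rule sigma_finite_M)
  interpret pair_sigma_finite M haar ..
  have "(AE x in M. AE g in haar. P (act g x)) \<longleftrightarrow> (AE g in haar. AE x in M. P (act g x))"
    by (rule AE_commute) measurable
  also have "\<dots> \<longleftrightarrow> (AE g in haar. AE x in M. P x)" by (simp add: AE_act)
  also have "\<dots> \<longleftrightarrow> (AE x in M. P x)"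
  proof (cases "AE x in M. P x")
    case False
    have "\<not> (AE g in haar. False)"
    proof
      assume "AE g in haar. False"
      then have "UNIV \<in> null_sets haar" using AE_iff_null_sets[of UNIV haar] by simp
      then show False using left_haar by (auto simp: left_haar_measure_def)
    qed
    then show ?thesis using False by simp
  qed simp
  finally show ?thesis .
qed

lemma AE_haar_orbit:
  assumes [measurable]: "Measurable.pred M P" and x: "x \<in> space M" and y: "y \<in> orbit act x"
  shows "(AE g in haar. P (act g y)) \<longleftrightarrow> (AE g in haar. P (act g x))"
proof -
  obtain h where h: "y = act h x" using y unfolding orbit_def by blast
  have [measurable]: "Measurable.pred borel (\<lambda>g. P (act g x))" using x by measurable
  have "(AE g in haar. P (act g y)) \<longleftrightarrow> (AE g in haar. P (act (g + h) x))" using x by (simp add: h act_add)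
  also have "\<dots> \<longleftrightarrow> (AE g in haar. P (act g x))" by (rule AE_haar_right) measurable
  finally show ?thesis .
qed

text \<open>The null sets of \<open>M\<close> are identified here with those of the image of the
  product of \<open>M'\<close> and \<open>haar\<close> under
  \<open>(x, g) \<mapsto> act g (s x)\<close>; both directions of the theorem rely on it. Almost
  every statement along an orbit may be based at \<open>s x\<close> instead of
  \<open>x\<close>.\<close>

lemma AE_selector:
  assumes P: "Measurable.pred M P" and equiv: "measure_equiv M' M"
    and s: "\<And>x. x \<in> space M \<Longrightarrow> s x \<in> orbit act x"
  shows "(AE x in M'. AE g in haar. P (act g (s x))) \<longleftrightarrow> (AE x in M. P x)"
proof -
  have "(AE x in M'. AE g in haar. P (act g (s x))) \<longleftrightarrow> (AE x in M. AE g in haar. P (act g (s x)))"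
    by (rule measure_equiv_AE[OF equiv])
  also have "\<dots> \<longleftrightarrow> (AE x in M. AE g in haar. P (act g x))"
    by (intro AE_cong AE_haar_orbit P s)
  also have "\<dots> \<longleftrightarrow> (AE x in M. P x)" by (rule AE_orbit[OF P])
  finally show ?thesis .
qed

end

subsection \<open>From a transversal to total dissipativity\<close>

context borel_G
begin

lemma orbit_act: "x \<in> space M \<Longrightarrow> orbit act (act g x) = orbit act x"
proof (intro set_eqI iffI)
  fix y assume x: "x \<in> space M"
  {
    assume "y \<in> orbit act (act g x)"
    then obtain h where "y = act h (act g x)" by (auto simp: orbit_def)
    then have "y = act (h + g) x" using x by (simp add: act_add)
    then show "y \<in> orbit act x" by (auto simp: orbit_def)
  next
    assume "y \<in> orbit act x"
    then obtain h where "y = act h x" by (auto simp: orbit_def)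
    then have "y = act (h - g) (act g x)" using x act_add[of x "h - g" g] by simp
    then show "y \<in> orbit act (act g x)" by (auto simp: orbit_def)
  }
qed

end

locale transversal_G = nonsingular_G haar M act
  for haar :: "'g::{topological_group_add, t2_space, second_countable_topology} measure"
    and M :: "'x measure" and act :: "'g \<Rightarrow> 'x \<Rightarrow> 'x" +
  fixes X1 W :: "'x set" and s :: "'x \<Rightarrow> 'x"
  assumes conull: "invariant_conull_borel M act X1"
    and compact_stabilizer: "\<And>x. x \<in> X1 \<Longrightarrow> compact (stabilizer act x)"
    and transversal: "borel_transversal M act X1 W"
    and selector: "borel_selector M act X1 W s"
begin

lemma X1_sets [measurable]: "X1 \<in> sets M"
  and act_X1: "x \<in> X1 \<Longrightarrow> act g x \<in> X1"
  and null_X1: "space M - X1 \<in> null_sets M"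
  using conull by (auto simp: invariant_conull_borel_def invariant_set_def)

lemma X1_space: "x \<in> X1 \<Longrightarrow> x \<in> space M"
  using sets.sets_into_space[OF X1_sets] by blast

lemma AE_X1: "AE x in M. x \<in> X1"
  by (rule AE_I'[OF null_X1]) auto

lemma W_sets: "W \<in> sets M" and W_X1: "w \<in> W \<Longrightarrow> w \<in> X1"
  using transversal by (auto simp: borel_transversal_def)

lemma selector_W: "x \<in> X1 \<Longrightarrow> s x \<in> W" and selector_orbit: "x \<in> X1 \<Longrightarrow> s x \<in> orbit act x"
  using selector by (auto simp: borel_selector_def)

lemma selector_X1: "x \<in> X1 \<Longrightarrow> s x \<in> X1"
  by (simp add: selector_W W_X1)

lemma selector_eqI: "x \<in> X1 \<Longrightarrow> w \<in> W \<Longrightarrow> w \<in> orbit act x \<Longrightarrow> s x = w"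
  using transversal selector_W[of x] selector_orbit[of x] unfolding borel_transversal_def by blast

lemma selector_act_W: "w \<in> W \<Longrightarrow> s (act g w) = w"
  using orbit_act[OF X1_space[OF W_X1], of w g] act_zero[OF X1_space[OF W_X1], of w]
  by (intro selector_eqI act_X1) (auto simp: W_X1 orbit_def intro: range_eqI[of _ _ 0])

lemma selector_measurable: "s \<in> measurable (restrict_space M X1) M"
  using selector unfolding borel_selector_def
  by (auto dest: measurable_compose[OF _ measurable_restrict_space1[OF measurable_ident]])

definition thickened_stabilizer :: "nat \<Rightarrow> 'x \<Rightarrow> 'g set" where
  "thickened_stabilizer n w = {h + k | h k. h \<in> closure (exhaustion n) \<and> k \<in> stabilizer act w}"

text \<open>Compactness of stabilizers enters here. The elements that carry \<open>w\<close> into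
  the part of its orbit reached by \<open>exhaustion n\<close> lie in a compact set, so that part
  receives finite mass from \<open>haar\<close>.\<close>

lemma transporter_stabilizer:
  assumes "w \<in> W"
  shows "compact (thickened_stabilizer n w)"
    and "{g. \<exists>h\<in>exhaustion n. act h w = act g w} \<subseteq> thickened_stabilizer n w"
proof -
  show "compact (thickened_stabilizer n w)"
    using compact_stabilizer[OF W_X1[OF assms]]
    unfolding thickened_stabilizer_def by (intro compact_group_sum) auto
  show "{g. \<exists>h\<in>exhaustion n. act h w = act g w} \<subseteq> thickened_stabilizer n w"
  proof
    fix g assume "g \<in> {g. \<exists>h\<in>exhaustion n. act h w = act g w}"
    then obtain h where h: "h \<in> exhaustion n" "act h w = act g w" by blast
    have "act (- h + g) w = w" using h(2)[symmetric] X1_space[OF W_X1[OF assms]] by (simp add: act_add)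
    then have "- h + g \<in> stabilizer act w" by (simp add: stabilizer_def)
    moreover have "g = h + (- h + g)" by (simp add: add.assoc[symmetric])
    moreover have "h \<in> closure (exhaustion n)" using h(1) closure_subset by blast
    ultimately show "g \<in> thickened_stabilizer n w" unfolding thickened_stabilizer_def by blast
  qed
qed

text \<open>Off \<open>X1\<close> the point itself is a Borel choice within its orbit;
  \<open>AE_selector\<close> asks for a selector on the whole space.\<close>

definition selector' :: "'x \<Rightarrow> 'x" where
  "selector' x = (if x \<in> X1 then s x else x)"

lemma selector'_measurable [measurable]: "selector' \<in> measurable M M"
proof -
  have "(\<lambda>x. x) \<in> measurable (restrict_space M {x. x \<notin> X1}) M"
    by (rule measurable_restrict_space1) simp
  then show ?thesis unfolding selector'_def using selector_measurable
    by (subst measurable_If_restrict_space_iff) auto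
qed

lemma selector'_orbit:
  assumes "x \<in> space M"
  shows "selector' x \<in> orbit act x"
proof (cases "x \<in> X1")
  case False
  have "x = act 0 x" using assms by simp
  then show ?thesis using False by (auto simp: orbit_def selector'_def)
qed (simp add: selector_orbit selector'_def)

lemma totally_dissipative: "totally_dissipative haar M act"
proof -
  define s0 where "s0 = selector'"
  have s0m[measurable]: "s0 \<in> measurable M M" by (simp add: s0_def)
  have s0o: "s0 x \<in> orbit act x" if "x \<in> space M" for x using selector'_orbit[OF that] by (simp add: s0_def)
  have s0: "s0 x = s x" if "x \<in> X1" for x using that by (simp add: s0_def selector'_def)
  have s0idem: "s0 (act g (s0 x)) = s0 x" if "x \<in> X1" for g x
    using that by (simp add: s0 selector_X1 act_X1 selector_act_W selector_W)
  interpret S: sigma_finite_measure M by (rule sigma_finite_M)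
  obtain M' where M': "prob_space M'" "measure_equiv M' M"
    using S.ex_equivalent_prob_space nonsingular by (auto simp: nonsingular_G_space_def)
  have setsM'[measurable_cong]: "sets M' = sets M" using M'(2) by (simp add: measure_equiv_def)
  interpret M': prob_space M' by (rule M'(1))
  interpret PM: pair_sigma_finite M' haar ..
  have spM': "space M' = space M" using setsM' by (rule sets_eq_imp_space_eq)
  have X1M': "AE x in M'. x \<in> X1" using AE_X1 by (simp add: measure_equiv_AE[OF M'(2)])

  \<comment> \<open>Since \<open>act h\<close> acts on the left of \<open>g\<close>, left invariance
    of \<open>haar\<close> makes \<open>m\<close> invariant. Its mass may be infinite, which the
    weight \<open>u\<close> below controls.\<close>
  define m where "m = distr (M' \<Otimes>\<^sub>M haar) M (\<lambda>(x, g). act g (s0 x))"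
  have sets_m[measurable_cong, simp]: "sets m = sets M" and space_m[simp]: "space m = space M" by (simp_all add: m_def)
  have m_int: "(\<integral>\<^sup>+y. F y \<partial>m) = (\<integral>\<^sup>+x. \<integral>\<^sup>+g. F (act g (s0 x)) \<partial>haar \<partial>M')"
    if [measurable]: "F \<in> borel_measurable M" for F
    unfolding m_def by (subst nn_integral_distr) (auto simp: nn_integral_fst[symmetric] case_prod_beta)
  have m_AE: "(AE y in m. P y) \<longleftrightarrow> (AE y in M. P y)" if [measurable]: "Measurable.pred M P" for P
  proof -
    have "(AE y in m. P y) \<longleftrightarrow> (AE z in M' \<Otimes>\<^sub>M haar. P (act (snd z) (s0 (fst z))))"
      unfolding m_def by (subst AE_distr_iff) (auto simp: case_prod_beta)
    also have "\<dots> \<longleftrightarrow> (AE x in M'. AE g in haar. P (act g (s0 x)))"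
      by (rule PM.AE_pair_iff[of "\<lambda>x g. P (act g (s0 x))", symmetric]) measurable
    also have "\<dots> \<longleftrightarrow> (AE y in M. P y)" by (rule AE_selector[OF that M'(2) s0o])
    finally show ?thesis .
  qed
  have m_inv: "(\<integral>\<^sup>+y. F (act h y) \<partial>m) = (\<integral>\<^sup>+y. F y \<partial>m)" if F[measurable]: "F \<in> borel_measurable M" for F h
  proof -
    have "(\<integral>\<^sup>+y. F (act h y) \<partial>m) = (\<integral>\<^sup>+x. \<integral>\<^sup>+g. F (act h (act g (s0 x))) \<partial>haar \<partial>M')"
      by (rule m_int) measurable
    also have "\<dots> = (\<integral>\<^sup>+x. \<integral>\<^sup>+g. F (act g (s0 x)) \<partial>haar \<partial>M')"
    proof (rule nn_integral_cong)
      fix x assume "x \<in> space M'"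
      then have x: "s0 x \<in> space M" using measurable_space[OF s0m] spM' by simp
      have [measurable]: "(\<lambda>g. F (act g (s0 x))) \<in> borel_measurable borel" using x by measurable
      show "(\<integral>\<^sup>+g. F (act h (act g (s0 x))) \<partial>haar) = (\<integral>\<^sup>+g. F (act g (s0 x)) \<partial>haar)"
        using nn_integral_haar_left[of "\<lambda>g. F (act g (s0 x))" h] x by (simp add: act_add)
    qed
    also have "\<dots> = (\<integral>\<^sup>+y. F y \<partial>m)" by (rule m_int[symmetric]) measurable
    finally show ?thesis .
  qed

  text \<open>A strictly positive \<open>m\<close>-integrable weight, from the finite Haar measure of compact neighbourhoods of stabilizers.\<close>

  define T where "T n = {x \<in> space M. \<exists>g\<in>exhaustion n. act g (s0 x) = x}" for n
  have Tm[measurable]: "T n \<in> sets M" for n unfolding T_def by (rule sets_ex_act_eq) auto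
  define l where "l n x = emeasure haar {g. act g (s0 x) \<in> T n}" for n x
  have lm[measurable]: "l n \<in> borel_measurable M" for n
    unfolding l_def by (rule measurable_emeasure) (simp, measurable)
  have l_fin: "l n x < \<infinity>" if xX: "x \<in> X1" for n x
  proof -
    let ?K = "thickened_stabilizer n (s0 x)"
    have w: "s0 x \<in> W" using xX by (simp add: s0 selector_W)
    have K: "compact ?K" by (rule transporter_stabilizer(1)[OF w])
    have "{g. act g (s0 x) \<in> T n} \<subseteq> {g. \<exists>h\<in>exhaustion n. act h (s0 x) = act g (s0 x)}"
      using s0idem[OF xX] by (auto simp: T_def)
    then have "{g. act g (s0 x) \<in> T n} \<subseteq> ?K" using transporter_stabilizer(2)[OF w] by (rule order_trans)
    then have "l n x \<le> emeasure haar ?K" unfolding l_def using K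
      by (intro emeasure_mono) (auto simp: compact_imp_closed)
    then show ?thesis using haar_compact_finite[OF K] by (rule le_less_trans)
  qed
  let ?e = "\<lambda>n. ennreal ((1/2) ^ Suc n)"
  \<comment> \<open>On orbits in \<open>X1\<close> the function \<open>l n\<close> is constant, so
    the \<open>n\<close>-th term integrates along an orbit to at most \<open>(1/2) ^ Suc n\<close>,
    and these bounds sum to 1; the added 1 in the denominator excludes division by 0. Positivity
    holds because the sets \<open>T n\<close> cover \<open>X1\<close>.\<close>
  define u where "u x = (\<Sum>n. ?e n * (indicator (T n) x / (1 + l n x)))" for x
  have um[measurable]: "u \<in> borel_measurable M" unfolding u_def by measurable
  have u_pos: "0 < u x" if xX: "x \<in> X1" for x
  proof -
    obtain h where h: "s0 x = act h x" using s0o[OF X1_space[OF xX]] by (auto simp: orbit_def)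
    obtain n where n: "- h \<in> exhaustion n" using exhaustion_cover by blast
    have "act (- h) (s0 x) = x" using X1_space[OF xX] by (simp add: h)
    then have "x \<in> T n" using n X1_space[OF xX] unfolding T_def by blast
    then have "0 < ?e n * (indicator (T n) x / (1 + l n x))"
      using l_fin[OF xX, of n] by (simp add: ennreal_zero_less_mult_iff ennreal_zero_less_divide)
    also have "\<dots> \<le> u x" unfolding u_def
      using sum_le_suminf[of "\<lambda>n. ?e n * (indicator (T n) x / (1 + l n x))" "{n}"] by simp
    finally show ?thesis .
  qed
  have half: "(\<Sum>n. ?e n) = 1"
    by (subst suminf_ennreal_eq[OF _ power_half_series]) auto
  have "(\<integral>\<^sup>+y. u y \<partial>m) \<le> 1"
  proof -
    have "(\<integral>\<^sup>+g. u (act g (s0 x)) \<partial>haar) \<le> 1" if x: "x \<in> X1" for x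
    proof -
      have [measurable]: "(\<lambda>g. act g (s0 x)) \<in> measurable borel M" using X1_space[OF selector_X1[OF x], folded s0[OF x]] by measurable
      have lc: "l n (act g (s0 x)) = l n x" for n g by (simp add: l_def s0idem[OF x])
      let ?t = "\<lambda>n g. ?e n * (indicator (T n) (act g (s0 x)) / (1 + l n x))"
      have "(\<integral>\<^sup>+g. u (act g (s0 x)) \<partial>haar) =
          (\<Sum>n. \<integral>\<^sup>+g. ?t n g \<partial>haar)"
        unfolding u_def lc by (rule nn_integral_suminf) measurable
      also have "\<dots> \<le> (\<Sum>n. ?e n)"
      proof (rule suminf_le)
        fix n
        have "(\<integral>\<^sup>+g. ?t n g \<partial>haar) =
            ?e n * ((\<integral>\<^sup>+g. indicator (T n) (act g (s0 x)) \<partial>haar) / (1 + l n x))"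
          by (simp add: nn_integral_cmult nn_integral_divide)
        also have "(\<integral>\<^sup>+g. indicator (T n) (act g (s0 x)) \<partial>haar) = (\<integral>\<^sup>+g. indicator {g. act g (s0 x) \<in> T n} g \<partial>haar)"
          by (rule nn_integral_cong) (simp add: indicator_def)
        also have "\<dots> = l n x" unfolding l_def
        proof (rule nn_integral_indicator)
          have "{g \<in> space borel. act g (s0 x) \<in> T n} \<in> sets borel" by measurable
          then show "{g. act g (s0 x) \<in> T n} \<in> sets haar" by simp
        qed
        also have "l n x / (1 + l n x) \<le> 1"
          using l_fin[OF x, of n] by (intro divide_le_posI_ennreal) (auto simp: add_pos_nonneg)
        then have "?e n * (l n x / (1 + l n x)) \<le> ?e n * 1"
          by (rule mult_left_mono) simp
        finally show "(\<integral>\<^sup>+g. ?t n g \<partial>haar) \<le> ?e n"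
          by simp
      qed auto
      finally show ?thesis unfolding half .
    qed
    then have "(\<integral>\<^sup>+y. u y \<partial>m) \<le> (\<integral>\<^sup>+x. 1 \<partial>M')"
      unfolding m_int[OF um] using X1M' by (intro nn_integral_mono_AE) (auto elim: eventually_mono)
    also have "\<dots> = 1" by (simp add: M'.emeasure_space_1)
    finally show ?thesis .
  qed
  then have u_fin: "(\<integral>\<^sup>+y. u y \<partial>m) \<noteq> \<infinity>" by (auto simp: top_unique)

  \<comment> \<open>Radon-Nikodym derivatives are taken with respect to this finite measure; the
    density of \<open>M\<close> with respect to \<open>m\<close> is then
    \<open>u y * r y\<close>.\<close>
  define N where "N = density m u"
  have u_AE: "AE y in m. 0 < u y"
  proof -
    have "AE y in M. y \<in> X1" using X1M' by (simp add: measure_equiv_AE[OF M'(2)])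
    then have "AE y in m. y \<in> X1" by (subst m_AE) (auto simp: pred_def)
    then show ?thesis by eventually_elim (rule u_pos)
  qed
  have N_AE: "(AE y in N. P y) \<longleftrightarrow> (AE y in M. P y)" if P: "Measurable.pred M P" for P
  proof -
    have "measure_equiv N m" unfolding N_def using u_AE by (intro measure_equiv_density) auto
    then show ?thesis using m_AE[OF P] by (simp add: measure_equiv_AE)
  qed
  have N_equiv: "measure_equiv N M"
  proof (rule measure_equivI_AE)
    show "sets N = sets M" by (simp add: N_def)
    fix A assume "A \<in> sets N"
    then have [measurable]: "A \<in> sets M" by (simp add: N_def)
    show "(AE x in N. x \<notin> A) \<longleftrightarrow> (AE x in M. x \<notin> A)" by (rule N_AE) measurable
  qed
  interpret N: finite_measure N
  proof (rule finite_measureI)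
    have "emeasure N (space N) = (\<integral>\<^sup>+y. u y * indicator (space M) y \<partial>m)"
      by (simp add: N_def emeasure_density)
    also have "\<dots> = (\<integral>\<^sup>+y. u y \<partial>m)" by (rule nn_integral_cong) simp
    finally show "emeasure N (space N) \<noteq> \<infinity>" using u_fin by simp
  qed
  define r where "r = RN_deriv N M"
  have rm[measurable]: "r \<in> borel_measurable M"
    unfolding r_def by (metis N_equiv borel_measurable_RN_deriv measurable_cong_sets measure_equiv_def)
  have Nr: "density N r = M"
    unfolding r_def using N_equiv by (intro N.density_RN_deriv) (auto simp: measure_equiv_def)
  have M_dens: "M = density m (\<lambda>y. u y * r y)"
    unfolding Nr[symmetric] N_def by (rule density_density_eq) auto
  have r_fin: "AE y in N. r y \<noteq> \<infinity>"
    unfolding r_def using N_equiv by (intro N.RN_deriv_finite sigma_finite_M) (auto simp: measure_equiv_def)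
  have r_pos: "AE y in M. r y \<noteq> 0"
  proof -
    have "AE y in density N r. r y \<noteq> 0"
      using N_equiv by (subst AE_density) (auto simp: measure_equiv_def r_def)
    then show ?thesis unfolding Nr .
  qed
  have good: "AE y in m. 0 < u y * r y \<and> u y * r y < \<infinity>"
  proof -
    have "AE y in m. r y \<noteq> 0" using r_pos by (subst m_AE) auto
    moreover have "AE y in m. r y \<noteq> \<infinity>" using r_fin by (subst m_AE) (auto simp: N_AE)
    moreover have "AE y in m. u y \<noteq> \<infinity>" using u_fin by (intro nn_integral_PInf_AE) auto
    ultimately show ?thesis using u_AE
      by eventually_elim (auto simp: ennreal_zero_less_mult_iff zero_less_iff_neq_zero ennreal_mult_less_top less_top)
  qed
  \<comment> \<open>The value 1 on the exceptional null set makes \<open>p\<close> positive and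
    finite everywhere, because the cocycle identities are required at every point and not only
    almost everywhere.\<close>
  define p where "p y = (if 0 < u y * r y \<and> u y * r y < \<infinity> then enn2real (u y * r y) else 1)" for y
  have pm[measurable]: "p \<in> borel_measurable M" unfolding p_def by measurable
  have p_pos: "0 < p y" for y unfolding p_def by (auto simp: enn2real_positive_iff)
  have M_eq: "M = density m (\<lambda>y. ennreal (p y))"
  proof -
    have "AE y in m. u y * r y = ennreal (p y)" using good by eventually_elim (simp add: p_def)
    then have "density m (\<lambda>y. u y * r y) = density m (\<lambda>y. ennreal (p y))"
      by (intro density_cong) auto
    then show ?thesis using M_dens by simp
  qed
  have M_int: "(\<integral>\<^sup>+y. F y \<partial>M) = (\<integral>\<^sup>+y. ennreal (p y) * F y \<partial>m)" if [measurable]: "F \<in> borel_measurable M" for F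
    by (subst M_eq, rule nn_integral_density) auto

  define D where "D g x = p (act g x) / p x" for g x
  have Dm: "(\<lambda>x. D g x) \<in> borel_measurable M" for g unfolding D_def by measurable
  have "rn_cocycle M act D"
    unfolding rn_cocycle_def
  proof (intro conjI allI ballI)
    show "(\<lambda>(g, x). D g x) \<in> borel_measurable (borel \<Otimes>\<^sub>M M)"
      unfolding D_def case_prod_beta by measurable
    show "D g x > 0" for g x using p_pos by (simp add: D_def)
    show "D 0 x = 1" if "x \<in> space M" for x using that p_pos[of x] by (simp add: D_def)
    show "D (g + h) x = D g (act h x) * D h x" if "x \<in> space M" for g h x
      using that p_pos[of "act h x"] by (simp add: D_def act_add)
    fix g
    let ?d = "\<lambda>x. ennreal (D g x)"
    show "AE x in M. ennreal (D g x) = RN_deriv M (translate_measure M act g) x"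
    proof (rule S.RN_deriv_unique)
      show "density M ?d = translate_measure M act g"
        unfolding translate_measure_def
      proof (rule measure_eqI)
        fix A assume "A \<in> sets (density M ?d)"
        then have [measurable]: "A \<in> sets M" by simp
        have "emeasure (density M ?d) A = (\<integral>\<^sup>+x. ennreal (D g x) * indicator A x \<partial>M)"
          using Dm by (intro emeasure_density) auto
        also have "\<dots> = (\<integral>\<^sup>+x. ennreal (p x) * (ennreal (D g x) * indicator A x) \<partial>m)"
          using Dm by (intro M_int) auto
        \<comment> \<open>The argument of the indicator is written as
          \<open>act (- g) (act g x)\<close> so that the integrand is a function of
          \<open>act g x\<close> and \<open>m_inv\<close> applies.\<close>
        also have "\<dots> = (\<integral>\<^sup>+x. ennreal (p (act g x)) * indicator A (act (- g) (act g x)) \<partial>m)"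
        proof (rule nn_integral_cong)
          fix x assume "x \<in> space m"
          moreover have "ennreal (p x) * ennreal (D g x) = ennreal (p (act g x))"
            using p_pos[of x] p_pos[of "act g x"] by (simp add: D_def ennreal_mult[symmetric])
          ultimately show "ennreal (p x) * (ennreal (D g x) * indicator A x) = ennreal (p (act g x)) * indicator A (act (- g) (act g x))"
            by (simp add: mult.assoc[symmetric])
        qed
        also have "\<dots> = (\<integral>\<^sup>+x. ennreal (p x) * indicator A (act (- g) x) \<partial>m)"
          by (rule m_inv) measurable
        also have "\<dots> = (\<integral>\<^sup>+x. indicator A (act (- g) x) \<partial>M)" by (rule M_int[symmetric]) measurable
        also have "\<dots> = (\<integral>\<^sup>+x. indicator A x \<partial>(distr M M (act (- g))))" by (rule nn_integral_distr[symmetric]) measurable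
        also have "\<dots> = emeasure (distr M M (act (- g))) A" by simp
        finally show "emeasure (density M ?d) A = emeasure (distr M M (act (- g))) A" .
      qed simp
    qed (use Dm in measurable)
  qed
  moreover have "hopf_decomposition haar M act D {} (space M)"
  proof -
    have fin: "AE x in M. hopf_sum haar act D f x < \<infinity>" if f: "f \<in> L1_plus M" for f
    proof -
      have fm[measurable]: "f \<in> borel_measurable M" and f_pos: "\<And>x. x \<in> space M \<Longrightarrow> 0 < f x"
        and f_int: "integrable M f" using f by (auto simp: L1_plus_def)
      \<comment> \<open>Integrability of \<open>f\<close> against \<open>M\<close> is finiteness of
        the integral of \<open>F\<close> against \<open>m\<close>, which by \<open>m_int\<close>
        makes almost every orbit integral based at \<open>s0 x\<close> finite.\<close>
      define F where "F y = ennreal (p y * f y)" for y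
      have Fm[measurable]: "F \<in> borel_measurable M" unfolding F_def by measurable
      have "(\<integral>\<^sup>+y. F y \<partial>m) = (\<integral>\<^sup>+y. ennreal (f y) \<partial>M)"
        using f_pos p_pos by (subst M_int) (auto simp: F_def ennreal_mult less_imp_le intro!: nn_integral_cong)
      also have "\<dots> < \<infinity>" using f_int f_pos by (subst nn_integral_eq_integral) (auto intro!: AE_I2 less_imp_le)
      finally have "(\<integral>\<^sup>+x. \<integral>\<^sup>+g. F (act g (s0 x)) \<partial>haar \<partial>M') < \<infinity>" unfolding m_int[OF Fm] .
      moreover have "(\<lambda>x. \<integral>\<^sup>+g. F (act g (s0 x)) \<partial>haar) \<in> borel_measurable M'" by measurable
      ultimately have "AE x in M'. (\<integral>\<^sup>+g. F (act g (s0 x)) \<partial>haar) \<noteq> \<infinity>"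
        by (intro nn_integral_PInf_AE) auto
      then have "AE x in M. (\<integral>\<^sup>+g. F (act g (s0 x)) \<partial>haar) \<noteq> \<infinity>" by (simp only: measure_equiv_AE[OF M'(2)])
      then show ?thesis
      proof (rule AE_mp, intro AE_I2 impI)
        fix x assume x: "x \<in> space M" and fin: "(\<integral>\<^sup>+g. F (act g (s0 x)) \<partial>haar) \<noteq> \<infinity>"
        obtain h where h: "s0 x = act h x" using s0o[OF x] by (auto simp: orbit_def)
        \<comment> \<open>Passing from the base point \<open>s0 x\<close> back to \<open>x\<close>
          changes the orbit integral by a nonzero factor, so finiteness is kept.\<close>
        obtain c where c: "c \<noteq> 0" "\<And>f. f \<in> borel_measurable borel \<Longrightarrow> (\<integral>\<^sup>+k. f (k + h) \<partial>haar) = c * (\<integral>\<^sup>+k. f k \<partial>haar)"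
          using haar_right_scaling by blast
        have [measurable]: "(\<lambda>g. F (act g x)) \<in> borel_measurable borel" using x by measurable
        have "(\<integral>\<^sup>+g. F (act g (s0 x)) \<partial>haar) = c * (\<integral>\<^sup>+g. F (act g x) \<partial>haar)"
          using c(2)[of "\<lambda>g. F (act g x)"] x by (simp add: h act_add)
        then have fin': "(\<integral>\<^sup>+g. F (act g x) \<partial>haar) < \<infinity>" using fin c(1) by (auto simp: ennreal_mult_eq_top_iff less_top)
        have "hopf_sum haar act D f x = (\<integral>\<^sup>+g. ennreal (1 / p x) * F (act g x) \<partial>haar)"
          unfolding hopf_sum_def F_def D_def using p_pos[of x]
          by (intro nn_integral_cong) (simp add: ennreal_mult'[symmetric])
        also have "\<dots> = ennreal (1 / p x) * (\<integral>\<^sup>+g. F (act g x) \<partial>haar)" by (rule nn_integral_cmult) measurable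
        finally show "hopf_sum haar act D f x < \<infinity>" using fin' by (simp add: ennreal_mult_less_top)
      qed
    qed
    have "AE x in M. x \<in> {} \<longleftrightarrow> hopf_sum haar act D f x = \<infinity>" if "f \<in> L1_plus M" for f
      using fin[OF that] by eventually_elim simp
    moreover have "AE x in M. x \<in> space M \<longleftrightarrow> hopf_sum haar act D f x < \<infinity>" if "f \<in> L1_plus M" for f
      using fin[OF that] AE_space by eventually_elim simp
    ultimately show ?thesis unfolding hopf_decomposition_def invariant_set_def by simp
  qed
  ultimately show ?thesis unfolding totally_dissipative_def by (intro exI[of _ D] exI[of _ "{}"] exI[of _ "space M"]) simp
qed

end

subsection \<open>Lexicographic transversals\<close>

context borel_G
begin

text \<open>
  \<open>lexset \<phi> n x\<close> is the set of group elements \<open>g\<close> for which \<open>(\<phi> 0 (g.x), \<dots>, \<phi> (n-1) (g.x))\<close>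
  is lexicographically minimal along the orbit of \<open>x\<close>.
\<close>

primrec lexset :: "(nat \<Rightarrow> 'x \<Rightarrow> real) \<Rightarrow> nat \<Rightarrow> 'x \<Rightarrow> 'g set" where
  "lexset \<phi> 0 x = UNIV"
| "lexset \<phi> (Suc n) x = {g \<in> lexset \<phi> n x. \<phi> n (act g x) = Inf ((\<lambda>g. \<phi> n (act g x)) ` lexset \<phi> n x)}"

abbreviation lexvals :: "(nat \<Rightarrow> 'x \<Rightarrow> real) \<Rightarrow> nat \<Rightarrow> 'x \<Rightarrow> real set" where
  "lexvals \<phi> n x \<equiv> (\<lambda>g. \<phi> n (act g x)) ` lexset \<phi> n x"

definition lexmin :: "(nat \<Rightarrow> 'x \<Rightarrow> real) \<Rightarrow> nat \<Rightarrow> 'x \<Rightarrow> real" where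
  "lexmin \<phi> n x = Inf (lexvals \<phi> n x)"

lemma lexset_iff: "g \<in> lexset \<phi> n x \<longleftrightarrow> (\<forall>i<n. \<phi> i (act g x) = lexmin \<phi> i x)"
  by (induction n) (auto simp: lexmin_def less_Suc_eq)

text \<open>The minimal values belong to the orbit, while the minimising group elements are
  right-translated when the base point moves. In the induction, corresponding minimising sets at
  stage \<open>n\<close> give equal value sets, hence the same infimum for stage
  \<open>Suc n\<close>.\<close>

lemma lexset_act:
  assumes x: "x \<in> space M"
  shows "g \<in> lexset \<phi> n (act h x) \<longleftrightarrow> g + h \<in> lexset \<phi> n x"
    and "lexmin \<phi> n (act h x) = lexmin \<phi> n x"
proof -
  have img: "lexvals \<phi> n (act h x) = lexvals \<phi> n x"
    if *: "\<And>g. g \<in> lexset \<phi> n (act h x) \<longleftrightarrow> g + h \<in> lexset \<phi> n x" for n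
  proof (intro subset_antisym image_subsetI)
    fix g assume "g \<in> lexset \<phi> n (act h x)"
    then have "g + h \<in> lexset \<phi> n x" using * by blast
    then show "\<phi> n (act g (act h x)) \<in> lexvals \<phi> n x"
      using x by (intro image_eqI[of _ _ "g + h"]) (simp_all add: act_add)
  next
    fix g assume "g \<in> lexset \<phi> n x"
    then have "g - h \<in> lexset \<phi> n (act h x)" using *[of "g - h"] by simp
    moreover have "act (g - h) (act h x) = act g x" using x by (simp add: act_add[symmetric])
    ultimately show "\<phi> n (act g x) \<in> lexvals \<phi> n (act h x)"
      by (intro image_eqI[of _ _ "g - h"]) simp_all
  qed
  have 1: "g \<in> lexset \<phi> n (act h x) \<longleftrightarrow> g + h \<in> lexset \<phi> n x" for g n
  proof (induction n arbitrary: g)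
    case (Suc n)
    have "lexvals \<phi> n (act h x) = lexvals \<phi> n x"
      by (rule img) (rule Suc.IH)
    then show ?case using Suc.IH[of g] x by (simp add: act_add)
  qed simp
  show "g \<in> lexset \<phi> n (act h x) \<longleftrightarrow> g + h \<in> lexset \<phi> n x" by (rule 1)
  show "lexmin \<phi> n (act h x) = lexmin \<phi> n x" unfolding lexmin_def using img[OF 1] by simp
qed

text \<open>Compactness comes from stage 0, where a sublevel set is compact; from then on each stage
  minimises a continuous function over a nonempty compact set, so minima are attained.\<close>

lemma lexset_compact:
  assumes cont: "\<And>n. continuous_on UNIV (\<lambda>g. \<phi> n (act g x))" and x: "x \<in> space M"
    and cpt: "compact {g. \<phi> 0 (act g x) \<le> \<phi> 0 x}"
  shows "compact (lexset \<phi> (Suc n) x)" "lexset \<phi> (Suc n) x \<noteq> {}"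
    "bdd_below (lexvals \<phi> n x)"
proof -
  \<comment> \<open>\<open>A\<close> is the set over which one minimises and \<open>K\<close> a
    compact part of it that contains every minimiser. At stage 0, \<open>A\<close> is the whole
    group and \<open>K\<close> the sublevel set; later both are the previous
    \<open>lexset\<close>.\<close>
  have step: "compact {g \<in> A. \<phi> n (act g x) = Inf ((\<lambda>g. \<phi> n (act g x)) ` A)} \<and>
      {g \<in> A. \<phi> n (act g x) = Inf ((\<lambda>g. \<phi> n (act g x)) ` A)} \<noteq> {} \<and> bdd_below ((\<lambda>g. \<phi> n (act g x)) ` A)"
    if K: "compact K" "K \<noteq> {}" "K \<subseteq> A" and le: "\<And>g. g \<in> A \<Longrightarrow> g \<notin> K \<Longrightarrow> \<exists>k\<in>K. \<phi> n (act k x) < \<phi> n (act g x)" for K A n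
  proof -
    obtain k where k: "k \<in> K" "\<And>g. g \<in> K \<Longrightarrow> \<phi> n (act k x) \<le> \<phi> n (act g x)"
      using continuous_attains_inf[OF K(1,2) continuous_on_subset[OF cont subset_UNIV]] by blast
    have kA: "\<phi> n (act k x) \<le> \<phi> n (act g x)" if "g \<in> A" for g
      using le[OF that] k(2) by (cases "g \<in> K") (auto intro: order_trans less_imp_le)
    have inf: "Inf ((\<lambda>g. \<phi> n (act g x)) ` A) = \<phi> n (act k x)"
      using k(1) K(3) kA by (intro cInf_eq_minimum) auto
    have "{g \<in> A. \<phi> n (act g x) = \<phi> n (act k x)} = K \<inter> {g. \<phi> n (act g x) = \<phi> n (act k x)}"
    proof (intro set_eqI iffI)
      fix g assume g: "g \<in> {g \<in> A. \<phi> n (act g x) = \<phi> n (act k x)}"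
      have "g \<in> K"
      proof (rule ccontr)
        assume "g \<notin> K"
        then obtain k' where "k' \<in> K" "\<phi> n (act k' x) < \<phi> n (act g x)" using le g by blast
        then show False using k(2) g by (simp add: leD)
      qed
      then show "g \<in> K \<inter> {g. \<phi> n (act g x) = \<phi> n (act k x)}" using g by simp
    qed (use K(3) in auto)
    moreover have "closed {g. \<phi> n (act g x) = \<phi> n (act k x)}"
      by (intro closed_Collect_eq cont continuous_on_const)
    ultimately have "compact {g \<in> A. \<phi> n (act g x) = \<phi> n (act k x)}" using K(1) by (simp add: compact_Int_closed)
    moreover have "k \<in> {g \<in> A. \<phi> n (act g x) = \<phi> n (act k x)}" using k(1) K(3) by blast
    moreover have "bdd_below ((\<lambda>g. \<phi> n (act g x)) ` A)" using kA by (intro bdd_belowI2) auto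
    ultimately show ?thesis unfolding inf by blast
  qed
  have *: "compact (lexset \<phi> (Suc n) x) \<and> lexset \<phi> (Suc n) x \<noteq> {} \<and> bdd_below (lexvals \<phi> n x)"
  proof (induction n)
    case 0
    have "0 \<in> {g. \<phi> 0 (act g x) \<le> \<phi> 0 x}" using x by simp
    then have ne: "{g. \<phi> 0 (act g x) \<le> \<phi> 0 x} \<noteq> {}" by blast
    have "\<exists>k\<in>{g. \<phi> 0 (act g x) \<le> \<phi> 0 x}. \<phi> 0 (act k x) < \<phi> 0 (act g x)"
      if "g \<notin> {g. \<phi> 0 (act g x) \<le> \<phi> 0 x}" for g
      using that x by (intro bexI[of _ 0]) auto
    from step[OF cpt ne subset_UNIV this] show ?case by simp
  next
    case (Suc n)
    show ?case
      unfolding lexset.simps(2)[of \<phi> "Suc n"]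
      by (rule step[of "lexset \<phi> (Suc n) x"]) (use Suc in blast)+
  qed
  show "compact (lexset \<phi> (Suc n) x)" by (rule *[THEN conjunct1])
  show "lexset \<phi> (Suc n) x \<noteq> {}" by (rule *[THEN conjunct2, THEN conjunct1])
  show "bdd_below (lexvals \<phi> n x)" by (rule *[THEN conjunct2, THEN conjunct2])
qed

text \<open>The minimum at stage \<open>n\<close> is below \<open>a\<close> iff some
  \<open>g\<close>, minimal at all earlier stages, has value at most a rational
  \<open>r < a\<close>. By induction the earlier minima are Borel, so these are countably many
  closed conditions on \<open>g\<close>, and \<open>sets_ex_in_open\<close> applies with the whole
  group.\<close>

lemma lexmin_measurable:
  assumes X1: "X1 \<in> sets M"
    and \<phi>[measurable]: "\<And>n. \<phi> n \<in> borel_measurable M"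
    and cont: "\<And>n x. x \<in> X1 \<Longrightarrow> continuous_on UNIV (\<lambda>g. \<phi> n (act g x))"
    and cpt: "\<And>x. x \<in> X1 \<Longrightarrow> compact {g. \<phi> 0 (act g x) \<le> \<phi> 0 x}"
  shows "lexmin \<phi> n \<in> borel_measurable (restrict_space M X1)"
proof (induction n rule: less_induct)
  case (less n)
  let ?N = "restrict_space M X1"
  have X1s: "X1 \<subseteq> space M" using X1 sets.sets_into_space by blast
  then have sp: "space ?N = X1" by (auto simp: space_restrict_space)
  have id[measurable]: "(\<lambda>x. x) \<in> measurable ?N M" by (rule measurable_restrict_space1) simp
  show ?case unfolding borel_measurable_iff_less
  proof
    fix a
    \<comment> \<open>From index \<open>n\<close> on, the constraint
      \<open>\<phi> n (act g x) \<le> r\<close> is repeated, since \<open>sets_ex_in_open\<close>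
      takes an infinite sequence; equations become bounds on absolute values.\<close>
    define c where "c r k x g = (if k < n then \<bar>\<phi> k (act g x) - lexmin \<phi> k x\<bar> else \<phi> n (act g x) - r)" for r k x g
    have "{x \<in> space ?N. \<exists>g\<in>UNIV. \<forall>k. c r k x g \<le> 0} \<in> sets ?N" for r
    proof (rule sets_ex_in_open)
      show "(\<lambda>x. c r k x g) \<in> borel_measurable ?N" for k g
      proof (cases "k < n")
        case True
        note less.IH[OF True, measurable]
        show ?thesis using True unfolding c_def by simp
      next
        case False
        then show ?thesis unfolding c_def by simp
      qed
      show "continuous_on UNIV (c r k x)" if "x \<in> space ?N" for k x
        using that sp unfolding c_def by (cases "k < n") (auto intro!: continuous_intros cont)
    qed simp
    then have "(\<Union>r\<in>{r\<in>\<rat>. r < a}. {x \<in> space ?N. \<exists>g\<in>UNIV. \<forall>k. c r k x g \<le> 0}) \<in> sets ?N"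
      by (intro sets.countable_UN'' countable_subset[OF _ countable_rat]) auto
    also have "(\<Union>r\<in>{r\<in>\<rat>. r < a}. {x \<in> space ?N. \<exists>g\<in>UNIV. \<forall>k. c r k x g \<le> 0}) = {x \<in> space ?N. lexmin \<phi> n x < a}"
      (is "?L = ?R")
    proof (intro set_eqI)
      fix x show "x \<in> ?L \<longleftrightarrow> x \<in> ?R"
      proof (cases "x \<in> X1")
        case x: True
        have ck: "(\<forall>k. c r k x g \<le> 0) \<longleftrightarrow> g \<in> lexset \<phi> n x \<and> \<phi> n (act g x) \<le> r" for r g
        proof
          assume *: "\<forall>k. c r k x g \<le> 0"
          have "\<phi> i (act g x) = lexmin \<phi> i x" if "i < n" for i using *[rule_format, of i] that by (simp add: c_def)
          moreover have "\<phi> n (act g x) \<le> r" using *[rule_format, of n] by (simp add: c_def)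
          ultimately show "g \<in> lexset \<phi> n x \<and> \<phi> n (act g x) \<le> r" by (simp add: lexset_iff)
        next
          assume *: "g \<in> lexset \<phi> n x \<and> \<phi> n (act g x) \<le> r"
          then show "\<forall>k. c r k x g \<le> 0" by (auto simp: c_def lexset_iff)
        qed
        have ne: "lexset \<phi> n x \<noteq> {}" and bdd: "bdd_below (lexvals \<phi> n x)"
          using lexset_compact(2,3)[where \<phi> = \<phi>, OF cont[OF x] subsetD[OF X1s x] cpt[OF x], of n] by auto
        have "lexmin \<phi> n x < a \<longleftrightarrow> (\<exists>g\<in>lexset \<phi> n x. \<phi> n (act g x) < a)"
          unfolding lexmin_def using ne bdd by (subst cInf_less_iff) auto
        also have "\<dots> \<longleftrightarrow> (\<exists>r\<in>{r\<in>\<rat>. r < a}. \<exists>g. g \<in> lexset \<phi> n x \<and> \<phi> n (act g x) \<le> r)"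
        proof
          assume "\<exists>g\<in>lexset \<phi> n x. \<phi> n (act g x) < a"
          then obtain g where g: "g \<in> lexset \<phi> n x" "\<phi> n (act g x) < a" by blast
          obtain r where "r \<in> \<rat>" "\<phi> n (act g x) < r" "r < a" using Rats_dense_in_real[OF g(2)] by blast
          then show "\<exists>r\<in>{r\<in>\<rat>. r < a}. \<exists>g. g \<in> lexset \<phi> n x \<and> \<phi> n (act g x) \<le> r" using g(1) less_imp_le by blast
        next
          assume "\<exists>r\<in>{r\<in>\<rat>. r < a}. \<exists>g. g \<in> lexset \<phi> n x \<and> \<phi> n (act g x) \<le> r"
          then show "\<exists>g\<in>lexset \<phi> n x. \<phi> n (act g x) < a" using le_less_trans by blast
        qed
        finally show ?thesis using x sp by (simp add: ck)
      qed (simp add: sp)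
    qed
    finally show "{x \<in> space ?N. lexmin \<phi> n x < a} \<in> sets ?N" .
  qed
qed

text \<open>The transversal consists of the lexicographic minima of \<open>(F, gen 0, gen 1, \<dots>)\<close> along orbits.\<close>

lemma ex_transversal:
  fixes F :: "'x \<Rightarrow> real"
  assumes X1: "X1 \<in> sets M" "invariant_set act X1"
    and F[measurable]: "F \<in> borel_measurable M"
    and cont: "\<And>x. x \<in> X1 \<Longrightarrow> continuous_on UNIV (\<lambda>g. F (act g x))"
    and cpt: "\<And>x. x \<in> X1 \<Longrightarrow> compact {g. F (act g x) \<le> F x}"
  shows "\<exists>W s. borel_transversal M act X1 W \<and> borel_selector M act X1 W s"
proof -
  \<comment> \<open>\<open>F\<close> comes first because its sublevel sets along orbits are compact;
    the functions \<open>gen\<close> follow because they separate points, which makes the minimising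
    point of an orbit unique.\<close>
  define \<phi> where "\<phi> n = (case n of 0 \<Rightarrow> F | Suc k \<Rightarrow> gen k)" for n
  have \<phi>0: "\<phi> 0 = F" and \<phi>S: "\<phi> (Suc k) = gen k" for k by (simp_all add: \<phi>_def)
  have X1s: "X1 \<subseteq> space M" using X1(1) sets.sets_into_space by blast
  have \<phi>m[measurable]: "\<phi> n \<in> borel_measurable M" for n by (cases n) (simp_all add: \<phi>_def)
  have \<phi>c: "continuous_on UNIV (\<lambda>g. \<phi> n (act g x))" if "x \<in> X1" for n x
    using that X1s cont gen_continuous by (cases n) (auto simp: \<phi>_def)
  have \<phi>k: "compact {g. \<phi> 0 (act g x) \<le> \<phi> 0 x}" if "x \<in> X1" for x using cpt[OF that] by (simp add: \<phi>0)
  let ?N = "restrict_space M X1"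
  have sp: "space ?N = X1" using X1s by (auto simp: space_restrict_space)
  have [measurable]: "lexmin \<phi> n \<in> borel_measurable ?N" for n
    by (rule lexmin_measurable[where \<phi> = \<phi>, OF X1(1) \<phi>m \<phi>c \<phi>k])
  have [measurable]: "\<phi> n \<in> borel_measurable ?N" for n by (rule measurable_restrict_space1) measurable
  define W where "W = {x \<in> space ?N. \<forall>n. \<phi> n x = lexmin \<phi> n x}"
  have "W \<in> sets ?N" unfolding W_def by measurable
  then have W: "W \<in> sets M" "W \<subseteq> X1" using X1 X1s by (auto simp: sets_restrict_space_iff inf_absorb1)
  have inv: "lexmin \<phi> n y = lexmin \<phi> n x" if "x \<in> X1" "y \<in> orbit act x" for x y n
    using that X1s lexset_act(2) by (auto simp: orbit_def)
  have eq: "y = z" if "x \<in> X1" "y \<in> W \<inter> orbit act x" "z \<in> W \<inter> orbit act x" for x y z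
  proof (rule gen_separates)
    show "y \<in> space M" "z \<in> space M" using that W X1s by auto
    show "gen n y = gen n z" for n
      using that inv[of x y "Suc n"] inv[of x z "Suc n"] by (simp add: W_def \<phi>S[symmetric])
  qed
  have ex: "\<exists>w. w \<in> W \<and> w \<in> orbit act x" if x: "x \<in> X1" for x
  proof -
    have xs: "x \<in> space M" using x X1s by blast
    note K = lexset_compact[where \<phi> = \<phi>, OF \<phi>c[OF x] xs \<phi>k[OF x]]
    have anti: "lexset \<phi> (Suc n) x \<subseteq> lexset \<phi> (Suc k) x" if "k \<le> n" for k n
      using that by (auto simp: lexset_iff simp del: lexset.simps)
    \<comment> \<open>\<open>lexset \<phi> 0 x\<close> is the whole group, so the decreasing
      sequence of compact sets starts at \<open>Suc 0\<close>.\<close>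
    have "lexset \<phi> (Suc 0) x \<inter> (\<Inter>n\<in>UNIV. lexset \<phi> (Suc n) x) \<noteq> {}"
    proof (rule compact_imp_fip_image[OF K(1)])
      show "closed (lexset \<phi> (Suc n) x)" for n by (rule compact_imp_closed[OF K(1)])
      fix I :: "nat set" assume "finite I"
      then have "lexset \<phi> (Suc (Max (insert 0 I))) x \<subseteq> (\<Inter>n\<in>insert 0 I. lexset \<phi> (Suc n) x)"
        by (intro INF_greatest anti Max_ge) auto
      then show "lexset \<phi> (Suc 0) x \<inter> (\<Inter>n\<in>I. lexset \<phi> (Suc n) x) \<noteq> {}"
        using K(2)[of "Max (insert 0 I)"] by blast
    qed
    then obtain g where g: "\<And>n. g \<in> lexset \<phi> (Suc n) x" by blast
    have "\<phi> n (act g x) = lexmin \<phi> n (act g x)" for n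
      using g[of n] unfolding lexset_iff lexset_act(2)[OF xs] by simp
    moreover have "act g x \<in> X1" using x X1(2) by (simp add: invariant_set_def)
    ultimately have "act g x \<in> W" by (simp add: W_def sp)
    then show ?thesis by (auto simp: orbit_def)
  qed
  have ex1: "\<exists>!w. w \<in> W \<and> w \<in> orbit act x" if "x \<in> X1" for x
    using ex[OF that] eq[OF that] by blast
  define s where "s x = (THE w. w \<in> W \<and> w \<in> orbit act x)" for x
  have s: "s x \<in> W \<and> s x \<in> orbit act x" if "x \<in> X1" for x
    unfolding s_def by (rule theI'[OF ex1[OF that]])
  have "s \<in> measurable ?N M"
  proof (rule measurable_genI)
    show "s x \<in> space M" if "x \<in> space ?N" for x using s[of x] that sp W X1s by auto
    fix n
    \<comment> \<open>A transversal point attains all minima of its orbit, so the coordinates of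
      \<open>s x\<close> are Borel in \<open>x\<close>; the shift by \<open>Suc\<close> is due to
      \<open>F\<close> at index 0.\<close>
    have "gen n (s x) = lexmin \<phi> (Suc n) x" if "x \<in> space ?N" for x
      using s[of x] that sp inv[of x "s x" "Suc n"] by (simp add: W_def \<phi>S[symmetric])
    then show "(\<lambda>x. gen n (s x)) \<in> borel_measurable ?N"
      by (subst measurable_cong[where g = "lexmin \<phi> (Suc n)"]) auto
  qed
  then have "s \<in> measurable ?N (restrict_space M W)"
    using s sp by (intro measurable_restrict_space2) auto
  then have "borel_selector M act X1 W s" using s by (simp add: borel_selector_def)
  moreover have "borel_transversal M act X1 W" using W ex1 by (simp add: borel_transversal_def)
  ultimately show ?thesis by blast
qed

end

subsection \<open>From total dissipativity to a transversal\<close>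

lemma ennreal_mult_divide_mult_cancel_left:
  fixes a b c :: ennreal
  assumes "c \<noteq> 0" "c \<noteq> \<infinity>"
  shows "(c * a) / (c * b) = a / b"
proof -
  have c: "0 < c" "c < \<top>" using assms by (auto simp: zero_less_iff_neq_zero less_top)
  have "(c * a) / (c * b) = (c / c) * (a / b)"
    using c by (simp add: divide_ennreal_def ennreal_inverse_mult' mult_ac)
  then show ?thesis using c by simp
qed

lemma measure_equiv_distr:
  assumes equiv: "measure_equiv M N" and f: "f \<in> measurable M L"
  shows "measure_equiv (distr M L f) (distr N L f)"
proof (rule measure_equivI_AE)
  have "sets M = sets N" using equiv by (simp add: measure_equiv_def)
  then have f': "f \<in> measurable N L" using f measurable_cong_sets by blast
  fix A assume "A \<in> sets (distr M L f)"
  then have "A \<in> sets L" by simp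
  then have A: "{x \<in> space L. x \<notin> A} \<in> sets L" by (simp add: set_diff_eq[symmetric] sets.Diff sets.top)
  show "(AE x in distr M L f. x \<notin> A) \<longleftrightarrow> (AE x in distr N L f. x \<notin> A)"
    by (simp add: AE_distr_iff[OF f A] AE_distr_iff[OF f' A] measure_equiv_AE[OF equiv])
qed simp

section \<open>Averages of a bump function against a finite measure on the group\<close>

context lcsc_group
begin

lemma average_integrable:
  fixes q :: "'g \<Rightarrow> real"
  assumes \<nu>: "finite_measure \<nu>" "sets \<nu> = sets borel"
    and q: "continuous_on UNIV q" "\<And>g. 0 \<le> q g" "\<And>g. q g \<le> c"
  shows "integrable \<nu> (\<lambda>g. q (g - h))"
proof (rule finite_measure.integrable_const_bound[OF \<nu>(1)])
  have [measurable]: "q \<in> borel_measurable borel" by (rule borel_measurable_continuous_onI[OF q(1)])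
  have "(\<lambda>g. q (g - h)) \<in> borel_measurable borel" by measurable
  then show "(\<lambda>g. q (g - h)) \<in> borel_measurable \<nu>" using measurable_cong_sets[OF \<nu>(2) refl] by blast
  show "AE g in \<nu>. norm (q (g - h)) \<le> c" using q(2,3) by simp
qed

lemma average_continuous:
  fixes q :: "'g \<Rightarrow> real"
  assumes \<nu>: "finite_measure \<nu>" "sets \<nu> = sets borel"
    and q: "continuous_on UNIV q" "\<And>g. 0 \<le> q g" "\<And>g. q g \<le> c"
  shows "continuous_on UNIV (\<lambda>h. \<integral>g. q (g - h) \<partial>\<nu>)"
  unfolding continuous_on_eq_continuous_within
proof (intro ballI continuous_within_sequentiallyI)
  interpret finite_measure \<nu> by (rule \<nu>)
  note \<nu>(2)[measurable_cong]
  have [measurable]: "q \<in> borel_measurable borel" by (rule borel_measurable_continuous_onI[OF q(1)])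
  fix h and u :: "nat \<Rightarrow> 'g" assume u: "u \<longlonglongrightarrow> h"
  show "(\<lambda>n. \<integral>g. q (g - u n) \<partial>\<nu>) \<longlonglongrightarrow> (\<integral>g. q (g - h) \<partial>\<nu>)"
  proof (rule integral_dominated_convergence[where w = "\<lambda>_. c"])
    have "(\<lambda>n. q (g - u n)) \<longlonglongrightarrow> q (g - h)" for g
    proof -
      have "(\<lambda>n. g + - u n) \<longlonglongrightarrow> g + - h" by (intro tendsto_intros u)
      then show ?thesis
        using continuous_on_tendsto_compose[OF q(1), of "\<lambda>n. g + - u n" "g + - h" sequentially] by simp
    qed
    then show "AE g in \<nu>. (\<lambda>n. q (g - u n)) \<longlonglongrightarrow> q (g - h)" by simp
    show "AE g in \<nu>. norm (q (g - u n)) \<le> c" for n using q(2,3) by simp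
    show "(\<lambda>g. q (g - h)) \<in> borel_measurable \<nu>" "(\<lambda>g. q (g - u n)) \<in> borel_measurable \<nu>" for n
      by measurable
  qed simp
qed

text \<open>Outside some \<open>exhaustion n\<close> the mass of the measure times \<open>c\<close>
  is below \<open>e\<close>. For the average at \<open>h\<close> to reach \<open>e\<close>, the
  support of \<open>q (g - h)\<close> in the variable \<open>g\<close>, contained in
  \<open>L + h\<close>, must therefore meet \<open>exhaustion n\<close>, which puts \<open>h\<close>
  in the compact set \<open>- L + closure (exhaustion n)\<close>.\<close>

lemma average_proper:
  fixes q :: "'g \<Rightarrow> real"
  assumes \<nu>: "finite_measure \<nu>" "sets \<nu> = sets borel"
    and q: "continuous_on UNIV q" "\<And>g. 0 \<le> q g" "\<And>g. q g \<le> c"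
    and L: "compact L" "\<And>g. q g \<noteq> 0 \<Longrightarrow> g \<in> L" and e: "0 < e"
  shows "compact {h. e \<le> (\<integral>g. q (g - h) \<partial>\<nu>)}"
proof -
  interpret finite_measure \<nu> by (rule \<nu>)
  note \<nu>(2)[measurable_cong]
  have sp: "space \<nu> = UNIV" using sets_eq_imp_space_eq[OF \<nu>(2)] by simp
  have qm[measurable]: "q \<in> borel_measurable borel" by (rule borel_measurable_continuous_onI[OF q(1)])
  have [measurable]: "exhaustion n \<in> sets borel" for n by simp
  have c: "0 \<le> c" using q(2,3)[of 0] by linarith
  have "(\<lambda>n. measure \<nu> (exhaustion n)) \<longlonglongrightarrow> measure \<nu> (\<Union>n. exhaustion n)"
    by (rule finite_Lim_measure_incseq) (use exhaustion_mono \<nu>(2) in \<open>auto simp: incseq_def\<close>)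
  moreover have "(\<Union>n. exhaustion n) = space \<nu>" using exhaustion_cover sp by auto
  ultimately have "(\<lambda>n. c * (measure \<nu> (space \<nu>) - measure \<nu> (exhaustion n))) \<longlonglongrightarrow> c * (measure \<nu> (space \<nu>) - measure \<nu> (space \<nu>))"
    by (intro tendsto_intros) simp
  then have "(\<lambda>n. c * (measure \<nu> (space \<nu>) - measure \<nu> (exhaustion n))) \<longlonglongrightarrow> 0" by simp
  then have "\<forall>\<^sub>F n in sequentially. c * (measure \<nu> (space \<nu>) - measure \<nu> (exhaustion n)) < e"
    using e by (rule order_tendstoD)
  then obtain n where n: "c * (measure \<nu> (space \<nu>) - measure \<nu> (exhaustion n)) < e"
    using eventually_happens'[OF sequentially_bot] by blast
  let ?K = "{h + k | h k. h \<in> uminus ` L \<and> k \<in> closure (exhaustion n)}"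
  have K: "compact ?K" by (intro compact_group_sum compact_group_minus L(1)) simp
  let ?S = "{h. e \<le> (\<integral>g. q (g - h) \<partial>\<nu>)}"
  have sub: "?S \<subseteq> ?K"
  proof
    fix h assume h: "h \<in> {h. e \<le> (\<integral>g. q (g - h) \<partial>\<nu>)}"
    have "\<exists>g\<in>exhaustion n. q (g - h) \<noteq> 0"
    proof (rule ccontr)
      assume none: "\<not> (\<exists>g\<in>exhaustion n. q (g - h) \<noteq> 0)"
      have "(\<integral>g. q (g - h) \<partial>\<nu>) \<le> (\<integral>g. c * indicator (space \<nu> - exhaustion n) g \<partial>\<nu>)"
      proof (rule integral_mono)
        show "integrable \<nu> (\<lambda>g. q (g - h))"
          by (rule average_integrable[OF \<nu> q])
        show "integrable \<nu> (\<lambda>g. c * indicator (space \<nu> - exhaustion n) g)"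
          by (intro integrable_mult_right integrable_real_indicator) (auto simp: less_top[symmetric])
        show "q (g - h) \<le> c * indicator (space \<nu> - exhaustion n) g" if "g \<in> space \<nu>" for g
          using none q(3) that by (cases "g \<in> exhaustion n") auto
      qed
      also have "\<dots> = c * measure \<nu> (space \<nu> - exhaustion n)" by simp
      also have "measure \<nu> (space \<nu> - exhaustion n) = measure \<nu> (space \<nu>) - measure \<nu> (exhaustion n)"
        by (rule finite_measure_compl) measurable
      finally show False using n h by simp
    qed
    then obtain g where g: "g \<in> exhaustion n" "q (g - h) \<noteq> 0" by blast
    have "- (g - h) \<in> uminus ` L" using L(2)[OF g(2)] by blast
    moreover have "h = - (g - h) + g" by simp
    moreover have "g \<in> closure (exhaustion n)" using g(1) closure_subset by blast
    ultimately show "h \<in> ?K" by blast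
  qed
  have "closed ?S"
    by (intro closed_Collect_le continuous_on_const average_continuous[OF \<nu> q])
  with K have "compact (?K \<inter> ?S)" by (rule compact_Int_closed)
  also have "?K \<inter> ?S = ?S" using sub by (rule Int_absorb1)
  finally show ?thesis .
qed

text \<open>\<open>q g\<close> is the Haar measure of \<open>V \<inter> (g + V)\<close>, that is,
  the convolution of the indicators of \<open>V\<close> and \<open>- V\<close>. Continuity is then
  \<open>continuous_haar_translate\<close>, and \<open>q\<close> vanishes outside the differences of
  elements of \<open>closure V\<close>.\<close>

lemma ex_bump:
  obtains q :: "'g \<Rightarrow> real" and c L where "continuous_on UNIV q" "\<And>g. 0 \<le> q g" "\<And>g. q g \<le> c"
    "compact L" "\<And>g. q g \<noteq> 0 \<Longrightarrow> g \<in> L" "0 < q 0"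
proof -
  obtain n where n: "(0::'g) \<in> cbase n" using cbase_basis[of UNIV 0] by auto
  define V where "V = cbase n"
  have V: "open V" "0 \<in> V" "emeasure haar V < \<infinity>" using n haar_closure_compact_finite[of V] by (auto simp: V_def)
  define q where "q g = measure haar {t. - g + t \<in> V \<and> t \<in> V}" for g
  have "continuous_on UNIV (\<lambda>h. measure haar {t. h + t \<in> V \<and> t \<in> V})"
    using V by (intro continuous_haar_translate) auto
  then have 1: "continuous_on UNIV q"
    unfolding q_def by (rule continuous_on_compose2) (auto intro!: continuous_intros)
  have 2: "q g \<le> measure haar V" for g
  proof -
    have "open ({t. - g + t \<in> V} \<inter> V)" using V by (intro open_Int open_group_translate)
    then have "open {t. - g + t \<in> V \<and> t \<in> V}" by (simp add: Int_def)
    then show ?thesis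
      unfolding q_def using V by (intro measure_mono_fmeasurable) (auto simp: fmeasurable_def)
  qed
  let ?L = "{h + k | h k. h \<in> closure V \<and> k \<in> uminus ` closure V}"
  have 3: "compact ?L" by (intro compact_group_sum compact_group_minus) (simp_all add: V_def)
  have 4: "g \<in> ?L" if g: "q g \<noteq> 0" for g
  proof -
    have "{t. - g + t \<in> V \<and> t \<in> V} \<noteq> {}" using g unfolding q_def by (metis measure_empty)
    then obtain t where t: "- g + t \<in> V" "t \<in> V" by blast
    have "g = t + - (- g + t)" by (simp add: minus_add add.assoc[symmetric])
    then show ?thesis using t closure_subset[of V] by blast
  qed
  have 5: "0 < q 0"
  proof -
    have "q 0 = measure haar V" by (simp add: q_def)
    then show ?thesis using V haar_nonempty_open_pos[OF V(1,2)]
      by (simp add: measure_def enn2real_positive_iff)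
  qed
  show ?thesis by (rule that[OF 1 _ 2 3 4 5]) (simp add: q_def)
qed

end

context nonsingular_G
begin

lemma dissipative_transversal:
  assumes "totally_dissipative haar M act"
  shows "\<exists>X1 W s. transversal_G haar M act X1 W s"
proof -
  interpret S: sigma_finite_measure M by (rule sigma_finite_M)
  obtain D Con Dis where D: "rn_cocycle M act D" and hopf: "hopf_decomposition haar M act D Con Dis"
    and Con0: "emeasure M Con = 0"
    using assms unfolding totally_dissipative_def by blast
  have Dm: "(\<lambda>(g, x). D g x) \<in> borel_measurable (borel \<Otimes>\<^sub>M M)"
    and D_pos: "\<And>g x. x \<in> space M \<Longrightarrow> 0 < D g x"
    and D_add: "\<And>g h x. x \<in> space M \<Longrightarrow> D (g + h) x = D g (act h x) * D h x"
    using D by (auto simp: rn_cocycle_def)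
  have [measurable (raw)]: "(\<lambda>z. D (a z) (b z)) \<in> borel_measurable N"
    if "a \<in> borel_measurable N" "b \<in> measurable N M" for a b and N :: "'z measure"
    using measurable_compose[OF measurable_Pair[OF that] Dm] by simp
  obtain h0 where h0[measurable]: "h0 \<in> borel_measurable M" and h0_int: "integral\<^sup>N M h0 \<noteq> \<infinity>"
    and h0_pos: "\<And>x. x \<in> space M \<Longrightarrow> 0 < h0 x \<and> h0 x < \<infinity>" using S.Ex_finite_integrable_function by blast
  define f where "f x = enn2real (h0 x)" for x
  have [measurable]: "f \<in> borel_measurable M" unfolding f_def by measurable
  have f_pos: "0 < f x" if "x \<in> space M" for x using h0_pos[OF that] by (simp add: f_def enn2real_positive_iff)
  have f: "f \<in> L1_plus M"
  proof -
    have "(\<integral>\<^sup>+x. ennreal (norm (f x)) \<partial>M) = (\<integral>\<^sup>+x. h0 x \<partial>M)"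
      using h0_pos by (intro nn_integral_cong) (simp add: f_def)
    then have "integrable M f" using h0_int by (intro integrableI_bounded) (auto simp: less_top)
    then show ?thesis using f_pos by (simp add: L1_plus_def)
  qed
  define p where "p x g = ennreal (D g x * f (act g x))" for x g
  have pm[measurable (raw)]: "(\<lambda>z. p (b z) (a z)) \<in> borel_measurable N"
    if [measurable]: "a \<in> borel_measurable N" "b \<in> measurable N M" for a b and N :: "'z measure"
    unfolding p_def by measurable
  have p_pos: "0 < p x g" if "x \<in> space M" for x g using D_pos f_pos that by (simp add: p_def)
  \<comment> \<open>The cocycle identity in the form needed for averages: moving the base point to
    \<open>act h x\<close> right-translates the density up to the factor \<open>D h x\<close>, which
    does not involve \<open>g\<close>.\<close>
  have p_add: "p x (g + h) = ennreal (D h x) * p (act h x) g" if x: "x \<in> space M" for x g h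
    using D_pos[OF x, of h] D_pos[OF act_space[OF x], of g h] f_pos[OF act_space[OF x], of "g + h"] x
    by (simp add: p_def D_add act_add ennreal_mult'[symmetric] mult_ac)
  define I where "I k x = (\<integral>\<^sup>+g. p x g * k g \<partial>haar)" for k x
  have I_act: "ennreal (D h x) * I k (act h x) = c * I (\<lambda>g. k (g - h)) x"
    if c: "\<And>f. f \<in> borel_measurable borel \<Longrightarrow> (\<integral>\<^sup>+g. f (g + h) \<partial>haar) = c * (\<integral>\<^sup>+g. f g \<partial>haar)"
      and x: "x \<in> space M" and [measurable]: "k \<in> borel_measurable borel" for c h k x
  proof -
    have [measurable]: "p y \<in> borel_measurable borel" if "y \<in> space M" for y using that by measurable
    have km: "(\<lambda>g. k (g - h)) \<in> borel_measurable borel" by measurable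
    have "ennreal (D h x) * I k (act h x) = (\<integral>\<^sup>+g. ennreal (D h x) * (p (act h x) g * k g) \<partial>haar)"
      unfolding I_def using x by (intro nn_integral_cmult[symmetric]) measurable
    also have "\<dots> = (\<integral>\<^sup>+g. p x (g + h) * k (g + h - h) \<partial>haar)"
      using p_add[OF x] by (simp add: mult.assoc)
    also have "\<dots> = c * (\<integral>\<^sup>+g. p x g * k (g - h) \<partial>haar)"
      using x km by (intro c[of "\<lambda>g. p x g * k (g - h)"] borel_measurable_times_ennreal) measurable
    finally show ?thesis unfolding I_def .
  qed
  define H where "H = I (\<lambda>_. 1)"
  have H_eq: "H x = hopf_sum haar act D f x" for x by (simp add: H_def I_def p_def hopf_sum_def)
  have Im[measurable]: "I k \<in> borel_measurable M" if [measurable]: "k \<in> borel_measurable borel" for k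
    unfolding I_def by measurable
  have Hm[measurable]: "H \<in> borel_measurable M" unfolding H_def by measurable
  define X1 where "X1 = {x \<in> space M. H x < \<infinity>}"
  have X1m: "X1 \<in> sets M" unfolding X1_def by measurable
  have X1s: "x \<in> space M" if "x \<in> X1" for x using that by (simp add: X1_def)
  \<comment> \<open>The two constants depend on \<open>h\<close> and \<open>x\<close> but not on
    \<open>k\<close>, so they cancel in a quotient of two such integrals at the same point; for
    \<open>k = 1\<close> the identity shows that \<open>X1\<close> is invariant.\<close>
  have scale: "\<exists>c d. 0 < d \<and> c \<noteq> 0 \<and> c \<noteq> \<infinity> \<and> (\<forall>k\<in>borel_measurable borel. ennreal d * I k (act h x) = c * I (\<lambda>g. k (g - h)) x)"
    if x: "x \<in> space M" for h x
  proof -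
    obtain c where c: "c \<noteq> 0" "c \<noteq> \<infinity>" "\<And>f. f \<in> borel_measurable borel \<Longrightarrow> (\<integral>\<^sup>+g. f (g + h) \<partial>haar) = c * (\<integral>\<^sup>+g. f g \<partial>haar)"
      using haar_right_scaling by blast
    show ?thesis using I_act[OF c(3) x] c(1,2) D_pos[OF x, of h] by blast
  qed
  have X1_inv: "invariant_set act X1"
    unfolding invariant_set_def
  proof (intro allI ballI)
    fix h x assume x: "x \<in> X1"
    obtain c d where cd: "0 < d" "c \<noteq> 0" "c \<noteq> \<infinity>" "ennreal d * H (act h x) = c * H x"
      using scale[OF X1s[OF x], of h] unfolding H_def by fastforce
    have "c * H x < \<infinity>" using cd(3) x by (simp add: X1_def ennreal_mult_less_top less_top)
    then have "ennreal d * H (act h x) \<noteq> \<infinity>" using cd(4) by simp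
    then have "H (act h x) < \<infinity>" using cd(1) by (auto simp: ennreal_mult_eq_top_iff less_top[symmetric])
    then show "act h x \<in> X1" using X1s[OF x] by (simp add: X1_def)
  qed
  have "AE x in M. x \<in> X1"
  proof -
    have Con: "Con \<in> sets M" "Con \<union> Dis = space M" and Dis: "AE x in M. x \<in> Dis \<longleftrightarrow> H x < \<infinity>"
      using hopf f unfolding hopf_decomposition_def H_eq by auto
    have "AE x in M. x \<notin> Con" using Con(1) Con0 by (intro AE_not_in) auto
    then show ?thesis using Dis AE_space by eventually_elim (use Con(2) in \<open>auto simp: X1_def\<close>)
  qed
  then have "space M - X1 \<in> null_sets M"
    using X1m by (subst AE_iff_null_sets) (auto elim: eventually_mono)
  then have conull: "invariant_conull_borel M act X1"
    using X1m X1_inv by (simp add: invariant_conull_borel_def)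

  obtain q :: "'g \<Rightarrow> real" and c L where q: "continuous_on UNIV q" "\<And>g. 0 \<le> q g" "\<And>g. q g \<le> c"
    and L: "compact L" "\<And>g. q g \<noteq> 0 \<Longrightarrow> g \<in> L" and q0: "0 < q 0" by (rule ex_bump) blast
  have qm[measurable]: "q \<in> borel_measurable borel" by (rule borel_measurable_continuous_onI[OF q(1)])
  \<comment> \<open>Dividing by \<open>H\<close> normalises the density; the minus sign turns the
    sets where the average is large, compact by \<open>average_proper\<close>, into sublevel
    sets.\<close>
  define F where "F x = - enn2real (I (\<lambda>g. ennreal (q g)) x / H x)" for x
  have Fm: "F \<in> borel_measurable M" unfolding F_def by measurable
  define N where "N x = density haar (p x)" for x
  have N: "finite_measure (N x)" "sets (N x) = sets borel" if x: "x \<in> X1" for x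
  proof -
    have [measurable]: "p x \<in> borel_measurable borel" using X1s[OF x] by measurable
    have "emeasure (N x) UNIV = H x" by (simp add: N_def emeasure_density H_def I_def)
    then show "finite_measure (N x)" using x by (intro finite_measureI) (auto simp: N_def X1_def)
    show "sets (N x) = sets borel" by (simp add: N_def)
  qed
  define E where "E x h = (\<integral>g. q (g - h) \<partial>(N x))" for x h
  have H_pos: "0 < H x" if "x \<in> space M" for x
  proof (rule ccontr)
    assume "\<not> 0 < H x"
    then have "H x = 0" by simp
    have [measurable]: "p x \<in> borel_measurable borel" using that by measurable
    have "AE g in haar. p x g = 0" using \<open>H x = 0\<close> by (simp add: H_def I_def nn_integral_0_iff_AE)
    then have "AE g in haar. g \<notin> UNIV"
    proof eventually_elim
      case (elim g)
      then show ?case using p_pos[OF that, of g] by simp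
    qed
    then have "UNIV \<in> null_sets haar" by (subst AE_iff_null_sets) auto
    then show False using left_haar by (auto simp: left_haar_measure_def)
  qed
  have F_act: "F (act h x) = - (E x h / enn2real (H x))" if x: "x \<in> X1" for x h
  proof -
    have xs: "x \<in> space M" by (rule X1s[OF x])
    have [measurable]: "p x \<in> borel_measurable borel" using xs by measurable
    have km[measurable]: "(\<lambda>g. q (g - h)) \<in> borel_measurable borel" by measurable
    obtain c' d where cd: "0 < d" "c' \<noteq> 0" "c' \<noteq> \<infinity>"
      "\<And>k. k \<in> borel_measurable borel \<Longrightarrow> ennreal d * I k (act h x) = c' * I (\<lambda>g. k (g - h)) x"
      using scale[OF xs, of h] by blast
    have J: "I (\<lambda>g. ennreal (q (g - h))) x = ennreal (E x h)"
    proof -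
      have "I (\<lambda>g. ennreal (q (g - h))) x = (\<integral>\<^sup>+g. ennreal (q (g - h)) \<partial>(N x))"
        unfolding I_def N_def by (subst nn_integral_density) auto
      also have "\<dots> = ennreal (E x h)"
        unfolding E_def by (rule nn_integral_eq_integral[OF average_integrable[OF N[OF x] q]]) (use q in auto)
      finally show ?thesis .
    qed
    have 1: "ennreal d * I (\<lambda>g. ennreal (q g)) (act h x) = c' * ennreal (E x h)"
      using cd(4)[of "\<lambda>g. ennreal (q g)"] J by simp
    have 2: "ennreal d * H (act h x) = c' * H x" using cd(4)[of "\<lambda>_. 1"] by (simp add: H_def)
    have Hx: "0 < H x" "H x < \<infinity>" using H_pos[OF xs] x by (auto simp: X1_def)
    have "I (\<lambda>g. ennreal (q g)) (act h x) / H (act h x) = (ennreal d * I (\<lambda>g. ennreal (q g)) (act h x)) / (ennreal d * H (act h x))"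
      using cd(1) by (intro ennreal_mult_divide_mult_cancel_left[symmetric]) auto
    also have "\<dots> = ennreal (E x h) / H x"
      unfolding 1 2 using cd(2,3) by (rule ennreal_mult_divide_mult_cancel_left)
    finally have 3: "I (\<lambda>g. ennreal (q g)) (act h x) / H (act h x) = ennreal (E x h) / H x" .
    have "0 \<le> E x h" unfolding E_def using q(2) by simp
    moreover obtain r where r: "H x = ennreal r" "0 < r" using Hx by (cases "H x") auto
    ultimately have "enn2real (ennreal (E x h) / H x) = E x h / enn2real (H x)"
      by (simp add: divide_ennreal)
    then show ?thesis unfolding F_def 3 by simp
  qed
  have cont: "continuous_on UNIV (\<lambda>g. F (act g x))" if x: "x \<in> X1" for x
    unfolding F_act[OF x] E_def
    using H_pos[OF X1s[OF x]] x
    by (intro continuous_intros average_continuous[OF N[OF x] q]) (auto simp: enn2real_eq_0_iff X1_def)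
  have cpt: "compact {g. F (act g x) \<le> F x}" if x: "x \<in> X1" for x
  proof -
    have xs: "x \<in> space M" by (rule X1s[OF x])
    have [measurable]: "p x \<in> borel_measurable borel" using xs by measurable
    have "0 \<le> E x 0" unfolding E_def using q(2) by simp
    \<comment> \<open>\<open>average_proper\<close> needs a positive level: \<open>p x\<close> is
      positive everywhere and \<open>q\<close> is positive on a neighbourhood of 0, so the average
      at \<open>h = 0\<close> does not vanish.\<close>
    moreover have "E x 0 \<noteq> 0"
    proof
      assume "E x 0 = 0"
      have int: "integrable (N x) q" using average_integrable[OF N[OF x] q, of 0] by simp
      have "AE g in N x. q g = 0"
        using \<open>E x 0 = 0\<close> q(2) by (subst (asm) E_def) (simp add: integral_nonneg_eq_0_iff_AE[OF int])
      then have "AE g in haar. q g = 0"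
        unfolding N_def using p_pos[OF xs] by (subst (asm) AE_density) auto
      then have "AE g in haar. g \<notin> {g. 0 < q g}" by eventually_elim simp
      moreover have op: "open {g. 0 < q g}" by (intro open_Collect_less continuous_on_const q)
      ultimately have "{g. 0 < q g} \<in> null_sets haar" by (subst AE_iff_null_sets) auto
      then show False using haar_nonempty_open_pos[OF op, of 0] q0 by auto
    qed
    ultimately have "0 < E x 0" by simp
    then have "compact {g. E x 0 \<le> E x g}"
      unfolding E_def[of x] by (intro average_proper[OF N[OF x] q L])
    moreover have "F (act g x) \<le> F x \<longleftrightarrow> E x 0 \<le> E x g" for g
    proof -
      have "0 < enn2real (H x)" using H_pos[OF xs] x by (simp add: enn2real_positive_iff X1_def)
      moreover have "F x = F (act 0 x)" using xs by simp
      ultimately show ?thesis unfolding F_act[OF x] by (simp add: divide_le_cancel F_act[OF x])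
    qed
    ultimately show ?thesis by simp
  qed
  have stab: "compact (stabilizer act x)" if x: "x \<in> X1" for x
  proof -
    have "closed (stabilizer act x)" unfolding stabilizer_def using X1s[OF x] by (intro closed_act_eq)
    moreover have "stabilizer act x \<subseteq> {g. F (act g x) \<le> F x}" by (auto simp: stabilizer_def)
    ultimately show ?thesis using compact_Int_closed[OF cpt[OF x], of "stabilizer act x"] by (simp add: inf.absorb2)
  qed
  obtain W s where "borel_transversal M act X1 W" "borel_selector M act X1 W s"
    using ex_transversal[OF X1m X1_inv Fm cont cpt] by blast
  then show ?thesis using conull stab
    by (intro exI transversal_G.intro transversal_G_axioms.intro nonsingular_G_axioms) auto
qed

end

subsection \<open>The isomorphism with the Krengel space\<close>

lemma (in sigma_finite_measure) pred_AE_Pair: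
  assumes P: "Measurable.pred (N \<Otimes>\<^sub>M M) P"
  shows "Measurable.pred N (\<lambda>x. AE y in M. P (x, y))"
proof -
  let ?A = "{z \<in> space (N \<Otimes>\<^sub>M M). \<not> P z}"
  have A: "?A \<in> sets (N \<Otimes>\<^sub>M M)" using P by measurable
  have "(AE y in M. P (x, y)) \<longleftrightarrow> emeasure M (Pair x -` ?A) = 0" if "x \<in> space N" for x
    by (rule AE_iff_measurable[OF sets_Pair1[OF A]]) (use that in \<open>auto simp: space_pair_measure\<close>)
  then have "{x \<in> space N. AE y in M. P (x, y)} = {x \<in> space N. emeasure M (Pair x -` ?A) = 0}" by auto
  also have "\<dots> \<in> sets N" using measurable_emeasure_Pair[OF A] by measurable
  finally show ?thesis by (simp add: pred_def)
qed

section \<open>Cosets of stabilizers and the invariant measure on them\<close>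

context transversal_G
begin

text \<open>For \<open>w \<in> W\<close> this is the left coset of \<open>g\<close> modulo the
  stabilizer; written as a transporter, its Borel dependence on \<open>w\<close> and
  \<open>g\<close> is a case of \<open>transporter_measurable\<close>.\<close>

definition coset :: "'x \<Rightarrow> 'g \<Rightarrow> 'g set" where
  "coset w g = {h. act h w = act g w}"

lemma coset_eq: "w \<in> W \<Longrightarrow> coset w g = left_translate g (stabilizer act w)"
  unfolding coset_def by (rule left_translate_stabilizer[symmetric]) (intro X1_space W_X1)

lemma coset_self: "g \<in> coset w g" by (simp add: coset_def)

lemma closed_coset: "w \<in> W \<Longrightarrow> closed (coset w g)"
  unfolding coset_def by (intro closed_act_eq act_space X1_space W_X1)

lemma left_translate_coset:
  assumes "w \<in> W"
  shows "left_translate k (coset w g) = coset w (k + g)"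
  unfolding coset_eq[OF assms] by (auto simp: left_translate_def image_image add.assoc)

lemma left_translate_measurable: "left_translate k \<in> measurable (effros :: 'g set measure) effros"
proof (rule measurable_effrosI)
  have eq: "left_translate k F = {h. - k + h \<in> F}" for F :: "'g set"
  proof (intro set_eqI iffI)
    fix h assume "h \<in> {h. - k + h \<in> F}"
    then show "h \<in> left_translate k F" unfolding left_translate_def
      by (intro image_eqI[of _ _ "- k + h"]) (simp_all add: add.assoc[symmetric])
  qed (auto simp: left_translate_def add.assoc[symmetric])
  show "closed (left_translate k F)" if "F \<in> space effros" for F :: "'g set"
  proof -
    have "closed ((\<lambda>h. - k + h) -` F)"
      using that by (intro closed_vimage continuous_intros) (simp add: space_effros)
    then show ?thesis by (simp add: eq vimage_def)
  qed
  fix U :: "'g set" assume U: "open U"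
  have "left_translate k F \<inter> U \<noteq> {} \<longleftrightarrow> F \<inter> {h. k + h \<in> U} \<noteq> {}" for F
    by (auto simp: left_translate_def)
  then have "{F \<in> space effros. left_translate k F \<inter> U \<noteq> {}} = {F. closed F \<and> F \<inter> {h. k + h \<in> U} \<noteq> {}}"
    by (auto simp: space_effros)
  also have "\<dots> \<in> sets effros" by (intro sets_effros_hit_open open_group_translate U)
  finally show "{F \<in> space effros. left_translate k F \<inter> U \<noteq> {}} \<in> sets effros" .
qed

lemma coset_measurable:
  assumes "w \<in> W"
  shows "coset w \<in> measurable borel effros"
proof -
  have [simp]: "w \<in> space M" by (intro X1_space W_X1 assms)
  have "(\<lambda>g. {h. act h w = act g w}) \<in> measurable borel effros"
    by (rule transporter_measurable) measurable
  then show ?thesis unfolding coset_def[abs_def] .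
qed

lemma sets_left_cosets:
  assumes w: "w \<in> W"
  shows "left_cosets (stabilizer act w) \<in> sets effros"
proof -
  let ?R = "restrict_space M W"
  have "krengel_set ?R (stabilizer act) \<in> sets (?R \<Otimes>\<^sub>M (effros :: 'g set measure))"
    by (rule krengel_set_measurable[OF W_sets refl])
  then have "Pair w -` krengel_set ?R (stabilizer act) \<in> sets (effros :: 'g set measure)"
    by (rule sets_Pair1)
  also have "Pair w -` krengel_set ?R (stabilizer act) = left_cosets (stabilizer act w)"
    using w X1_space[OF W_X1[OF w]] by (auto simp: krengel_set_def left_cosets_def space_restrict_space)
  finally show ?thesis .
qed

text \<open>The image of \<open>haar\<close> is invariant since \<open>coset w\<close> intertwines
  left translations. Sigma-finiteness rests on compact stabilizers: the cosets that meet
  \<open>exhaustion n\<close> pull back into \<open>thickened_stabilizer n w\<close>, which has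
  finite measure.\<close>

lemma invariant_coset_measure_haar:
  assumes w: "w \<in> W"
  shows "invariant_coset_measure (stabilizer act w) (distr haar effros (coset w))"
  unfolding invariant_coset_measure_def
proof (intro conjI allI)
  let ?m = "distr haar effros (coset w)"
  have cm[measurable]: "coset w \<in> measurable haar effros"
    using coset_measurable[OF w] by (simp add: measurable_cong_sets[OF sets_haar refl])
  show "sets ?m = sets effros" by simp
  have "(AE F in ?m. F \<in> left_cosets (stabilizer act w)) \<longleftrightarrow> (AE g in haar. coset w g \<in> left_cosets (stabilizer act w))"
    using sets_left_cosets[OF w] by (intro AE_distr_iff) auto
  then show "AE F in ?m. F \<in> left_cosets (stabilizer act w)"
    using coset_eq[OF w] by (simp add: left_cosets_def)
  show "emeasure ?m (space ?m) \<noteq> 0"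
    using left_haar measurable_space[OF cm] by (simp add: emeasure_distr vimage_def left_haar_measure_def)
  show "distr ?m effros (left_translate k) = ?m" for k
  proof -
    have "distr ?m effros (left_translate k) = distr haar effros (\<lambda>g. coset w (k + g))"
      by (subst distr_distr[OF left_translate_measurable cm]) (simp add: comp_def left_translate_coset[OF w])
    also have "\<dots> = distr (distr haar borel (\<lambda>g. k + g)) effros (coset w)"
      by (subst distr_distr[OF coset_measurable[OF w]]) (auto simp: comp_def)
    also have "distr haar borel (\<lambda>g. k + g) = haar" using left_haar by (simp add: left_haar_measure_def)
    finally show ?thesis .
  qed
  let ?B = "\<lambda>n. {F :: 'g set. closed F \<and> F \<inter> exhaustion n \<noteq> {}}"
  \<comment> \<open>\<open>?Z\<close> contains only the empty set, the one closed set that misses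
    every \<open>exhaustion n\<close>; it has measure 0 because cosets are nonempty.\<close>
  let ?Z = "space effros - {F :: 'g set. closed F \<and> F \<inter> UNIV \<noteq> {}}"
  have B: "?B n \<in> sets effros" for n by (rule sets_effros_hit_open) simp
  have Z: "?Z \<in> sets effros" by (intro sets.Diff sets.top sets_effros_hit_open) simp
  show "sigma_finite_measure ?m"
  proof
    show "\<exists>A. countable A \<and> A \<subseteq> sets ?m \<and> \<Union>A = space ?m \<and> (\<forall>a\<in>A. emeasure ?m a \<noteq> \<infinity>)"
    proof (intro exI[of _ "insert ?Z (range ?B)"] conjI ballI)
      show "\<Union>(insert ?Z (range ?B)) = space ?m"
        using exhaustion_cover by (auto simp: space_effros)
      fix A assume "A \<in> insert ?Z (range ?B)"
      then consider "A = ?Z" | n where "A = ?B n" by blast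
      then show "emeasure ?m A \<noteq> \<infinity>"
      proof cases
        case 1
        have "coset w -` ?Z \<inter> space haar = {}" using coset_self closed_coset[OF w] by fastforce
        then show ?thesis unfolding 1 using Z by (simp add: emeasure_distr[OF cm])
      next
        case 2
        let ?K = "thickened_stabilizer n w"
        have "coset w -` ?B n \<inter> space haar \<subseteq> {g. \<exists>h\<in>exhaustion n. act h w = act g w}"
          by (auto simp: coset_def)
        then have "coset w -` ?B n \<inter> space haar \<subseteq> ?K" using transporter_stabilizer(2)[OF w] by (rule order_trans)
        then have "emeasure haar (coset w -` ?B n \<inter> space haar) \<le> emeasure haar ?K"
          using transporter_stabilizer(1)[OF w, of n] by (intro emeasure_mono) (auto simp: compact_imp_closed)
        also have "\<dots> < \<infinity>" by (rule haar_compact_finite[OF transporter_stabilizer(1)[OF w]])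
        finally show ?thesis unfolding 2 by (simp add: emeasure_distr[OF cm B])
      qed
    qed (use B Z in auto)
  qed
qed

end

section \<open>The random compact subgroup and the isomorphism\<close>

locale transversal_prob_G = transversal_G haar M act X1 W s
  for haar :: "'g::{topological_group_add, t2_space, second_countable_topology} measure"
    and M :: "'x measure" and act :: "'g \<Rightarrow> 'x \<Rightarrow> 'x" and X1 W :: "'x set" and s :: "'x \<Rightarrow> 'x" +
  fixes M' :: "'x measure"
  assumes prob_M': "prob_space M'" and equiv_M': "measure_equiv M' M"
begin

definition \<nu> :: "'x measure" where
  "\<nu> = distr (restrict_space M' X1) (restrict_space M W) s"

lemma sets_M': "sets M' = sets M"
  using equiv_M' by (simp add: measure_equiv_def)

lemma sets_\<nu>: "sets \<nu> = sets (restrict_space M W)" by (simp add: \<nu>_def)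

lemma W_space: "w \<in> W \<Longrightarrow> w \<in> space M"
  by (intro X1_space W_X1)

lemma space_\<nu>: "space \<nu> = W"
  using W_space by (auto simp: \<nu>_def space_restrict_space)

lemma selector_measurable': "s \<in> measurable (restrict_space M' X1) (restrict_space M W)"
proof -
  have "s \<in> measurable (restrict_space M X1) (restrict_space M W)"
    using selector by (simp add: borel_selector_def)
  then show ?thesis
    using measurable_cong_sets[OF sets_restrict_space_cong[OF sets_M'] refl] by blast
qed

lemma prob_\<nu>: "prob_space \<nu>"
proof -
  interpret M': prob_space M' by (rule prob_M')
  have "AE x in M'. x \<in> X1" using AE_X1 by (simp add: measure_equiv_AE[OF equiv_M'])
  then have "emeasure M' X1 = 1"
    using X1_sets M'.AE_in_set_eq_1[of X1] sets_M' by (simp add: M'.emeasure_eq_measure)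
  then have "prob_space (restrict_space M' X1)"
    using X1_sets sets_M' sets.sets_into_space[OF X1_sets] sets_eq_imp_space_eq[OF sets_M']
    by (intro prob_spaceI) (simp add: emeasure_restrict_space space_restrict_space inf_absorb1)
  then show ?thesis unfolding \<nu>_def by (rule prob_space.prob_space_distr[OF _ selector_measurable'])
qed

lemma AE_\<nu>:
  assumes "{w \<in> W. P w} \<in> sets \<nu>"
  shows "(AE w in \<nu>. P w) \<longleftrightarrow> (AE x in M. x \<in> X1 \<longrightarrow> P (s x))"
proof -
  have "X1 \<inter> space M' \<in> sets M'" using X1_sets sets_M' by auto
  note restr = AE_restrict_space_iff[OF this]
  have "(AE w in \<nu>. P w) \<longleftrightarrow> (AE x in restrict_space M' X1. P (s x))"
    unfolding \<nu>_def
  proof (rule AE_distr_iff[OF selector_measurable'])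
    show "{w \<in> space (restrict_space M W). P w} \<in> sets (restrict_space M W)"
      using assms space_\<nu> by (simp add: sets_\<nu> \<nu>_def)
  qed
  also have "\<dots> \<longleftrightarrow> (AE x in M. x \<in> X1 \<longrightarrow> P (s x))" by (simp add: restr measure_equiv_AE[OF equiv_M'])
  finally show ?thesis .
qed

lemma ident_measurable: "(\<lambda>w. w) \<in> measurable \<nu> M"
  unfolding measurable_cong_sets[OF sets_\<nu> refl] by (rule measurable_restrict_space1) simp

lemma coset_pair_measurable: "(\<lambda>(w, g). coset w g) \<in> measurable (\<nu> \<Otimes>\<^sub>M borel) effros"
proof -
  note ident_measurable[measurable]
  have fst_m[measurable]: "fst \<in> measurable (\<nu> \<Otimes>\<^sub>M borel) M"
    using measurable_compose[OF measurable_fst ident_measurable] by simp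
  have "(\<lambda>z. {h. act h (fst z) = act (snd z) (fst z)}) \<in> measurable (\<nu> \<Otimes>\<^sub>M borel) effros"
    by (rule transporter_measurable) measurable
  then show ?thesis by (simp add: coset_def[abs_def] case_prod_beta')
qed

lemma random_compact_subgroup_stabilizer: "random_compact_subgroup \<nu> (stabilizer act)"
  unfolding random_compact_subgroup_def
proof (intro conjI)
  show "prob_space \<nu>" by (rule prob_\<nu>)
  have "standard_borel M" using borel_action by (simp add: borel_G_space_def)
  from standard_borel_restrict_space[OF this W_sets] show "standard_borel \<nu>"
    unfolding standard_borel_def using sets_\<nu> sets_eq_imp_space_eq[OF sets_\<nu>] by simp
  have "(\<lambda>w. {g. act g w = w}) \<in> measurable \<nu> effros"
    by (rule transporter_measurable) (rule ident_measurable)+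
  then have "stabilizer act \<in> measurable \<nu> effros" unfolding stabilizer_def[abs_def] .
  moreover have "stabilizer act w \<in> compact_subgroups" if "w \<in> space \<nu>" for w
    using that compact_stabilizer[OF W_X1] stabilizer_subgroup[OF W_space] by (simp add: compact_subgroups_def space_\<nu>)
  ultimately show "stabilizer act \<in> measurable \<nu> (restrict_space effros compact_subgroups)"
    by (intro measurable_restrict_space2) auto
qed

lemma isomorphic_to_krengel: "isomorphic_to_krengel_space M act \<nu> (stabilizer act)"
proof -
  let ?E = "effros :: 'g set measure"
  let ?Y = "krengel_set \<nu> (stabilizer act)"
  interpret \<nu>: prob_space \<nu> by (rule prob_\<nu>)
  \<comment> \<open>\<open>haar\<close> may be infinite while the kernel consists of probability
    measures, so an equivalent probability measure is pushed to the cosets in its place.\<close>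
  obtain \<eta> where \<eta>: "prob_space \<eta>" "measure_equiv \<eta> haar"
    using ex_equivalent_prob_space left_haar by (auto simp: left_haar_measure_def)
  have sets_\<eta>: "sets \<eta> = sets borel" using \<eta>(2) by (simp add: measure_equiv_def)
  interpret \<eta>: prob_space \<eta> by (rule \<eta>(1))
  define \<kappa> where "\<kappa> w = distr \<eta> ?E (coset w)" for w
  have coset_\<eta>: "coset w \<in> measurable \<eta> ?E" if "w \<in> W" for w
    using coset_measurable[OF that] measurable_cong_sets[OF sets_\<eta> refl] by blast
  have \<kappa>_prob: "\<kappa> \<in> measurable \<nu> (prob_algebra ?E)"
    unfolding \<kappa>_def
  proof (rule measurable_distr_prob_space2)
    show "(\<lambda>w. \<eta>) \<in> measurable \<nu> (prob_algebra borel)"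
      using \<eta>(1) sets_\<eta> by (intro measurable_const) (simp add: space_prob_algebra)
    show "(\<lambda>(w, g). coset w g) \<in> measurable (\<nu> \<Otimes>\<^sub>M borel) ?E" by (rule coset_pair_measurable)
  qed
  have \<kappa>_equiv: "measure_equiv (\<kappa> w) (distr haar ?E (coset w))" if "w \<in> W" for w
    unfolding \<kappa>_def by (rule measure_equiv_distr[OF \<eta>(2) coset_\<eta>[OF that]])
  have kernel: "krengel_kernel \<nu> (stabilizer act) \<kappa>"
    unfolding krengel_kernel_def using \<kappa>_prob \<kappa>_equiv invariant_coset_measure_haar by (auto simp: space_\<nu>)

  define B where "B = Giry_Monad.bind \<nu> (\<lambda>w. return \<nu> w \<Otimes>\<^sub>M \<kappa> w)"
  define K where "K = krengel_measure \<nu> (stabilizer act) \<kappa>"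
  have K: "K = restrict_space B ?Y" by (simp add: K_def B_def krengel_measure_def)
  have pair_sub: "(\<lambda>w. return \<nu> w \<Otimes>\<^sub>M \<kappa> w) \<in> measurable \<nu> (subprob_algebra (\<nu> \<Otimes>\<^sub>M ?E))"
    by (intro measurable_pair_measure return_measurable measurable_prob_algebraD[OF \<kappa>_prob])
  have ne: "space \<nu> \<noteq> {}" by (rule \<nu>.not_empty)
  have sets_B: "sets B = sets (\<nu> \<Otimes>\<^sub>M ?E)"
    unfolding B_def by (rule sets_bind[OF sets_kernel[OF pair_sub] ne])
  have Y: "?Y \<in> sets B" unfolding sets_B by (rule krengel_set_measurable[OF W_sets sets_\<nu>])
  have Ysp: "?Y \<inter> space B = ?Y" using sets.sets_into_space[OF Y] by blast
  have space_K: "space K = ?Y" unfolding K space_restrict_space by (rule Ysp)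
  have Y_eq: "?Y = {(w, coset w g) | w g. w \<in> W}"
    unfolding krengel_set_def space_\<nu> using coset_eq by blast
  \<comment> \<open>The null sets of the Krengel measure are expressed through \<open>\<nu>\<close>
    and \<open>haar\<close>: the point mass fixes the first component to \<open>w\<close>, and
    \<open>\<kappa> w\<close> is replaced by the equivalent image of \<open>haar\<close>.\<close>
  have AE_B: "(AE z in B. P z) \<longleftrightarrow> (AE w in \<nu>. AE g in haar. P (w, coset w g))"
    if P: "Measurable.pred (\<nu> \<Otimes>\<^sub>M ?E) P" for P
  proof -
    have "(AE z in B. P z) \<longleftrightarrow> (AE w in \<nu>. AE z in return \<nu> w \<Otimes>\<^sub>M \<kappa> w. P z)"
      unfolding B_def by (rule AE_bind[OF pair_sub P])
    also have "\<dots> \<longleftrightarrow> (AE w in \<nu>. AE g in haar. P (w, coset w g))"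
    proof (rule AE_cong)
      fix w assume w: "w \<in> space \<nu>"
      then have wW: "w \<in> W" by (simp add: space_\<nu>)
      have s\<kappa>: "sets (\<kappa> w) = sets ?E" by (simp add: \<kappa>_def)
      interpret \<kappa>: prob_space "\<kappa> w" unfolding \<kappa>_def by (rule \<eta>.prob_space_distr[OF coset_\<eta>[OF wW]])
      interpret R: prob_space "return \<nu> w" by (rule prob_space_return[OF w])
      interpret pair_sigma_finite "return \<nu> w" "\<kappa> w" ..
      have sp: "sets (return \<nu> w \<Otimes>\<^sub>M \<kappa> w) = sets (\<nu> \<Otimes>\<^sub>M ?E)" by (intro sets_pair_measure_cong) (simp_all add: s\<kappa>)
      have P': "Measurable.pred (return \<nu> w \<Otimes>\<^sub>M \<kappa> w) P" using P measurable_cong_sets[OF sp refl] by blast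
      have P'': "{z \<in> space (return \<nu> w \<Otimes>\<^sub>M \<kappa> w). P (fst z, snd z)} \<in> sets (return \<nu> w \<Otimes>\<^sub>M \<kappa> w)"
        using P' by (simp add: pred_def)
      have "(AE z in return \<nu> w \<Otimes>\<^sub>M \<kappa> w. P z) \<longleftrightarrow> (AE v in return \<nu> w. AE F in \<kappa> w. P (v, F))"
        using AE_pair_iff[OF P''] by simp
      also have "\<dots> \<longleftrightarrow> (AE F in \<kappa> w. P (w, F))"
      proof (rule AE_return[OF w])
        have "Measurable.pred (\<nu> \<Otimes>\<^sub>M \<kappa> w) P" using P measurable_cong_sets[OF sets_pair_measure_cong[OF refl s\<kappa>] refl] by blast
        then show "Measurable.pred \<nu> (\<lambda>v. AE F in \<kappa> w. P (v, F))" by (rule \<kappa>.pred_AE_Pair)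
      qed
      also have "\<dots> \<longleftrightarrow> (AE F in distr haar ?E (coset w). P (w, F))"
        by (rule measure_equiv_AE[OF \<kappa>_equiv[OF wW]])
      also have "\<dots> \<longleftrightarrow> (AE g in haar. P (w, coset w g))"
      proof (rule AE_distr_iff)
        show "coset w \<in> measurable haar ?E"
          using coset_measurable[OF wW] measurable_cong_sets[OF sets_haar refl] by blast
        have "Pair w \<in> measurable ?E (\<nu> \<Otimes>\<^sub>M ?E)" by (rule measurable_Pair1'[OF w])
        from measurable_compose[OF this P] show "{F \<in> space ?E. P (w, F)} \<in> sets ?E" by (simp add: pred_def)
      qed
      finally show "(AE z in return \<nu> w \<Otimes>\<^sub>M \<kappa> w. P z) \<longleftrightarrow> (AE g in haar. P (w, coset w g))" .
    qed
    finally show ?thesis .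
  qed

  \<comment> \<open>The second component is the coset of any \<open>g\<close> with
    \<open>act g (s x) = x\<close>; taking the whole transporter avoids a measurable choice of such
    a \<open>g\<close>.\<close>
  define \<phi> where "\<phi> x = (s x, {g. act g (s x) = x})" for x
  let ?X = "restrict_space M X1"
  have spX: "space ?X = X1" using X1_space by (auto simp: space_restrict_space)
  have \<phi>_act: "\<phi> (act g w) = (w, coset w g)" if "w \<in> W" for g w
    using that by (simp add: \<phi>_def coset_def selector_act_W)
  have \<phi>_form: "\<exists>g. x = act g (s x) \<and> \<phi> x = (s x, coset (s x) g)" if x: "x \<in> X1" for x
  proof -
    obtain h where h: "s x = act h x" using selector_orbit[OF x] by (auto simp: orbit_def)
    then have "x = act (- h) (s x)" using X1_space[OF x] by simp
    then show ?thesis using \<phi>_act[OF selector_W[OF x], of "- h"] by metis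
  qed
  let ?K = "restrict_space K ?Y"
  have \<phi>_meas: "\<phi> \<in> measurable ?X ?K"
  proof -
    have sm: "s \<in> measurable ?X M" by (rule selector_measurable)
    have "s \<in> measurable ?X (restrict_space M W)" using selector by (simp add: borel_selector_def)
    then have "s \<in> measurable ?X \<nu>" using measurable_cong_sets[OF refl sets_\<nu>] by blast
    moreover have "(\<lambda>x. {g. act g (s x) = x}) \<in> measurable ?X ?E"
      by (intro transporter_measurable sm measurable_restrict_space1) simp
    ultimately have "\<phi> \<in> measurable ?X (\<nu> \<Otimes>\<^sub>M ?E)" unfolding \<phi>_def by (rule measurable_Pair)
    then have "\<phi> \<in> measurable ?X B" using measurable_cong_sets[OF refl sets_B] by blast
    moreover have "\<phi> x \<in> ?Y" if "x \<in> X1" for x using \<phi>_form[OF that] selector_W[OF that] unfolding Y_eq by auto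
    ultimately show ?thesis unfolding K by (intro measurable_restrict_space2) (auto simp: spX)
  qed
  have "isomorphic_G_spaces M act K krengel_act"
    unfolding isomorphic_G_spaces_def
  proof (intro exI[of _ X1] exI[of _ ?Y] exI[of _ \<phi>] conjI allI)
    show "invariant_conull_borel M act X1" by (rule conull)
    show "invariant_conull_borel K krengel_act ?Y"
      unfolding invariant_conull_borel_def invariant_set_def
    proof (intro conjI allI ballI)
      show "?Y \<in> sets K" using sets.top[of K] by (simp only: space_K)
      show "space K - ?Y \<in> null_sets K" by (simp add: space_K)
      fix g z assume "z \<in> ?Y"
      then obtain w k where z: "z = (w, coset w k)" "w \<in> W" unfolding Y_eq by blast
      then have "krengel_act g z = (w, coset w (g + k))" by (simp add: krengel_act_def left_translate_coset)
      then show "krengel_act g z \<in> ?Y" using z(2) unfolding Y_eq by blast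
    qed
    show "bij_betw \<phi> X1 ?Y"
      unfolding bij_betw_def
    proof
      show "inj_on \<phi> X1"
      proof (rule inj_onI)
        fix x y assume x: "x \<in> X1" and y: "y \<in> X1" and eq: "\<phi> x = \<phi> y"
        obtain g where g: "x = act g (s x)" using \<phi>_form[OF x] by blast
        then have "g \<in> {g. act g (s x) = x}" by simp
        also have "{g. act g (s x) = x} = {g. act g (s y) = y}" using eq unfolding \<phi>_def by (rule Pair_inject)
        finally have "act g (s y) = y" by simp
        moreover have "s x = s y" using eq by (simp add: \<phi>_def)
        ultimately show "x = y" using g by simp
      qed
      show "\<phi> ` X1 = ?Y"
      proof (intro subset_antisym subsetI)
        fix z assume "z \<in> \<phi> ` X1"
        then obtain x where x: "x \<in> X1" "z = \<phi> x" by blast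
        then show "z \<in> ?Y" using \<phi>_form[OF x(1)] selector_W[OF x(1)] unfolding Y_eq by auto
      next
        fix z assume "z \<in> ?Y"
        then obtain w g where z: "z = (w, coset w g)" "w \<in> W" unfolding Y_eq by blast
        then have "z = \<phi> (act g w)" by (simp add: \<phi>_act)
        moreover have "act g w \<in> X1" using z(2) by (intro act_X1 W_X1)
        ultimately show "z \<in> \<phi> ` X1" by (rule image_eqI)
      qed
    qed
    show "\<phi> \<in> measurable ?X ?K" by (rule \<phi>_meas)
    show "measure_equiv (distr ?X ?K \<phi>) ?K"
    proof (rule measure_equivI_AE)
      fix A assume "A \<in> sets (distr ?X ?K \<phi>)"
      then have "A \<in> sets ?K" by simp
      then obtain A' where A': "A' \<in> sets B" "A = ?Y \<inter> A'"
        unfolding K sets_restrict_space by auto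
      then have AB: "A \<in> sets B" using Y by blast
      \<comment> \<open>The equivalences below bring both null ideals to the same form, almost every
        base point and \<open>haar\<close>-almost every \<open>g\<close>: \<open>AE_selector\<close>
        does so for \<open>M\<close>, while \<open>AE_\<nu>\<close> and \<open>AE_B\<close> lead
        from there to the Krengel space.\<close>
      define Q where "Q x \<longleftrightarrow> (x \<in> X1 \<longrightarrow> \<phi> x \<notin> A)" for x
      have Qm: "Measurable.pred M Q"
      proof -
        have "\<phi> -` A \<inter> space ?X \<in> sets ?X" by (rule measurable_sets[OF \<phi>_meas]) fact
        then have "\<phi> -` A \<inter> X1 \<in> sets M" using X1_sets X1_space unfolding spX by (subst (asm) sets_restrict_space_iff) auto
        then have "space M - (\<phi> -` A \<inter> X1) \<in> sets M" by blast
        also have "space M - (\<phi> -` A \<inter> X1) = {x \<in> space M. Q x}" by (auto simp: Q_def)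
        finally show ?thesis by (simp add: pred_def)
      qed
      have PA: "Measurable.pred (\<nu> \<Otimes>\<^sub>M ?E) (\<lambda>z. z \<notin> A)"
        using AB unfolding sets_B by measurable
      have "(AE z in distr ?X ?K \<phi>. z \<notin> A) \<longleftrightarrow> (AE x in ?X. \<phi> x \<notin> A)"
      proof (rule AE_distr_iff[OF \<phi>_meas])
        have "space ?K - A \<in> sets ?K"
          using \<open>A \<in> sets ?K\<close> by blast
        then show "{z \<in> space ?K. z \<notin> A} \<in> sets ?K"
          by (simp add: set_diff_eq)
      qed
      also have "\<dots> \<longleftrightarrow> (AE x in M. Q x)"
        unfolding Q_def by (rule AE_restrict_space_iff) (use X1_sets in auto)
      also have "\<dots> \<longleftrightarrow> (AE x in M. AE g in haar. Q (act g (selector' x)))"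
      proof (rule AE_selector[symmetric, OF Qm])
        show "measure_equiv M M" by (rule measure_equivI_AE) auto
      qed (rule selector'_orbit)
      also have "\<dots> \<longleftrightarrow> (AE x in M. x \<in> X1 \<longrightarrow> (AE g in haar. (s x, coset (s x) g) \<notin> A))"
      proof -
        have "(AE g in haar. Q (act g (selector' x))) \<longleftrightarrow> (AE g in haar. (s x, coset (s x) g) \<notin> A)" if x: "x \<in> X1" for x
          using x by (simp add: Q_def selector'_def act_X1 selector_X1 \<phi>_act selector_W)
        then show ?thesis by (intro eventually_subst eventually_mono[OF AE_X1]) simp
      qed
      also have "\<dots> \<longleftrightarrow> (AE w in \<nu>. AE g in haar. (w, coset w g) \<notin> A)"
      proof (rule AE_\<nu>[symmetric])
        have "Measurable.pred (\<nu> \<Otimes>\<^sub>M haar) (\<lambda>z. (fst z, coset (fst z) (snd z)) \<notin> A)"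
        proof -
          have "(\<lambda>(w, g). coset w g) \<in> measurable (\<nu> \<Otimes>\<^sub>M haar) ?E"
            using coset_pair_measurable measurable_cong_sets[OF sets_pair_measure_cong[OF refl sets_haar] refl] by blast
          then have "(\<lambda>z. (fst z, coset (fst z) (snd z))) \<in> measurable (\<nu> \<Otimes>\<^sub>M haar) (\<nu> \<Otimes>\<^sub>M ?E)"
            by (intro measurable_Pair measurable_fst) (simp add: case_prod_beta')
          from measurable_compose[OF this PA] show ?thesis .
        qed
        then have "Measurable.pred \<nu> (\<lambda>w. AE g in haar. (w, coset w g) \<notin> A)"
          using pred_AE_Pair[where N = \<nu> and P = "\<lambda>z. (fst z, coset (fst z) (snd z)) \<notin> A"] by simp
        then show "{w \<in> W. AE g in haar. (w, coset w g) \<notin> A} \<in> sets \<nu>" by (simp add: pred_def space_\<nu>)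
      qed
      also have "\<dots> \<longleftrightarrow> (AE z in B. z \<notin> A)" by (rule AE_B[symmetric, OF PA])
      also have "\<dots> \<longleftrightarrow> (AE z in K. z \<notin> A)"
        unfolding K using Y Ysp A'(2) by (subst AE_restrict_space_iff) (auto intro: AE_cong)
      also have "\<dots> \<longleftrightarrow> (AE z in ?K. z \<notin> A)"
        using space_K sets.top[of K] by (subst AE_restrict_space_iff) (auto intro: AE_cong)
      finally show "(AE z in distr ?X ?K \<phi>. z \<notin> A) \<longleftrightarrow> (AE z in ?K. z \<notin> A)" .
    qed simp
    show "AE x in M. x \<in> X1 \<longrightarrow> \<phi> (act g x) = krengel_act g (\<phi> x)" for g
    proof (intro AE_I2 impI)
      fix x assume x: "x \<in> X1"
      obtain k where k: "x = act k (s x)" "\<phi> x = (s x, coset (s x) k)" using \<phi>_form[OF x] by blast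
      have "act g x = act (g + k) (s x)" using k(1) X1_space[OF selector_X1[OF x]] by (simp add: act_add)
      then have "\<phi> (act g x) = (s x, coset (s x) (g + k))" by (simp add: \<phi>_act selector_W[OF x])
      then show "\<phi> (act g x) = krengel_act g (\<phi> x)"
        unfolding k(2) by (simp add: krengel_act_def left_translate_coset selector_W[OF x])
    qed
  qed
  then show ?thesis unfolding isomorphic_to_krengel_space_def K_def using kernel by blast
qed

end

theorem theoremG:
  fixes haar :: "'g::{topological_group_add, t2_space, second_countable_topology} measure"
    and M :: "'x measure"
    and act :: "'g \<Rightarrow> 'x \<Rightarrow> 'x"
  assumes "locally_compact_space (euclidean :: 'g topology)"
    and "left_haar_measure haar"
    and "nonsingular_G_space M act"
  shows "totally_dissipative haar M act \<longleftrightarrow>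
    (\<exists>X1 W s M'.
       invariant_conull_borel M act X1 \<and>
       (\<forall>x\<in>X1. compact (stabilizer act x)) \<and>
       borel_transversal M act X1 W \<and>
       borel_selector M act X1 W s \<and>
       prob_space M' \<and> measure_equiv M' M \<and>
       (let \<nu> = distr (restrict_space M' X1) (restrict_space M W) s in
          random_compact_subgroup \<nu> (stabilizer act) \<and>
          isomorphic_to_krengel_space M act \<nu> (stabilizer act)))"
    (is "_ \<longleftrightarrow> ?R")
proof
  interpret nonsingular_G haar M act
    using assms by unfold_locales (simp_all add: nonsingular_G_space_def)
  {
    assume "totally_dissipative haar M act"
    then obtain X1 W s where "transversal_G haar M act X1 W s" using dissipative_transversal by blast
    then interpret T: transversal_G haar M act X1 W s .
    interpret S: sigma_finite_measure M by (rule sigma_finite_M)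
    obtain M' where "prob_space M'" "measure_equiv M' M"
      using S.ex_equivalent_prob_space assms(3) by (auto simp: nonsingular_G_space_def)
    then interpret P: transversal_prob_G haar M act X1 W s M'
      by (intro transversal_prob_G.intro transversal_prob_G_axioms.intro T.transversal_G_axioms)
    show ?R
      using T.conull T.compact_stabilizer T.transversal T.selector P.prob_M' P.equiv_M'
        P.random_compact_subgroup_stabilizer P.isomorphic_to_krengel
      unfolding Let_def P.\<nu>_def by blast
  next
    assume ?R
    then obtain X1 W s where "invariant_conull_borel M act X1" "\<forall>x\<in>X1. compact (stabilizer act x)"
      "borel_transversal M act X1 W" "borel_selector M act X1 W s" by blast
    then interpret T: transversal_G haar M act X1 W s by unfold_locales auto
    show "totally_dissipative haar M act" by (rule T.totally_dissipative)
  }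
qed

end
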